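(* Suppose that $1<p<p_1\leq\infty$ and $\frac{1}{p}=1-\theta+\frac{\theta}{p_1}$, with $\theta\in(0,1)$. Then $$\big[H^1,L^{p_1}\big]_{\theta,p}=L^p.$$
   Context: Let $d\geq 1$ be an integer and $S=\mathbb{R}^d\ltimes\mathbb{R}^+$ the group with product $(x,a)\cdot(x',a')=(x+a\,x',a\,a')$, endowed with the right Haar measure $d\rho(x,a)=a^{-1}\,dx\,da$. Write $L^p=L^p(S,\rho)$ with norm $\|\cdot\|_p$. A Calderón--Zygmund set is a set $R=Q\times[ae^{-r},ae^r]$, where $Q$ is a dyadic cube in $\mathbb{R}^d$ of side $L$, $a\in\mathbb{R}^+$, $r>0$, and $e^2ar\leq L<e^8ar$ if $r<1$, while $ae^{2r}\leq L<ae^{8r}$ if $r\geq1$. $H^1=H^{1,\infty}$ consists of all $h\in L^1$ such that $h=\sum_j\lambda_ja_j$ with $\sum_j|\lambda_j|<\infty$, $\lambda_j\in\mathbb{C}$, and $a_j$ $(1,\infty)$-atoms, i.e. functions supported in a Calderón--Zygmund set $R$ with $\|a_j\|_\infty\leq\rho(R)^{-1}$ and $\int a_j\,d\rho=0$; $\|h\|_{H^1}$ is the infimum of $\sum_j|\lambda_j|$ over all such decompositions. For two compatible normed spaces $X_0,X_1$, $t>0$ and $x\in X_0+X_1$, let $K(t,x;X_0,X_1)=\inf\{\|x_0\|_{X_0}+t\|x_1\|_{X_1}: x=x_0+x_1,\ x_i\in X_i\}$. For $q\in[1,\infty]$, $\theta\in(0,1)$, the real interpolation space $[X_0,X_1]_{\theta,q}$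 is the set of $x\in X_0+X_1$ for which $\|x\|_{\theta,q}<\infty$, where $\|x\|_{\theta,q}=\big(\int_0^\infty[t^{-\theta}K(t,x;X_0,X_1)]^q\frac{dt}{t}\big)^{1/q}$ if $q<\infty$ and $\|x\|_{\theta,\infty}=\sup_{t>0}t^{-\theta}K(t,x;X_0,X_1)$. Equality of interpolation spaces is understood with equivalence of norms. *)

theory Defs
  imports
    "HOL-Analysis.Analysis"
    "HOL-Probability.Essential_Supremum"
    "HOL-Library.Function_Algebras"
begin

section \<open>The group and its right Haar measure\<close>

text \<open>
  The group is the upper half-space inside \<^typ>\<open>(real^'n) \<times> real\<close>, so that the dimension \<open>d\<close> is
  \<^term>\<open>CARD('n)\<close>, which is automatically at least 1.
\<close>

definition axb_set :: "((real^'n) \<times> real) set" where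
  "axb_set = UNIV \<times> {0<..}"

definition axb_mult :: "(real^'n) \<times> real \<Rightarrow> (real^'n) \<times> real \<Rightarrow> (real^'n) \<times> real" where
  "axb_mult z w = (fst z + snd z *\<^sub>R fst w, snd z * snd w)"

definition rho :: "((real^'n) \<times> real) measure" where
  "rho = density (restrict_space lborel axb_set) (\<lambda>z. ennreal (1 / snd z))"

lemma axb_set_borel [measurable]: "axb_set \<in> sets borel"
proof -
  have "open (axb_set :: ((real^'n) \<times> real) set)"
    unfolding axb_set_def by (intro open_Times) auto
  then show ?thesis by (rule borel_open)
qed

lemma nn_integral_rho:
  fixes f :: "(real^'n) \<times> real \<Rightarrow> ennreal"
  assumes [measurable]: "f \<in> borel_measurable borel"
  shows "(\<integral>\<^sup>+z. f z \<partial>rho)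
    = (\<integral>\<^sup>+a. (\<integral>\<^sup>+x. f (x, a) \<partial>lborel) * (ennreal (1 / a) * indicator {0<..} a) \<partial>lborel)"
proof -
  have [measurable]: "(snd :: (real^'n) \<times> real \<Rightarrow> real) \<in> borel_measurable borel"
    by (intro borel_measurable_continuous_onI continuous_intros)
  have m: "(\<lambda>z::(real^'n) \<times> real. f z * (ennreal (1 / snd z) * indicator {0<..} (snd z)))
      \<in> borel_measurable (lborel \<Otimes>\<^sub>M lborel)"
  proof -
    have "indicator axb_set z = (indicator {0<..} (snd z) :: ennreal)" for z :: "(real^'n) \<times> real"
      by (cases z) (auto simp: axb_set_def indicator_def)
    moreover have "(\<lambda>z::(real^'n) \<times> real. f z * (ennreal (1 / snd z) * indicator axb_set z))
        \<in> borel_measurable borel"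
      by measurable
    ultimately show ?thesis
      by (simp add: lborel_prod)
  qed
  have "(\<integral>\<^sup>+z. f z \<partial>rho)
      = (\<integral>\<^sup>+z. ennreal (1 / snd z) * f z \<partial>restrict_space lborel axb_set)"
    unfolding rho_def
    by (subst nn_integral_density) (auto intro!: measurable_restrict_space1)
  also have "\<dots> = (\<integral>\<^sup>+z. ennreal (1 / snd z) * f z * indicator axb_set z \<partial>lborel)"
    by (rule nn_integral_restrict_space) auto
  also have "\<dots> = (\<integral>\<^sup>+z. f z * (ennreal (1 / snd z) * indicator {0<..} (snd z))
      \<partial>(lborel \<Otimes>\<^sub>M lborel))"
    unfolding lborel_prod
    by (intro nn_integral_cong) (auto simp: axb_set_def indicator_def mult_ac)
  also have "\<dots> = (\<integral>\<^sup>+a. (\<integral>\<^sup>+x. f (x, a) * (ennreal (1 / a) * indicator {0<..} a) \<partial>lborel) \<partial>lborel)"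
    using lborel_pair.nn_integral_snd[OF m] by simp
  also have "\<dots> = (\<integral>\<^sup>+a. (\<integral>\<^sup>+x. f (x, a) \<partial>lborel) * (ennreal (1 / a) * indicator {0<..} a) \<partial>lborel)"
    by (intro nn_integral_cong nn_integral_multc) measurable
  finally show ?thesis .
qed

lemma rho_right_invariant:
  fixes f :: "(real^'n) \<times> real \<Rightarrow> ennreal"
  assumes [measurable]: "f \<in> borel_measurable borel" and w: "w \<in> axb_set"
  shows "(\<integral>\<^sup>+z. f (axb_mult z w) \<partial>rho) = (\<integral>\<^sup>+z. f z \<partial>rho)"
proof -
  obtain y b where wb: "w = (y, b)" and b: "b > 0"
    using w by (auto simp: axb_set_def)
  define g where "g a = (\<integral>\<^sup>+x. f (x, a) \<partial>lborel)" for a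
  have [measurable]: "g \<in> borel_measurable borel"
  proof -
    have "(\<lambda>(a, x). f (x, a)) \<in> borel_measurable (borel \<Otimes>\<^sub>M lborel)"
      by measurable
    then show ?thesis
      unfolding g_def using lborel.borel_measurable_nn_integral[of "\<lambda>a x. f (x, a)" borel] by simp
  qed
  have shift: "(\<integral>\<^sup>+x. f (x + c, a) \<partial>lborel) = g a" for c a
  proof -
    have "g a = (\<integral>\<^sup>+x. f (x, a) \<partial>distr lborel borel ((+) c))"
      by (simp add: g_def lborel_distr_plus)
    also have "\<dots> = (\<integral>\<^sup>+x. f (c + x, a) \<partial>lborel)"
      by (subst nn_integral_distr) auto
    finally show ?thesis by (simp add: add.commute)
  qed
  have "(\<integral>\<^sup>+z. f (axb_mult z w) \<partial>rho)
      = (\<integral>\<^sup>+a. (\<integral>\<^sup>+x. f (axb_mult (x, a) w) \<partial>lborel)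
          * (ennreal (1 / a) * indicator {0<..} a) \<partial>lborel)"
  proof (rule nn_integral_rho)
    have "(\<lambda>z. axb_mult z w) \<in> borel_measurable borel"
      unfolding axb_mult_def by (intro borel_measurable_continuous_onI continuous_intros)
    then show "(\<lambda>z. f (axb_mult z w)) \<in> borel_measurable borel"
      by measurable
  qed
  also have "\<dots> = (\<integral>\<^sup>+a. g (b * a) * (ennreal (1 / a) * indicator {0<..} a) \<partial>lborel)"
    by (simp add: axb_mult_def wb shift mult.commute[of _ b])
  also have "\<dots> = (\<integral>\<^sup>+a. ennreal b * (g (b * a) * (ennreal (1 / (b * a)) * indicator {0<..} (b * a))) \<partial>lborel)"
  proof (intro nn_integral_cong)
    fix a :: real
    have "ennreal (1 / a) = ennreal b * ennreal (1 / (b * a))" if "a > 0"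
      using that b by (subst ennreal_mult[symmetric]) auto
    then show "g (b * a) * (ennreal (1 / a) * indicator {0<..} a)
        = ennreal b * (g (b * a) * (ennreal (1 / (b * a)) * indicator {0<..} (b * a)))"
      using b by (auto simp: indicator_def zero_less_mult_iff mult_ac)
  qed
  also have "\<dots> = ennreal \<bar>b\<bar> * (\<integral>\<^sup>+a. g (0 + b * a) * (ennreal (1 / (0 + b * a)) * indicator {0<..} (0 + b * a)) \<partial>lborel)"
    using b by (subst nn_integral_cmult) auto
  also have "\<dots> = (\<integral>\<^sup>+a. g a * (ennreal (1 / a) * indicator {0<..} a) \<partial>lborel)"
    using b by (intro nn_integral_real_affine[symmetric]) auto
  also have "\<dots> = (\<integral>\<^sup>+z. f z \<partial>rho)"
    by (simp add: nn_integral_rho g_def)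
  finally show ?thesis .
qed


section \<open>Normed spaces and Lebesgue spaces\<close>

text \<open>
  A normed space is given by its carrier inside an ambient group together with its norm. Spaces of
  functions modulo equality almost everywhere are represented by all their representatives (the
  carriers are closed under almost everywhere equality of measurable functions), so that the norm is
  only a seminorm on the carrier.
\<close>

record 'v nspace =
  carr :: "'v set"
  nrm :: "'v \<Rightarrow> real"

definition nspace_equiv :: "'v nspace \<Rightarrow> 'v nspace \<Rightarrow> bool" where
  "nspace_equiv X Y \<longleftrightarrow> carr X = carr Y \<and>
    (\<exists>c>0. \<exists>C>0. \<forall>x\<in>carr X. c * nrm X x \<le> nrm Y x \<and> nrm Y x \<le> C * nrm X x)"

definition ennreal_powr :: "ennreal \<Rightarrow> real \<Rightarrow> ennreal" where
  "ennreal_powr x s = (if x = \<infinity> then \<infinity> else ennreal (enn2real x powr s))"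

text \<open>For exponents \<open>1 \<le> p \<le> \<infinity>\<close>.\<close>

definition Lp_enorm :: "'a measure \<Rightarrow> ereal \<Rightarrow> ('a \<Rightarrow> complex) \<Rightarrow> ennreal" where
  "Lp_enorm M p f =
    (if p = \<infinity> then esssup M (\<lambda>z. ennreal (cmod (f z)))
     else ennreal_powr (\<integral>\<^sup>+z. ennreal (cmod (f z) powr real_of_ereal p) \<partial>M) (1 / real_of_ereal p))"

definition Lp :: "'a measure \<Rightarrow> ereal \<Rightarrow> ('a \<Rightarrow> complex) nspace" where
  "Lp M p = \<lparr>carr = {f \<in> borel_measurable M. Lp_enorm M p f < \<infinity>},
             nrm = (\<lambda>f. enn2real (Lp_enorm M p f))\<rparr>"


section \<open>The atomic Hardy space\<close>

definition dyadic_cube :: "(real^'n) set \<Rightarrow> real \<Rightarrow> bool" where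
  "dyadic_cube Q L \<longleftrightarrow> (\<exists>(k::int) (m::'n \<Rightarrow> int). L = 2 powi k \<and>
    Q = {x. \<forall>i. of_int (m i) * L \<le> x $ i \<and> x $ i < (of_int (m i) + 1) * L})"

definition CZ_set :: "((real^'n) \<times> real) set \<Rightarrow> bool" where
  "CZ_set R \<longleftrightarrow> (\<exists>Q L a r. dyadic_cube Q L \<and> 0 < a \<and> 0 < r \<and>
    R = Q \<times> {a * exp (- r)..a * exp r} \<and>
    (r < 1 \<longrightarrow> exp 2 * a * r \<le> L \<and> L < exp 8 * a * r) \<and>
    (1 \<le> r \<longrightarrow> a * exp (2 * r) \<le> L \<and> L < a * exp (8 * r)))"

definition H1_atom :: "((real^'n) \<times> real \<Rightarrow> complex) \<Rightarrow> bool" where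
  "H1_atom f \<longleftrightarrow> (\<exists>R. CZ_set R \<and> f \<in> carr (Lp rho \<infinity>) \<and>
    (AE z in rho. z \<notin> R \<longrightarrow> f z = 0) \<and>
    nrm (Lp rho \<infinity>) f \<le> 1 / measure rho R \<and>
    (\<integral>z. f z \<partial>rho) = 0)"

text \<open>
  The series converges in \<open>L\<^sup>1\<close>. Finite sums are included, since coefficients may vanish.
\<close>

definition atomic_decomp ::
  "((real^'n) \<times> real \<Rightarrow> complex) \<Rightarrow> (nat \<Rightarrow> complex) \<Rightarrow> (nat \<Rightarrow> (real^'n) \<times> real \<Rightarrow> complex) \<Rightarrow> bool" where
  "atomic_decomp h c A \<longleftrightarrow>
    (\<forall>j. H1_atom (A j)) \<and> summable (\<lambda>j. cmod (c j)) \<and>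
    (\<lambda>N. nrm (Lp rho 1) (\<lambda>z. h z - (\<Sum>j<N. c j * A j z))) \<longlonglongrightarrow> 0"

definition H1 :: "((real^'n) \<times> real \<Rightarrow> complex) nspace" where
  "H1 = \<lparr>carr = {h \<in> carr (Lp rho 1). \<exists>c A. atomic_decomp h c A},
         nrm = (\<lambda>h. Inf {\<Sum>j. cmod (c j) |c. \<exists>A. atomic_decomp h c A})\<rparr>"


section \<open>Real interpolation\<close>

definition sum_carr :: "'v::ab_group_add nspace \<Rightarrow> 'v nspace \<Rightarrow> 'v set" where
  "sum_carr X0 X1 = {x0 + x1 |x0 x1. x0 \<in> carr X0 \<and> x1 \<in> carr X1}"

definition K_functional :: "real \<Rightarrow> 'v::ab_group_add \<Rightarrow> 'v nspace \<Rightarrow> 'v nspace \<Rightarrow> real" where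
  "K_functional t x X0 X1 =
    Inf {nrm X0 x0 + t * nrm X1 x1 |x0 x1. x0 \<in> carr X0 \<and> x1 \<in> carr X1 \<and> x = x0 + x1}"

definition interp_enorm ::
  "'v::ab_group_add nspace \<Rightarrow> 'v nspace \<Rightarrow> real \<Rightarrow> ereal \<Rightarrow> 'v \<Rightarrow> ennreal" where
  "interp_enorm X0 X1 \<theta> q x =
    (if q = \<infinity> then (SUP t\<in>{0<..}. ennreal (t powr (- \<theta>) * K_functional t x X0 X1))
     else ennreal_powr
       (\<integral>\<^sup>+t\<in>{0<..}. ennreal ((t powr (- \<theta>) * K_functional t x X0 X1) powr real_of_ereal q / t) \<partial>lborel)
       (1 / real_of_ereal q))"

definition real_interp ::
  "'v::ab_group_add nspace \<Rightarrow> 'v nspace \<Rightarrow> real \<Rightarrow> ereal \<Rightarrow> 'v nspace" where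
  "real_interp X0 X1 \<theta> q =
    \<lparr>carr = {x \<in> sum_carr X0 X1. interp_enorm X0 X1 \<theta> q x < \<infinity>},
     nrm = (\<lambda>x. enn2real (interp_enorm X0 X1 \<theta> q x))\<rparr>"

end

theory Submission
  imports Defs
begin

text \<open>
  Write \<open>q\<close> for the conjugate exponent of \<open>p\<^sub>1\<close>, so that \<open>\<theta> p = q (p - 1)\<close>, and \<open>K(t)\<close> for the
  \<open>K\<close>-functional of \<open>f\<close>. Both inclusions compare \<open>K\<close> with a distribution function of \<open>f\<close> and then
  exchange two integrals; the measure \<open>q t\<^sup>q\<^sup>-\<^sup>1 dt\<close> gives the set of all \<open>t\<close> with \<open>t\<^sup>q < m\<close> the mass \<open>m\<close>.

  From the interpolation space into \<open>L\<^sup>p\<close>: the \<open>H\<^sup>1\<close>-norm dominates the \<open>L\<^sup>1\<close>-norm. If \<open>f = x\<^sub>0 + x\<^sub>1\<close>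
  and the set where \<open>\<bar>f\<bar> > v\<close> has measure larger than \<open>t\<^sup>q\<close>, then \<open>x\<^sub>0\<close> or \<open>x\<^sub>1\<close> exceeds \<open>v/2\<close> on a
  set of measure larger than \<open>t\<^sup>q/2\<close>, and Markov's inequality gives \<open>v t\<^sup>q \<le> 4 K(t)\<close>
  (\<open>level_le_K_functional\<close>). With the layer cake formula for the \<open>L\<^sup>p\<close>-norm this bounds \<open>\<parallel>f\<parallel>\<^sub>p\<close>.

  From \<open>L\<^sup>p\<close> into the interpolation space: let \<open>\<Phi>(v)\<close> be the sum over \<open>n \<ge> 0\<close> of the integrals of
  \<open>\<bar>f\<bar>\<close> over the sets where \<open>\<bar>f\<bar> > 2\<^sup>n v / 2\<close>. The Calderon--Zygmund decomposition at height \<open>v\<close> writes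
  \<open>f = b + g\<close> with \<open>\<bar>g\<bar> \<le> 2\<^sup>d v\<close>, with \<open>g = f\<close> outside a set of measure at most \<open>2 \<Phi>(v) / v\<close>, and
  with \<open>\<parallel>b\<parallel> \<le> C \<Phi>(v)\<close> in \<open>H\<^sup>1\<close> (\<open>H1_decomposition\<close>). The last bound comes from decomposing at all the
  heights \<open>2\<^sup>n v\<close> along one and the same tree of Calderon--Zygmund sets: \<open>b\<close> is the telescoping sum of the
  differences of consecutive good functions. On a maximal set of height \<open>2\<^sup>n v\<close> such a difference has
  mean zero and is bounded by \<open>3 \<cdot> 2\<^sup>d 2\<^sup>n v\<close>, so it is a multiple of a bounded atom. Consequently
  \<open>K(t) \<le> C v t\<^sup>q\<close> as soon as \<open>D(v) \<le> t\<^sup>q\<close>, where \<open>D(v)\<close> is \<open>\<Phi>(v) / v\<close> plus, for finite \<open>p\<^sub>1\<close>, the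
  integral of \<open>min (\<bar>f\<bar> / v) 1\<close> to the power \<open>p\<^sub>1\<close> (\<open>K_functional_le_excess\<close>). Read backwards,
  \<open>v < K(t) / (C t\<^sup>q)\<close> forces \<open>t\<^sup>q < D(v)\<close>, and the interpolation norm is controlled by the integral of
  \<open>p v\<^sup>p\<^sup>-\<^sup>1 D(v)\<close>. By Tonelli this is at most a constant times \<open>\<parallel>f\<parallel>\<^sub>p\<^sup>p\<close>: the first part of \<open>D\<close> converges
  because \<open>p > 1\<close>, the second because \<open>p < p\<^sub>1\<close>.

  The tree of sets exists since every Calderon--Zygmund set splits into Calderon--Zygmund sets of comparable
  measure, by halving either the cube or the interval in logarithmic scale (\<open>cz_boxes_split\<close>), and since the
  group has partitions into Calderon--Zygmund sets of arbitrarily large measure (\<open>ex_cz_box_partition\<close>).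
\<close>

section \<open>Trees of partitions\<close>

lemma enumerate_disjoint_family:
  assumes "countable S" "disjoint S"
  obtains A :: "nat \<Rightarrow> 'a set"
  where "disjoint_family A" "range A \<subseteq> insert {} S" "S \<subseteq> range A" "(\<Union>i. A i) = \<Union>S"
proof
  define A where "A i = (if i \<in> to_nat_on S ` S then from_nat_into S i else {})" for i
  show 1: "range A \<subseteq> insert {} S"
    using assms(1) by (auto simp: A_def)
  show 2: "S \<subseteq> range A"
  proof
    fix R assume "R \<in> S"
    then have "A (to_nat_on S R) = R"
      using assms(1) by (auto simp: A_def)
    then show "R \<in> range A" by (metis rangeI)
  qed
  show "(\<Union>i. A i) = \<Union>S"
    using 1 2 by blast
  have "A i \<inter> A j = {}" if "i \<noteq> j" for i j
  proof (rule ccontr)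
    assume ne: "A i \<inter> A j \<noteq> {}"
    then obtain R R' where R: "R \<in> S" "i = to_nat_on S R" "R' \<in> S" "j = to_nat_on S R'"
      by (auto simp: A_def split: if_splits)
    then have "A i = R" "A j = R'" "R \<noteq> R'"
      using assms(1) that by (auto simp: A_def)
    then show False
      using assms(2) R ne by (auto simp: disjoint_def)
  qed
  then show "disjoint_family A"
    by (auto simp: disjoint_family_on_def)
qed

lemma nn_integral_Union_suminf:
  assumes [measurable]: "f \<in> borel_measurable M" "\<And>i::nat. A i \<in> sets M"
    and "disjoint_family A"
  shows "(\<integral>\<^sup>+z. f z * indicator (\<Union>i. A i) z \<partial>M) = (\<Sum>i. \<integral>\<^sup>+z. f z * indicator (A i) z \<partial>M)"
proof -
  have "(\<integral>\<^sup>+z. f z * indicator (\<Union>i. A i) z \<partial>M) = (\<integral>\<^sup>+z. (\<Sum>i. f z * indicator (A i) z) \<partial>M)"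
    using assms(3) by (intro nn_integral_cong) (simp add: suminf_indicator)
  also have "\<dots> = (\<Sum>i. \<integral>\<^sup>+z. f z * indicator (A i) z \<partial>M)"
    by (rule nn_integral_suminf) simp
  finally show ?thesis .
qed

abbreviation mass_on :: "'a measure \<Rightarrow> ('a \<Rightarrow> complex) \<Rightarrow> 'a set \<Rightarrow> ennreal" where
  "mass_on M f E \<equiv> \<integral>\<^sup>+z. ennreal (cmod (f z)) * indicator E z \<partial>M"

abbreviation power_mass :: "'a measure \<Rightarrow> real \<Rightarrow> ('a \<Rightarrow> complex) \<Rightarrow> ennreal" where
  "power_mass M p f \<equiv> \<integral>\<^sup>+z. ennreal (cmod (f z) powr p) \<partial>M"

abbreviation height_weight :: "real \<Rightarrow> real \<Rightarrow> ennreal" where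
  "height_weight p v \<equiv> ennreal (p * v powr (p - 1)) * indicator {0<..} v"

text \<open>
  The last assumption stands in for the topology: outer regularity together with the fact that the sets of
  the tree around a point shrink to it. It is all that the differentiation of integrals below requires.
\<close>

locale partition_tree =
  fixes M :: "'a measure" and gen :: "nat \<Rightarrow> 'a set set" and \<kappa> :: real
  assumes gen_countable: "countable (gen n)"
    and gen_disjoint: "disjoint (gen n)"
    and gen_cover: "\<Union>(gen n) = space M"
    and gen_sets: "R \<in> gen n \<Longrightarrow> R \<in> sets M"
    and gen_pos: "R \<in> gen n \<Longrightarrow> 0 < measure M R"
    and gen_parent: "R \<in> gen (Suc n) \<Longrightarrow> \<exists>R'\<in>gen n. R \<subseteq> R' \<and> measure M R' \<le> \<kappa> * measure M R"
    and kappa_ge_1: "1 \<le> \<kappa>"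
    and outer_approx: "A \<in> sets M \<Longrightarrow> emeasure M A < \<infinity> \<Longrightarrow> 0 < e \<Longrightarrow>
      \<exists>U\<in>sets M. A \<subseteq> U \<and> emeasure M U \<le> emeasure M A + ennreal e \<and>
        (\<forall>z\<in>U. \<exists>n. \<exists>R\<in>gen n. z \<in> R \<and> R \<subseteq> U)"
begin

lemma gen_finite: "R \<in> gen n \<Longrightarrow> emeasure M R = ennreal (measure M R)"
  using gen_pos[of R n] by (intro emeasure_eq_ennreal_measure) (auto simp: measure_def)

lemma ancestor: "R \<in> gen (m + k) \<Longrightarrow> \<exists>R'\<in>gen m. R \<subseteq> R'"
proof (induction k arbitrary: R)
  case (Suc k)
  then obtain R1 where "R1 \<in> gen (m + k)" "R \<subseteq> R1"
    using gen_parent[of R "m + k"] by auto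
  moreover obtain R2 where "R2 \<in> gen m" "R1 \<subseteq> R2"
    using Suc.IH[OF \<open>R1 \<in> gen (m + k)\<close>] by blast
  ultimately show ?case by (meson subset_trans)
qed auto

lemma nested:
  assumes "m \<le> n" "R' \<in> gen m" "R \<in> gen n" "R \<inter> R' \<noteq> {}"
  shows "R \<subseteq> R'"
proof -
  obtain R1 where R1: "R1 \<in> gen m" "R \<subseteq> R1"
    using ancestor[of R m "n - m"] assms(1,3) by auto
  then have "R1 = R'"
    using gen_disjoint[of m] assms(2,4)
    unfolding disjoint_def by blast
  then show ?thesis using R1 by simp
qed

text \<open>
  The sets at which the descent from the roots first meets the property \<open>B\<close>.
\<close>

definition stopped :: "('a set \<Rightarrow> bool) \<Rightarrow> 'a set set" where
  "stopped B = {R. \<exists>n. R \<in> gen n \<and> B R \<and> (\<forall>m<n. \<forall>R'\<in>gen m. R \<subseteq> R' \<longrightarrow> \<not> B R')}"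

lemma stopped_gen: "R \<in> stopped B \<Longrightarrow> \<exists>n. R \<in> gen n"
  unfolding stopped_def by blast

lemma countable_stopped: "countable (stopped B)"
proof (rule countable_subset)
  show "stopped B \<subseteq> (\<Union>n. gen n)" using stopped_gen by blast
qed (simp add: gen_countable)

lemma stopped_sets: "R \<in> stopped B \<Longrightarrow> R \<in> sets M"
  using stopped_gen gen_sets by blast

text \<open>
  A set stopped for the stronger property \<open>B'\<close> also has the property \<open>B\<close>, so it cannot properly contain a
  set stopped for \<open>B\<close>.
\<close>

lemma stopped_mono:
  assumes "\<And>R. B' R \<Longrightarrow> B R" and "R' \<in> stopped B'" "R \<in> stopped B"
  shows "R' \<subseteq> R \<or> R' \<inter> R = {}"
proof (rule ccontr)
  assume neg: "\<not> (R' \<subseteq> R \<or> R' \<inter> R = {})"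
  obtain n where n: "R \<in> gen n" "\<And>m R'. m < n \<Longrightarrow> R' \<in> gen m \<Longrightarrow> R \<subseteq> R' \<Longrightarrow> \<not> B R'"
    using assms(3) unfolding stopped_def mem_Collect_eq by metis
  obtain m where m: "R' \<in> gen m" "B' R'"
    using assms(2) unfolding stopped_def mem_Collect_eq by metis
  show False
  proof (cases "n \<le> m")
    case True
    then show ?thesis using nested[OF True n(1) m(1)] neg by blast
  next
    case False
    then have "R \<subseteq> R'" using nested[of m n R' R] n m neg by auto
    then show ?thesis using False n(2)[OF _ m(1)] assms(1)[OF m(2)] by simp
  qed
qed

lemma disjoint_stopped: "disjoint (stopped B)"
  unfolding disjoint_def using stopped_mono[of B B] by blast

lemma bad_subset_stopped:
  assumes "R \<in> gen n" "B R"
  shows "R \<subseteq> \<Union>(stopped B)"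
proof -
  define P where "P m \<longleftrightarrow> (\<exists>R'\<in>gen m. R \<subseteq> R' \<and> B R')" for m
  have "P n" using assms by (auto simp: P_def)
  then have L: "P (LEAST m. P m)" by (rule LeastI)
  have min: "\<not> P m" if "m < (LEAST m. P m)" for m
    using that by (rule not_less_Least)
  obtain R' where R': "R' \<in> gen (LEAST m. P m)" "R \<subseteq> R'" "B R'"
    using L unfolding P_def by auto
  have "R' \<in> stopped B"
    unfolding stopped_def
  proof (intro CollectI exI[of _ "LEAST m. P m"] conjI allI impI ballI)
    fix m R1 assume "m < (LEAST m. P m)" "R1 \<in> gen m" "R' \<subseteq> R1"
    then show "\<not> B R1" using min[of m] R'(2) unfolding P_def by blast
  qed (use R' in auto)
  then show ?thesis using R'(2) by blast
qed

lemma stopped_bad: "R \<in> stopped B \<Longrightarrow> B R"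
  unfolding stopped_def by blast

lemma stopped_enum:
  obtains S where "disjoint_family S" "range S \<subseteq> insert {} (stopped B)" "stopped B \<subseteq> range S"
    "(\<Union>i::nat. S i) = \<Union>(stopped B)" "range S \<subseteq> sets M"
proof -
  obtain S :: "nat \<Rightarrow> 'a set" where S: "disjoint_family S" "range S \<subseteq> insert {} (stopped B)" "stopped B \<subseteq> range S"
    "(\<Union>i. S i) = \<Union>(stopped B)"
    by (rule enumerate_disjoint_family[OF countable_stopped disjoint_stopped])
  have "S i \<in> sets M" for i
  proof -
    have "S i \<in> insert {} (stopped B)" using S(2) by blast
    then show ?thesis using stopped_sets by auto
  qed
  then have "range S \<subseteq> sets M" by blast
  from that[OF S this] show ?thesis .
qed

lemma Union_stopped_sets [measurable]: "\<Union>(stopped B) \<in> sets M"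
  using stopped_sets countable_stopped by (intro sets.countable_Union) auto

end

section \<open>Calderon--Zygmund decomposition along a tree\<close>

definition tail_mass :: "'a measure \<Rightarrow> ('a \<Rightarrow> complex) \<Rightarrow> real \<Rightarrow> ennreal" where
  "tail_mass M f l = (\<integral>\<^sup>+z. ennreal (cmod (f z)) * indicator {z. l < cmod (f z)} z \<partial>M)"

text \<open>
  The value \<open>\<bar>f z\<bar>\<close> is counted once for every \<open>n\<close> with \<open>2\<^sup>n l / 2 < \<bar>f z\<bar>\<close>, that is, about
  \<open>log\<^sub>2 (2 \<bar>f z\<bar> / l)\<close> times: this is an \<open>L log L\<close> quantity above the height \<open>l\<close>.
\<close>

definition log_tail_mass :: "'a measure \<Rightarrow> ('a \<Rightarrow> complex) \<Rightarrow> real \<Rightarrow> ennreal" where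
  "log_tail_mass M f l = (\<Sum>n. tail_mass M f (2 ^ n * l / 2))"

lemma tail_mass_antimono: "l \<le> l' \<Longrightarrow> tail_mass M f l' \<le> tail_mass M f l"
  unfolding tail_mass_def by (intro nn_integral_mono mult_left_mono) (auto split: split_indicator)

lemma tail_mass_le_log: "tail_mass M f (l / 2) \<le> log_tail_mass M f l"
  unfolding log_tail_mass_def
  using sum_le_suminf[of "\<lambda>n. tail_mass M f (2 ^ n * l / 2)" "{0}"] by simp

lemma mass_le_tail_mass:
  assumes [measurable]: "f \<in> borel_measurable M" "E \<in> sets M" and l: "0 \<le> l"
  shows "mass_on M f E \<le> ennreal l * emeasure M E
    + (\<integral>\<^sup>+z. ennreal (cmod (f z)) * indicator {z. l < cmod (f z)} z * indicator E z \<partial>M)"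
proof -
  have "mass_on M f E
      \<le> (\<integral>\<^sup>+z. ennreal l * indicator E z
          + ennreal (cmod (f z)) * indicator {z. l < cmod (f z)} z * indicator E z \<partial>M)"
    by (intro nn_integral_mono) (use l in \<open>auto split: split_indicator intro!: ennreal_leI\<close>)
  also have "\<dots> = ennreal l * emeasure M E
      + (\<integral>\<^sup>+z. ennreal (cmod (f z)) * indicator {z. l < cmod (f z)} z * indicator E z \<partial>M)"
    by (subst nn_integral_add) (auto simp: nn_integral_cmult_indicator)
  finally show ?thesis .
qed

text \<open>
  The averages over the roots are at most \<open>l\<^sub>0\<close>, so at every height \<open>l \<ge> l\<^sub>0\<close> the stopped sets have a
  parent whose average is at most \<open>l\<close>.
\<close>

locale calderon_zygmund = partition_tree M gen \<kappa>
  for M :: "'a measure" and gen :: "nat \<Rightarrow> 'a set set" and \<kappa> :: real +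
  fixes f :: "'a \<Rightarrow> complex" and l\<^sub>0 :: real
  assumes f_meas [measurable]: "f \<in> borel_measurable M"
    and l0_pos: "0 < l\<^sub>0"
    and tail_finite: "tail_mass M f (l\<^sub>0 / 2) < \<infinity>"
    and roots: "R \<in> gen 0 \<Longrightarrow>
      mass_on M f R \<le> ennreal (l\<^sub>0 * measure M R)"
begin

definition bad :: "real \<Rightarrow> 'a set \<Rightarrow> bool" where
  "bad l R \<longleftrightarrow> ennreal (l * measure M R) < mass_on M f R"

abbreviation max_bad :: "real \<Rightarrow> 'a set set" where
  "max_bad l \<equiv> stopped (bad l)"

abbreviation bad_set :: "real \<Rightarrow> 'a set" where
  "bad_set l \<equiv> \<Union>(max_bad l)"

lemma bad_mono: "l \<le> l' \<Longrightarrow> bad l' R \<Longrightarrow> bad l R"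
  unfolding bad_def by (meson ennreal_leI le_less_trans measure_nonneg mult_right_mono)

lemma max_bad_pos: "R \<in> max_bad l \<Longrightarrow> 0 < measure M R"
  using stopped_gen gen_pos by blast

lemma max_bad_finite: "R \<in> max_bad l \<Longrightarrow> emeasure M R = ennreal (measure M R)"
  using stopped_gen gen_finite by blast

text \<open>
  The parent was not bad, and its measure is at most \<open>\<kappa>\<close> times that of its child.
\<close>

lemma max_bad_mass_le:
  assumes l: "l\<^sub>0 \<le> l" and R: "R \<in> max_bad l"
  shows "mass_on M f R \<le> ennreal (\<kappa> * l * measure M R)"
proof -
  obtain n where n: "R \<in> gen n" "bad l R"
      "\<And>m R'. m < n \<Longrightarrow> R' \<in> gen m \<Longrightarrow> R \<subseteq> R' \<Longrightarrow> \<not> bad l R'"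
    using R unfolding stopped_def mem_Collect_eq by metis
  show ?thesis
  proof (cases n)
    case 0
    then have "bad l\<^sub>0 R" using bad_mono[OF l n(2)] by simp
    then show ?thesis using roots[of R] n(1) 0 by (simp add: bad_def)
  next
    case (Suc k)
    then obtain R' where R': "R' \<in> gen k" "R \<subseteq> R'" "measure M R' \<le> \<kappa> * measure M R"
      using gen_parent[of R k] n(1) by auto
    have "mass_on M f R
        \<le> (\<integral>\<^sup>+z. ennreal (cmod (f z)) * indicator R' z \<partial>M)"
      using R'(2) by (intro nn_integral_mono mult_left_mono) (auto split: split_indicator)
    also have "\<dots> \<le> ennreal (l * measure M R')"
      using n(3)[of k R'] R' Suc by (simp add: bad_def not_less)
    also have "l * measure M R' \<le> l * (\<kappa> * measure M R)"
      using R'(3) l l0_pos by (intro mult_left_mono) auto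
    finally show ?thesis
      by (simp add: ennreal_leI mult_ac)
  qed
qed

text \<open>
  The part of \<open>\<bar>f\<bar>\<close> below \<open>l / 2\<close> accounts for at most half of an integral that exceeds \<open>l\<close> times the
  measure, so the part above \<open>l / 2\<close> carries the other half. Integrating only the large values of \<open>\<bar>f\<bar>\<close>
  makes the resulting weak type bound summable over dyadic heights.
\<close>

lemma max_bad_mass_ge:
  assumes l: "0 < l" and R: "R \<in> max_bad l"
  shows "ennreal l * emeasure M R
    \<le> 2 * (\<integral>\<^sup>+z. ennreal (cmod (f z)) * indicator {z. l / 2 < cmod (f z)} z * indicator R z \<partial>M)"
    (is "_ \<le> 2 * ?X")
proof (cases "?X = \<infinity>")
  case False
  then obtain x where x: "?X = ennreal x" "0 \<le> x"
    by (cases ?X) auto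
  note [measurable] = stopped_sets[OF R]
  have "ennreal (l * measure M R) < mass_on M f R"
    using stopped_bad[OF R] by (simp add: bad_def)
  also have "\<dots> \<le> ennreal (l / 2) * emeasure M R + ?X"
    using l by (intro mass_le_tail_mass) auto
  also have "\<dots> = ennreal (l / 2 * measure M R + x)"
    using l x by (simp add: max_bad_finite[OF R] ennreal_plus flip: ennreal_mult)
  finally have "l * measure M R < l / 2 * measure M R + x"
    using l by (simp add: ennreal_less_iff)
  then have "ennreal (l * measure M R) \<le> ennreal (2 * x)"
    by (intro ennreal_leI) auto
  then show ?thesis
    using l x by (simp add: max_bad_finite[OF R] ennreal_mult)
qed (simp add: ennreal_mult_top)

lemma emeasure_bad_set_le:
  assumes l: "0 < l"
  shows "ennreal l * emeasure M (bad_set l) \<le> 2 * tail_mass M f (l / 2)"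
proof -
  obtain S :: "nat \<Rightarrow> 'a set" where S: "disjoint_family S" "range S \<subseteq> insert {} (max_bad l)"
      "max_bad l \<subseteq> range S" "(\<Union>i. S i) = bad_set l" and S_sets: "range S \<subseteq> sets M"
    by (rule stopped_enum[of "bad l"])
  have S_meas [measurable]: "S i \<in> sets M" for i using S_sets by blast
  let ?h = "\<lambda>z. ennreal (cmod (f z)) * indicator {z. l / 2 < cmod (f z)} z"
  have "ennreal l * emeasure M (bad_set l) = (\<Sum>i. ennreal l * emeasure M (S i))"
    using suminf_emeasure[OF S_sets S(1)] S(4) by (subst ennreal_suminf_cmult) auto
  also have "\<dots> \<le> (\<Sum>i. 2 * (\<integral>\<^sup>+z. ?h z * indicator (S i) z \<partial>M))"
  proof (intro suminf_le)
    fix i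
    have "S i \<in> insert {} (max_bad l)" using S(2) by blast
    then show "ennreal l * emeasure M (S i) \<le> 2 * (\<integral>\<^sup>+z. ?h z * indicator (S i) z \<partial>M)"
      using max_bad_mass_ge[OF l] by auto
  qed auto
  also have "\<dots> = 2 * (\<integral>\<^sup>+z. ?h z * indicator (bad_set l) z \<partial>M)"
    using S(1) by (subst ennreal_suminf_cmult) (simp add: nn_integral_Union_suminf flip: S(4))
  also have "\<dots> \<le> 2 * tail_mass M f (l / 2)"
    unfolding tail_mass_def
    by (intro mult_left_mono nn_integral_mono) (auto split: split_indicator)
  finally show ?thesis .
qed

lemma f_integrable:
  assumes [measurable]: "E \<in> sets M" and "emeasure M E < \<infinity>"
  shows "set_integrable M E f"
proof -
  have "mass_on M f E
      \<le> ennreal (l\<^sub>0 / 2) * emeasure M E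
        + (\<integral>\<^sup>+z. ennreal (cmod (f z)) * indicator {z. l\<^sub>0 / 2 < cmod (f z)} z * indicator E z \<partial>M)"
    using l0_pos by (intro mass_le_tail_mass) auto
  also have "\<dots> \<le> ennreal (l\<^sub>0 / 2) * emeasure M E + tail_mass M f (l\<^sub>0 / 2)"
    unfolding tail_mass_def
    by (intro add_left_mono nn_integral_mono) (auto split: split_indicator)
  also have "\<dots> < \<infinity>"
    using tail_finite assms(2) by (simp add: ennreal_mult_less_top)
  finally have "mass_on M f E < \<infinity>" .
  moreover have "(\<integral>\<^sup>+z. ennreal (norm (indicator E z *\<^sub>R f z)) \<partial>M)
      = mass_on M f E"
    by (intro nn_integral_cong) (auto split: split_indicator)
  ultimately show ?thesis
    unfolding set_integrable_def by (intro integrableI_bounded) auto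
qed

text \<open>
  The differentiation theorem in the form that is needed: let \<open>A\<close> be the set outside the bad sets where
  \<open>\<bar>f\<bar> > l\<close>. The maximal sets of the tree that meet \<open>A\<close> and lie in a set \<open>U\<close> slightly larger than \<open>A\<close>
  cover \<open>A\<close>, and none of them is bad. Hence the integral of \<open>\<bar>f\<bar>\<close> over \<open>A\<close> is at most \<open>l\<close> times the measure of
  \<open>U\<close>, and in the limit at most \<open>l\<close> times that of \<open>A\<close>, which forces \<open>A\<close> to be a null set.
\<close>

lemma AE_le_off_bad_set:
  assumes l: "l\<^sub>0 \<le> l"
  shows "AE z in M. z \<notin> bad_set l \<longrightarrow> cmod (f z) \<le> l"
proof -
  define A where "A = {z \<in> space M. l < cmod (f z) \<and> z \<notin> bad_set l}"
  have A_meas [measurable]: "A \<in> sets M" unfolding A_def by measurable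
  have l': "0 < l" using l l0_pos by simp
  have "ennreal l * emeasure M A \<le> tail_mass M f l"
  proof -
    have "ennreal l * emeasure M A = (\<integral>\<^sup>+z. ennreal l * indicator A z \<partial>M)"
      by (simp add: nn_integral_cmult_indicator)
    also have "\<dots> \<le> tail_mass M f l"
      unfolding tail_mass_def by (intro nn_integral_mono) (auto simp: A_def intro!: ennreal_leI split: split_indicator)
    finally show ?thesis .
  qed
  also have "\<dots> \<le> tail_mass M f (l\<^sub>0 / 2)"
    using l l0_pos by (intro tail_mass_antimono) auto
  also note tail_finite
  finally have Afin: "emeasure M A < \<infinity>"
    using l' by (auto simp: ennreal_mult_less_top)
  have upper: "mass_on M f A \<le> ennreal l * emeasure M A + ennreal (l * e)"
    if e: "0 < e" for e
  proof -
    obtain U where U: "U \<in> sets M" "A \<subseteq> U" "emeasure M U \<le> emeasure M A + ennreal e"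
        "\<And>z. z \<in> U \<Longrightarrow> \<exists>n. \<exists>R\<in>gen n. z \<in> R \<and> R \<subseteq> U"
      using outer_approx[OF A_meas Afin e] by metis
    \<comment> \<open>stopping at this property selects the maximal sets of the tree inside \<open>U\<close> that meet \<open>A\<close>\<close>
    define B where "B R \<longleftrightarrow> R \<subseteq> U \<and> R \<inter> A \<noteq> {}" for R
    obtain S :: "nat \<Rightarrow> 'a set" where S: "disjoint_family S" "range S \<subseteq> insert {} (stopped B)"
      "stopped B \<subseteq> range S" "(\<Union>i. S i) = \<Union>(stopped B)" and S_sets: "range S \<subseteq> sets M"
      by (rule stopped_enum[of B])
    have S_meas [measurable]: "S i \<in> sets M" for i using S_sets by blast
    have A_sub: "A \<subseteq> (\<Union>i. S i)"
    proof
      fix z assume z: "z \<in> A"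
      then obtain n R where R: "R \<in> gen n" "z \<in> R" "R \<subseteq> U"
        using U(4)[of z] U(2) by blast
      then have "B R" using z by (auto simp: B_def)
      then show "z \<in> (\<Union>i. S i)"
        using bad_subset_stopped[OF R(1), of B] R(2) S(4) by blast
    qed
    have S_sub: "(\<Union>i. S i) \<subseteq> U"
      using stopped_bad[of _ B] unfolding S(4) B_def by blast
    have "mass_on M f A
        \<le> mass_on M f (\<Union>i. S i)"
      using A_sub by (intro nn_integral_mono mult_left_mono) (auto split: split_indicator)
    also have "\<dots> = (\<Sum>i. \<integral>\<^sup>+z. ennreal (cmod (f z)) * indicator (S i) z \<partial>M)"
      using S(1) by (intro nn_integral_Union_suminf) auto
    also have "\<dots> \<le> (\<Sum>i. ennreal l * emeasure M (S i))"
    proof (intro suminf_le)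
      fix i
      have "S i \<in> insert {} (stopped B)" using S(2) by blast
      then consider "S i = {}" | "S i \<in> stopped B" by blast
      then show "mass_on M f (S i) \<le> ennreal l * emeasure M (S i)"
      proof cases
        case 2
        then obtain n where n: "S i \<in> gen n" using stopped_gen by blast
        have "\<not> bad l (S i)"
        proof
          assume "bad l (S i)"
          then have "S i \<subseteq> bad_set l" using bad_subset_stopped[OF n] by blast
          moreover have "S i \<inter> A \<noteq> {}" using stopped_bad[OF 2] by (simp add: B_def)
          ultimately show False by (auto simp: A_def)
        qed
        then show ?thesis
          using l' gen_finite[OF n] by (simp add: bad_def not_less ennreal_mult)
      qed simp
    qed auto
    also have "\<dots> = ennreal l * emeasure M (\<Union>i. S i)"
      using suminf_emeasure[OF S_sets S(1)] by (subst ennreal_suminf_cmult) auto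
    also have "\<dots> \<le> ennreal l * (emeasure M A + ennreal e)"
      using S_sub U(1,3) by (intro mult_left_mono order_trans[OF emeasure_mono U(3)]) auto
    also have "\<dots> = ennreal l * emeasure M A + ennreal (l * e)"
      using l' e by (simp add: distrib_left ennreal_mult)
    finally show ?thesis .
  qed
  have "mass_on M f A \<le> ennreal l * emeasure M A"
  proof (rule ennreal_le_epsilon)
    fix e :: real assume "0 < e"
    then show "mass_on M f A \<le> ennreal l * emeasure M A + ennreal e"
      using upper[of "e / l"] l' by simp
  qed
  moreover have "mass_on M f A
      = (\<integral>\<^sup>+z. ennreal (cmod (f z) - l) * indicator A z + ennreal l * indicator A z \<partial>M)"
    using l' by (intro nn_integral_cong) (auto simp: A_def split: split_indicator simp flip: ennreal_plus)
  ultimately have "(\<integral>\<^sup>+z. ennreal (cmod (f z) - l) * indicator A z \<partial>M) + ennreal l * emeasure M A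
      \<le> ennreal l * emeasure M A"
    by (simp add: nn_integral_add nn_integral_cmult_indicator)
  then have "(\<integral>\<^sup>+z. ennreal (cmod (f z) - l) * indicator A z \<partial>M) = 0"
    using Afin l' by (auto simp: ennreal_mult_eq_top_iff)
  then have "AE z in M. ennreal (cmod (f z) - l) * indicator A z = 0"
    by (subst (asm) nn_integral_0_iff_AE) auto
  then show ?thesis
    by (rule AE_mp) (auto simp: A_def ennreal_eq_0_iff split: split_indicator_asm)
qed

definition avg :: "'a set \<Rightarrow> complex" where
  "avg R = (LINT z:R|M. f z) / of_real (measure M R)"

definition good :: "real \<Rightarrow> 'a \<Rightarrow> complex" where
  "good l z = (if z \<in> bad_set l then avg (THE R. R \<in> max_bad l \<and> z \<in> R) else f z)"

lemma good_on:
  assumes "R \<in> max_bad l" "z \<in> R"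
  shows "good l z = avg R"
proof -
  have "(THE R. R \<in> max_bad l \<and> z \<in> R) = R"
  proof (rule the_equality)
    fix R' assume "R' \<in> max_bad l \<and> z \<in> R'"
    then show "R' = R"
      using disjoint_stopped[of "bad l"] assms unfolding disjoint_def by blast
  qed (use assms in simp)
  then show ?thesis using assms by (auto simp: good_def)
qed

lemma good_off: "z \<notin> bad_set l \<Longrightarrow> good l z = f z"
  unfolding good_def by argo

lemma good_meas [measurable]: "good l \<in> borel_measurable M"
proof (rule measurable_piecewise_restrict)
  show "countable (insert (space M - bad_set l) (max_bad l))"
    using countable_stopped by simp
  show "space M \<subseteq> \<Union>(insert (space M - bad_set l) (max_bad l))" by auto
  fix C assume C: "C \<in> insert (space M - bad_set l) (max_bad l)"
  then show "C \<inter> space M \<in> sets M"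
    using stopped_sets[of C "bad l"] by auto
  show "good l \<in> borel_measurable (restrict_space M C)"
  proof (cases "C \<in> max_bad l")
    case True
    then have "good l \<in> borel_measurable (restrict_space M C) \<longleftrightarrow> (\<lambda>_. avg C) \<in> borel_measurable (restrict_space M C)"
      by (intro measurable_cong) (auto simp: space_restrict_space good_on)
    then show ?thesis by simp
  next
    case False
    then have "C = space M - bad_set l" using C by simp
    then have "good l \<in> borel_measurable (restrict_space M C) \<longleftrightarrow> f \<in> borel_measurable (restrict_space M C)"
      by (intro measurable_cong) (simp add: space_restrict_space good_off)
    then show ?thesis using measurable_restrict_space1[OF f_meas] by simp
  qed
qed

lemma cmod_avg_le:
  assumes l: "l\<^sub>0 \<le> l" and R: "R \<in> max_bad l"
  shows "cmod (avg R) \<le> \<kappa> * l"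
proof -
  have l': "0 < l" using l l0_pos by simp
  have int: "set_integrable M R f"
    using stopped_sets[OF R] max_bad_finite[OF R] by (intro f_integrable) auto
  have "ennreal (cmod (LINT z:R|M. f z)) \<le> (\<integral>\<^sup>+z. ennreal (cmod (indicator R z *\<^sub>R f z)) \<partial>M)"
    unfolding set_lebesgue_integral_def
    using int by (intro integral_norm_bound_ennreal) (simp add: set_integrable_def)
  also have "\<dots> = mass_on M f R"
    by (intro nn_integral_cong) (auto split: split_indicator)
  also have "\<dots> \<le> ennreal (\<kappa> * l * measure M R)"
    by (rule max_bad_mass_le[OF l R])
  finally have "cmod (LINT z:R|M. f z) \<le> \<kappa> * l * measure M R"
    using l' kappa_ge_1 by (subst (asm) ennreal_le_iff) auto
  then show ?thesis
    using max_bad_pos[OF R] by (simp add: avg_def norm_divide divide_le_eq)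
qed

lemma AE_good_le:
  assumes l: "l\<^sub>0 \<le> l"
  shows "AE z in M. cmod (good l z) \<le> \<kappa> * l"
  using AE_le_off_bad_set[OF l]
proof (rule AE_mp, intro AE_I2 impI)
  fix z assume *: "z \<notin> bad_set l \<longrightarrow> cmod (f z) \<le> l"
  show "cmod (good l z) \<le> \<kappa> * l"
  proof (cases "z \<in> bad_set l")
    case True
    then obtain R where "R \<in> max_bad l" "z \<in> R" by blast
    then show ?thesis using cmod_avg_le[OF l] good_on by simp
  next
    case False
    have "l \<le> \<kappa> * l" using kappa_ge_1 l l0_pos by simp
    then show ?thesis using * False good_off by force
  qed
qed

lemma good_integrable:
  assumes l: "l\<^sub>0 \<le> l" and [measurable]: "E \<in> sets M" and fin: "emeasure M E < \<infinity>"
  shows "set_integrable M E (good l)"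
proof -
  have "set_integrable M E (\<lambda>_. \<kappa> * l)"
    using fin unfolding set_integrable_def by simp
  then show ?thesis
    by (rule set_integrable_bound)
      (use AE_good_le[OF l] l l0_pos kappa_ge_1 in \<open>auto simp: set_borel_measurable_def\<close>)
qed

lemma good_same_integral_max_bad:
  assumes l: "l\<^sub>0 \<le> l" and R: "R \<in> max_bad l"
  shows "(LINT z:R|M. good l z - f z) = 0"
proof -
  have fin: "emeasure M R < \<infinity>" using max_bad_finite[OF R] by simp
  note [measurable] = stopped_sets[OF R]
  have "(LINT z:R|M. good l z) = (LINT z:R|M. avg R)"
    by (rule set_lebesgue_integral_cong) (auto simp: good_on[OF R])
  also have "\<dots> = of_real (measure M R) * avg R"
    using fin by (simp add: set_lebesgue_integral_def scaleR_conv_of_real)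
  also have "\<dots> = (LINT z:R|M. f z)"
    using max_bad_pos[OF R] by (simp add: avg_def)
  finally show ?thesis
    using good_integrable[OF l _ fin] f_integrable[OF _ fin] by (simp add: set_integral_diff)
qed

text \<open>
  Replacing \<open>f\<close> by its average on a set contained in \<open>E\<close> does not change the integral over \<open>E\<close>. With \<open>E\<close> a
  maximal set of a lower height this yields the mean value zero of the pieces in \<open>atomic_pieces\<close>.
\<close>

lemma good_same_integral:
  assumes l: "l\<^sub>0 \<le> l" and E [measurable]: "E \<in> sets M" and fin: "emeasure M E < \<infinity>"
    and nest: "\<And>R. R \<in> max_bad l \<Longrightarrow> R \<subseteq> E \<or> R \<inter> E = {}"
  shows "(LINT z:E|M. good l z - f z) = 0"
proof -
  obtain S :: "nat \<Rightarrow> 'a set" where S: "disjoint_family S" "range S \<subseteq> insert {} (max_bad l)"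
      "max_bad l \<subseteq> range S" "(\<Union>i. S i) = bad_set l" and S_sets: "range S \<subseteq> sets M"
    by (rule stopped_enum[of "bad l"])
  have S_meas [measurable]: "S i \<in> sets M" for i using S_sets by blast
  let ?h = "\<lambda>z. good l z - f z"
  have int: "set_integrable M E ?h"
    using good_integrable[OF l E fin] f_integrable[OF E fin] by (rule set_integral_diff)
  have "(LINT z:E|M. ?h z) = (LINT z:(\<Union>i. E \<inter> S i)|M. ?h z)"
    unfolding set_lebesgue_integral_def
  proof (rule Bochner_Integration.integral_cong)
    fix z
    show "indicator E z *\<^sub>R ?h z = indicator (\<Union>i. E \<inter> S i) z *\<^sub>R ?h z"
    proof (cases "z \<in> bad_set l")
      case True
      then have "z \<in> E \<longleftrightarrow> z \<in> (\<Union>i. E \<inter> S i)" using S(4) by blast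
      then show ?thesis by (simp add: indicator_def)
    qed (simp add: good_off)
  qed simp
  also have "\<dots> = (\<Sum>i. LINT z:(E \<inter> S i)|M. ?h z)"
  proof (rule lebesgue_integral_countable_add)
    show "set_integrable M (\<Union>i. E \<inter> S i) ?h"
      using int by (rule set_integrable_subset) auto
    show "(E \<inter> S i) \<inter> (E \<inter> S j) = {}" if "i \<noteq> j" for i j
      using S(1) that by (auto simp: disjoint_family_on_def)
  qed auto
  also have "\<dots> = (\<Sum>i. 0)"
  proof (intro suminf_cong)
    fix i
    have "S i \<in> insert {} (max_bad l)" using S(2) by blast
    then consider "E \<inter> S i = {}" | "S i \<in> max_bad l" "E \<inter> S i = S i"
      using nest[of "S i"] by blast
    then show "(LINT z:(E \<inter> S i)|M. ?h z) = 0"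
    proof cases
      case 1
      then show ?thesis by (simp add: set_lebesgue_integral_def)
    next
      case 2
      then show ?thesis using good_same_integral_max_bad[OF l 2(1)] by simp
    qed
  qed
  finally show ?thesis by simp
qed

lemma bad_set_antimono: "l \<le> l' \<Longrightarrow> bad_set l' \<subseteq> bad_set l"
proof
  fix z assume "l \<le> l'" "z \<in> bad_set l'"
  then obtain R n where "z \<in> R" "R \<in> gen n" "bad l R"
    using stopped_gen stopped_bad bad_mono by (metis Union_iff)
  then show "z \<in> bad_set l" using bad_subset_stopped by blast
qed

abbreviation level :: "nat \<Rightarrow> real" where
  "level n \<equiv> 2 ^ n * l\<^sub>0"

lemma level_ge: "l\<^sub>0 \<le> level n"
  using l0_pos by (simp add: mult_le_cancel_right1)

text \<open>
  The function \<open>f - good l\<^sub>0\<close> is the sum of the differences \<open>d n\<close> of the good functions at the heights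
  \<open>2\<^sup>n\<^sup>+\<^sup>1 l\<^sub>0\<close> and \<open>2\<^sup>n l\<^sub>0\<close>, because almost every point leaves the bad sets eventually. The difference \<open>d n\<close>
  vanishes outside the maximal sets of height \<open>2\<^sup>n l\<^sub>0\<close>, is bounded by
  \<open>\<kappa> 2\<^sup>n\<^sup>+\<^sup>1 l\<^sub>0 + \<kappa> 2\<^sup>n l\<^sub>0\<close>, and has mean value zero on each of them. The pieces are indexed by pairs of a
  height and a maximal set, encoded as one natural number.
\<close>

lemma atomic_pieces:
  assumes Phi: "log_tail_mass M f l\<^sub>0 < \<infinity>"
  obtains T :: "nat \<Rightarrow> 'a set" and a :: "nat \<Rightarrow> 'a \<Rightarrow> complex" and h :: "nat \<Rightarrow> real"
  where "\<forall>j. T j \<in> insert {} (\<Union>n. gen n)" "\<forall>j. 0 < h j" "\<forall>j. a j \<in> borel_measurable M"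
    "\<forall>j. AE z in M. cmod (a j z) \<le> h j" "\<forall>j z. z \<notin> T j \<longrightarrow> a j z = 0"
    "\<forall>j. (\<integral>z. a j z \<partial>M) = 0"
    "(\<Sum>j. ennreal (h j) * emeasure M (T j)) \<le> ennreal (6 * \<kappa>) * log_tail_mass M f l\<^sub>0"
    "AE z in M. (\<lambda>j. a j z) sums (f z - good l\<^sub>0 z)"
proof -
  have "\<exists>S :: nat \<Rightarrow> 'a set. disjoint_family S \<and> range S \<subseteq> insert {} (max_bad (level n))
      \<and> (\<Union>i. S i) = bad_set (level n) \<and> (\<forall>i. S i \<in> sets M)" for n
  proof (rule stopped_enum[of "bad (level n)"])
    fix S :: "nat \<Rightarrow> 'a set"
    assume "disjoint_family S" "range S \<subseteq> insert {} (max_bad (level n))"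
      "(\<Union>i. S i) = bad_set (level n)" "range S \<subseteq> sets M"
    then show ?thesis by (intro exI[of _ S]) auto
  qed
  then obtain S :: "nat \<Rightarrow> nat \<Rightarrow> 'a set" where S: "\<And>n. disjoint_family (S n)"
      "\<And>n. range (S n) \<subseteq> insert {} (max_bad (level n))" "\<And>n. (\<Union>i. S n i) = bad_set (level n)"
      and S_meas [measurable]: "\<And>n i. S n i \<in> sets M"
    by metis
  have S_cases: "S n i = {} \<or> S n i \<in> max_bad (level n)" for n i
    using S(2)[of n] by blast
  define d where "d n z = good (level (Suc n)) z - good (level n) z" for n z
  have d_meas [measurable]: "d n \<in> borel_measurable M" for n
    unfolding d_def by measurable
  define A where "A n i z = indicator (S n i) z *\<^sub>R d n z" for n i z
  define T where "T j = (case prod_decode j of (n, i) \<Rightarrow> S n i)" for j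
  define a where "a j = (case prod_decode j of (n, i) \<Rightarrow> A n i)" for j
  define h where "h j = (case prod_decode j of (n, i) \<Rightarrow> 3 * \<kappa> * level n)" for j
  have level_pos: "0 < level n" for n using l0_pos by simp
  show thesis
  proof (rule that[of T h a]; (intro allI impI)?)
    show "T j \<in> insert {} (\<Union>n. gen n)" for j
    proof -
      obtain n i where "prod_decode j = (n, i)" by (cases "prod_decode j")
      then show ?thesis
        using S_cases[of n i] stopped_gen[of "S n i" "bad (level n)"] by (auto simp: T_def)
    qed
    show "0 < h j" for j
      using kappa_ge_1 l0_pos by (auto simp: h_def split: prod.split)
    show "a j \<in> borel_measurable M" for j
      unfolding a_def A_def by (auto split: prod.split)
    show "a j z = 0" if "z \<notin> T j" for j z
      using that by (auto simp: a_def T_def A_def split: prod.splits)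
    show "AE z in M. cmod (a j z) \<le> h j" for j
    proof -
      obtain n i where ni: "prod_decode j = (n, i)" by (cases "prod_decode j")
      have pos: "0 \<le> \<kappa> * level n" using kappa_ge_1 l0_pos by simp
      show ?thesis
        using AE_good_le[OF level_ge[of "Suc n"]] AE_good_le[OF level_ge[of n]]
      proof eventually_elim
        case (elim z)
        have "cmod (d n z) \<le> \<kappa> * level (Suc n) + \<kappa> * level n"
          unfolding d_def by (rule order_trans[OF norm_triangle_ineq4 add_mono[OF elim]])
        also have "\<dots> = 3 * \<kappa> * level n" by (simp add: algebra_simps)
        finally show ?case
          using pos by (auto simp: a_def h_def ni A_def indicator_def mult_ac)
      qed
    qed
    show "(\<integral>z. a j z \<partial>M) = 0" for j
    proof -
      obtain n i where ni: "prod_decode j = (n, i)" by (cases "prod_decode j")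
      have "(\<integral>z. a j z \<partial>M) = (LINT z:S n i|M. d n z)"
        by (simp add: a_def ni A_def set_lebesgue_integral_def)
      also have "\<dots> = 0"
        using S_cases[of n i]
      proof
        assume R: "S n i \<in> max_bad (level n)"
        have fin: "emeasure M (S n i) < \<infinity>" using max_bad_finite[OF R] by simp
        have le: "level n \<le> level (Suc n)" using l0_pos by simp
        have 1: "(LINT z:S n i|M. good (level n) z - f z) = 0"
          by (rule good_same_integral_max_bad[OF level_ge R])
        have 2: "(LINT z:S n i|M. good (level (Suc n)) z - f z) = 0"
          by (rule good_same_integral[OF level_ge S_meas fin stopped_mono[OF bad_mono[OF le] _ R]])
        note int = good_integrable[OF level_ge S_meas fin] f_integrable[OF S_meas fin]
        have "(LINT z:S n i|M. d n z)
            = (LINT z:S n i|M. (good (level (Suc n)) z - f z) - (good (level n) z - f z))"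
          by (simp add: d_def)
        also have "\<dots> = (LINT z:S n i|M. good (level (Suc n)) z - f z)
            - (LINT z:S n i|M. good (level n) z - f z)"
          by (intro set_integral_diff int)
        finally show ?thesis using 1 2 by simp
      qed (simp add: set_lebesgue_integral_def)
      finally show ?thesis .
    qed
    show "(\<Sum>j. ennreal (h j) * emeasure M (T j)) \<le> ennreal (6 * \<kappa>) * log_tail_mass M f l\<^sub>0"
    proof -
      have "(\<Sum>j. ennreal (h j) * emeasure M (T j))
          = (\<Sum>j. (\<lambda>(n, i). ennreal (3 * \<kappa> * level n) * emeasure M (S n i)) (prod_decode j))"
        by (simp add: h_def T_def case_prod_beta)
      also have "\<dots> = (\<Sum>n. \<Sum>i. ennreal (3 * \<kappa> * level n) * emeasure M (S n i))"
        by (rule suminf_ennreal_2dimen) simp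
      also have "\<dots> = (\<Sum>n. ennreal (3 * \<kappa> * level n) * emeasure M (bad_set (level n)))"
      proof (intro suminf_cong)
        fix n
        show "(\<Sum>i. ennreal (3 * \<kappa> * level n) * emeasure M (S n i)) = ennreal (3 * \<kappa> * level n) * emeasure M (bad_set (level n))"
          using suminf_emeasure[OF _ S(1)[of n], of M] S(3)[of n] S_meas by (subst ennreal_suminf_cmult) (simp add: image_subset_iff)
      qed
      also have "\<dots> \<le> (\<Sum>n. ennreal (6 * \<kappa>) * tail_mass M f (level n / 2))"
      proof (intro suminf_le)
        fix n
        have "ennreal (3 * \<kappa> * level n) * emeasure M (bad_set (level n))
            = ennreal (3 * \<kappa>) * (ennreal (level n) * emeasure M (bad_set (level n)))"
          using kappa_ge_1 l0_pos by (simp add: ennreal_mult mult.assoc)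
        also have "\<dots> \<le> ennreal (3 * \<kappa>) * (2 * tail_mass M f (level n / 2))"
          by (intro mult_left_mono emeasure_bad_set_le level_pos) simp
        also have "\<dots> = ennreal (3 * \<kappa> * 2) * tail_mass M f (level n / 2)"
          using kappa_ge_1 by (subst ennreal_mult) (auto simp: mult.assoc)
        finally show "ennreal (3 * \<kappa> * level n) * emeasure M (bad_set (level n)) \<le> ennreal (6 * \<kappa>) * tail_mass M f (level n / 2)"
          by (simp add: mult_ac)
      qed auto
      also have "\<dots> = ennreal (6 * \<kappa>) * log_tail_mass M f l\<^sub>0"
        unfolding log_tail_mass_def by (rule ennreal_suminf_cmult)
      finally show ?thesis .
    qed
    have null: "(\<Inter>n. bad_set (level n)) \<in> null_sets M"
    proof (rule null_setsI)
      have "ennreal (2 ^ n) * emeasure M (\<Inter>n. bad_set (level n)) \<le> ennreal (2 / l\<^sub>0) * tail_mass M f (l\<^sub>0 / 2)" for n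
      proof -
        have "emeasure M (\<Inter>n. bad_set (level n)) \<le> emeasure M (bad_set (level n))"
          by (intro emeasure_mono) auto
        then have "ennreal (level n) * emeasure M (\<Inter>n. bad_set (level n)) \<le> ennreal (level n) * emeasure M (bad_set (level n))"
          by (intro mult_left_mono) auto
        also have "\<dots> \<le> 2 * tail_mass M f (level n / 2)"
          by (rule emeasure_bad_set_le[OF level_pos])
        also have "\<dots> \<le> 2 * tail_mass M f (l\<^sub>0 / 2)"
          using level_ge[of n] by (intro mult_left_mono tail_mass_antimono) auto
        finally have "ennreal (1 / l\<^sub>0) * (ennreal (level n) * emeasure M (\<Inter>n. bad_set (level n)))
            \<le> ennreal (1 / l\<^sub>0) * (2 * tail_mass M f (l\<^sub>0 / 2))"
          by (intro mult_left_mono) auto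
        moreover have "ennreal (1 / l\<^sub>0) * ennreal (level n) = ennreal (2 ^ n)"
          using l0_pos by (simp flip: ennreal_mult)
        moreover have "ennreal (1 / l\<^sub>0) * 2 = ennreal (2 / l\<^sub>0)"
          using l0_pos ennreal_mult[of "1 / l\<^sub>0" 2] by simp
        ultimately show ?thesis by (simp add: mult.assoc[symmetric])
      qed
      moreover obtain c where c: "ennreal (2 / l\<^sub>0) * tail_mass M f (l\<^sub>0 / 2) = ennreal c" "0 \<le> c"
        using tail_finite by (cases "ennreal (2 / l\<^sub>0) * tail_mass M f (l\<^sub>0 / 2)")
          (auto simp: ennreal_mult_eq_top_iff)
      ultimately have le: "ennreal (2 ^ n) * emeasure M (\<Inter>n. bad_set (level n)) \<le> ennreal c" for n by simp
      have "emeasure M (\<Inter>n. bad_set (level n)) \<noteq> \<infinity>"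
        using le[of 0] by (auto simp: top_unique)
      then obtain m where m: "emeasure M (\<Inter>n. bad_set (level n)) = ennreal m" "0 \<le> m"
        by (cases "emeasure M (\<Inter>n. bad_set (level n))") auto
      have le': "2 ^ n * m \<le> c" for n
        using le[of n] m c by (simp add: ennreal_le_iff flip: ennreal_mult)
      have "m = 0"
      proof (rule ccontr)
        assume "m \<noteq> 0"
        then have "0 < m" using m by simp
        obtain n where "c / m < 2 ^ n" using real_arch_pow[of 2 "c / m"] by auto
        then show False using le'[of n] \<open>0 < m\<close> by (simp add: divide_less_eq)
      qed
      then show "emeasure M (\<Inter>n. bad_set (level n)) = 0" using m by simp
    qed measurable
    show "AE z in M. (\<lambda>j. a j z) sums (f z - good l\<^sub>0 z)"
      using AE_not_in[OF null]
    proof (rule AE_mp, intro AE_I2 impI)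
      fix z assume "z \<notin> (\<Inter>n. bad_set (level n))"
      then obtain N where N: "z \<notin> bad_set (level N)" by blast
      have off: "z \<notin> bad_set (level n)" if "N \<le> n" for n
        using N bad_set_antimono[of "level N" "level n"] that l0_pos by auto
      define I where "I n = {i. z \<in> S n i}" for n
      have I_unique: "i = i'" if "i \<in> I n" "i' \<in> I n" for i i' n
        using S(1)[of n] that unfolding I_def disjoint_family_on_def by blast
      have I_sum: "(\<Sum>i\<in>I n. A n i z) = d n z" and I_fin: "finite (I n)" if "n < N" for n
      proof -
        consider i where "I n = {i}" | "I n = {}"
          using I_unique[of _ n] by blast
        then have "(\<Sum>i\<in>I n. A n i z) = d n z \<and> finite (I n)"
        proof cases
          case 1
          then have "z \<in> S n i" by (auto simp: I_def)
          then show ?thesis using 1 by (simp add: A_def)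
        next
          case 2
          then have "z \<notin> bad_set (level n)" using S(3)[of n] by (auto simp: I_def)
          moreover then have "z \<notin> bad_set (level (Suc n))"
            using bad_set_antimono[of "level n" "level (Suc n)"] l0_pos by auto
          ultimately show ?thesis using 2 by (simp add: d_def good_off)
        qed
        then show "(\<Sum>i\<in>I n. A n i z) = d n z" "finite (I n)" by auto
      qed
      define J where "J = prod_encode ` (Sigma {..<N} I)"
      have "(\<lambda>j. a j z) sums (\<Sum>j\<in>J. a j z)"
      proof (rule sums_finite)
        show "finite J" unfolding J_def using I_fin by (intro finite_imageI finite_SigmaI) auto
        fix j assume j: "j \<notin> J"
        obtain n i where ni: "prod_decode j = (n, i)" by (cases "prod_decode j")
        then have "j = prod_encode (n, i)" by (metis prod_decode_inverse)
        then have "\<not> (n < N \<and> z \<in> S n i)" using j by (auto simp: J_def I_def)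
        moreover have "z \<notin> S n i" if "N \<le> n" using off[OF that] S(3)[of n] by auto
        ultimately have "z \<notin> S n i" by force
        then show "a j z = 0" by (simp add: a_def ni A_def)
      qed
      also have "(\<Sum>j\<in>J. a j z) = (\<Sum>(n, i)\<in>Sigma {..<N} I. A n i z)"
        unfolding J_def by (subst sum.reindex) (auto simp: a_def inj_on_def case_prod_beta prod_encode_eq)
      also have "\<dots> = (\<Sum>n<N. \<Sum>i\<in>I n. A n i z)"
        using I_fin by (subst sum.Sigma) auto
      also have "\<dots> = (\<Sum>n<N. d n z)"
        using I_sum by simp
      also have "\<dots> = good (level N) z - good (level 0) z"
        unfolding d_def by (rule sum_lessThan_telescope)
      finally show "(\<lambda>j. a j z) sums (f z - good l\<^sub>0 z)"
        using off[of N] by (simp add: good_off)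
    qed
  qed
qed

end

section \<open>The measure of the group\<close>

lemma sets_rho: "A \<in> sets rho \<longleftrightarrow> A \<in> sets borel \<and> A \<subseteq> axb_set"
  unfolding rho_def using axb_set_borel by (auto simp: sets_restrict_space_iff)

lemma space_rho [simp]: "space rho = axb_set"
  by (simp add: rho_def space_restrict_space)

lemma emeasure_rho:
  assumes "A \<in> sets rho"
  shows "emeasure rho A = (\<integral>\<^sup>+z. ennreal (1 / snd z) * indicator A z \<partial>lborel)"
proof -
  have [measurable]: "A \<in> sets borel" and sub: "A \<subseteq> axb_set"
    using assms by (auto simp: sets_rho)
  have A: "A \<in> sets (restrict_space lborel axb_set)"
    using assms by (simp add: rho_def)
  have [measurable]: "(snd :: (real^'n) \<times> real \<Rightarrow> real) \<in> borel_measurable borel"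
    by (intro borel_measurable_continuous_onI continuous_intros)
  have "emeasure rho A = (\<integral>\<^sup>+z. ennreal (1 / snd z) * indicator A z \<partial>restrict_space lborel axb_set)"
    unfolding rho_def using A by (intro emeasure_density) (auto intro!: measurable_restrict_space1)
  also have "\<dots> = (\<integral>\<^sup>+z. ennreal (1 / snd z) * indicator A z * indicator axb_set z \<partial>lborel)"
    by (rule nn_integral_restrict_space) auto
  also have "\<dots> = (\<integral>\<^sup>+z. ennreal (1 / snd z) * indicator A z \<partial>lborel)"
    using sub by (intro nn_integral_cong) (auto split: split_indicator)
  finally show ?thesis .
qed

text \<open>
  The measure is not locally finite at the boundary of the half-space, so the open set is built from pieces
  in the regions \<open>W j\<close>, where the density is at most \<open>j + 1\<close> and Lebesgue outer regularity applies.
\<close>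

lemma rho_outer_regular:
  fixes A :: "((real^'n) \<times> real) set"
  assumes A: "A \<in> sets rho" and e: "0 < e"
  shows "\<exists>U. open U \<and> U \<subseteq> axb_set \<and> A \<subseteq> U \<and> emeasure rho U \<le> emeasure rho A + ennreal e"
proof -
  have [measurable]: "A \<in> sets borel" and sub: "A \<subseteq> axb_set"
    using A by (auto simp: sets_rho)
  define W where "W j = {z :: (real^'n) \<times> real. 1 / real (Suc j) < snd z}" for j
  have W_open: "open (W j)" for j
    unfolding W_def by (intro open_Collect_less continuous_intros)
  then have [measurable]: "W j \<in> sets borel" for j by simp
  have W_axb: "W j \<subseteq> axb_set" for j
  proof
    fix z assume "z \<in> W j"
    then have "1 / real (Suc j) < snd z" by (simp add: W_def)
    moreover have "0 < 1 / real (Suc j)" by simp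
    ultimately have "0 < snd z" by linarith
    then show "z \<in> axb_set" by (cases z) (simp add: axb_set_def)
  qed
  define \<epsilon> where "\<epsilon> j = e * (1 / 2) ^ Suc j" for j
  have eps_pos: "0 < \<epsilon> j" for j using e by (simp add: \<epsilon>_def)
  have "\<exists>U. open U \<and> A \<inter> W j \<subseteq> U \<and> emeasure lborel (U - A \<inter> W j) \<le> ennreal (\<epsilon> j / real (Suc j))" for j
  proof -
    have "0 < \<epsilon> j / real (Suc j)" using eps_pos[of j] by simp
    then show ?thesis
      using outer_regular_lborel_le[of "A \<inter> W j" "\<epsilon> j / real (Suc j)"] by (metis \<open>A \<in> sets borel\<close> \<open>\<And>j. W j \<in> sets borel\<close> sets.Int)
  qed
  then obtain U where U: "\<And>j. open (U j)" "\<And>j. A \<inter> W j \<subseteq> U j"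
      "\<And>j. emeasure lborel (U j - A \<inter> W j) \<le> ennreal (\<epsilon> j / real (Suc j))"
    by metis
  have [measurable]: "U j \<in> sets borel" for j using U(1) by simp
  define V where "V j = U j \<inter> W j" for j
  have V_open: "open (V j)" for j
    unfolding V_def using U(1) W_open by (rule open_Int)
  have V_axb: "V j \<subseteq> axb_set" for j
    using W_axb by (auto simp: V_def)
  have D_sets: "V j - A \<inter> W j \<in> sets rho" for j
    using V_axb[of j] by (auto simp: sets_rho V_def)
  have D_le: "emeasure rho (V j - A \<inter> W j) \<le> ennreal (\<epsilon> j)" for j
  proof -
    have "emeasure rho (V j - A \<inter> W j) = (\<integral>\<^sup>+z. ennreal (1 / snd z) * indicator (V j - A \<inter> W j) z \<partial>lborel)"
      by (rule emeasure_rho[OF D_sets])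
    also have "\<dots> \<le> (\<integral>\<^sup>+z. ennreal (real (Suc j)) * indicator (U j - A \<inter> W j) z \<partial>lborel)"
    proof (intro nn_integral_mono)
      fix z :: "(real^'n) \<times> real"
      show "ennreal (1 / snd z) * indicator (V j - A \<inter> W j) z \<le> ennreal (real (Suc j)) * indicator (U j - A \<inter> W j) z"
      proof (cases "z \<in> V j - A \<inter> W j")
        case True
        then have *: "1 / real (Suc j) < snd z" "z \<in> U j - A \<inter> W j" by (auto simp: V_def W_def)
        then have "1 / snd z \<le> real (Suc j)"
          by (smt (verit) divide_less_eq less_divide_eq mult.commute of_nat_0_less_iff zero_less_Suc zero_less_divide_1_iff)
        then show ?thesis using * True by (simp add: ennreal_leI del: of_nat_Suc)
      qed simp
    qed
    also have "\<dots> = ennreal (real (Suc j)) * emeasure lborel (U j - A \<inter> W j)"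
      by (intro nn_integral_cmult_indicator) auto
    also have "\<dots> \<le> ennreal (real (Suc j)) * ennreal (\<epsilon> j / real (Suc j))"
      by (intro mult_left_mono U(3)) simp
    also have "\<dots> = ennreal (\<epsilon> j)"
      by (subst ennreal_mult[symmetric]) (use eps_pos[of j] in auto)
    finally show ?thesis .
  qed
  have "A \<subseteq> (\<Union>j. V j)"
  proof
    fix z assume z: "z \<in> A"
    then have "0 < snd z" using sub by (auto simp: axb_set_def)
    then obtain j where "1 / real (Suc j) < snd z"
      using nat_approx_posE by blast
    then have "z \<in> W j" by (simp add: W_def)
    then show "z \<in> (\<Union>j. V j)" using z U(2)[of j] by (auto simp: V_def)
  qed
  moreover have "emeasure rho (\<Union>j. V j) \<le> emeasure rho A + ennreal e"
  proof -
    have "emeasure rho (\<Union>j. V j) \<le> emeasure rho (A \<union> (\<Union>j. V j - A \<inter> W j))"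
      using A D_sets by (intro emeasure_mono sets.Un sets.countable_UN) (auto simp: V_def)
    also have "\<dots> \<le> emeasure rho A + emeasure rho (\<Union>j. V j - A \<inter> W j)"
      using A D_sets by (intro emeasure_subadditive sets.countable_UN) auto
    also have "emeasure rho (\<Union>j. V j - A \<inter> W j) \<le> (\<Sum>j. emeasure rho (V j - A \<inter> W j))"
      using D_sets by (intro emeasure_subadditive_countably) auto
    also have "\<dots> \<le> (\<Sum>j. ennreal (\<epsilon> j))"
      using D_le by (intro suminf_le) auto
    also have "\<dots> = ennreal e"
    proof (rule suminf_ennreal_eq)
      show "\<epsilon> sums e"
        unfolding \<epsilon>_def using sums_mult[OF power_half_series, of e] by simp
    qed (use eps_pos less_imp_le in blast)
    finally show ?thesis by (simp add: add_left_mono)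
  qed
  ultimately show ?thesis
    using V_open V_axb by (intro exI[of _ "\<Union>j. V j"]) auto
qed

section \<open>Splitting Calderon--Zygmund sets\<close>

definition dcube :: "int \<Rightarrow> ('n \<Rightarrow> int) \<Rightarrow> (real^'n) set" where
  "dcube k m = {x. \<forall>i. of_int (m i) * 2 powi k \<le> x $ i \<and> x $ i < (of_int (m i) + 1) * 2 powi k}"

lemma dcube_index: "x \<in> dcube k m \<longleftrightarrow> m = (\<lambda>i. \<lfloor>x $ i / 2 powi k\<rfloor>)"
proof -
  have pos: "(0::real) < 2 powi k" by simp
  have "(of_int (m i) * 2 powi k \<le> x $ i \<and> x $ i < (of_int (m i) + 1) * 2 powi k)
      \<longleftrightarrow> m i = \<lfloor>x $ i / 2 powi k\<rfloor>" for i
    using pos by (auto simp: eq_commute[of "m i"] floor_eq_iff le_divide_eq divide_less_eq)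
  then show ?thesis by (auto simp: dcube_def)
qed

lemma dcube_sets [measurable]: "dcube k m \<in> sets borel"
  unfolding dcube_def by measurable

lemma emeasure_dcube: "emeasure lborel (dcube k m :: (real^'n) set) = ennreal ((2 powi k) ^ CARD('n))"
proof (rule antisym)
  define a b :: "real^'n" where "a = (\<chi> i. of_int (m i) * 2 powi k)" and "b = (\<chi> i. (of_int (m i) + 1) * 2 powi k)"
  have side: "(b - a) \<bullet> c = 2 powi k" if c: "c \<in> Basis" for c
  proof -
    obtain i where "c = axis i 1" using c by (auto simp: Basis_vec_def)
    then show ?thesis
      by (simp add: a_def b_def cart_eq_inner_axis[symmetric] algebra_simps)
  qed
  have le: "a \<bullet> c \<le> b \<bullet> c" if "c \<in> Basis" for c
  proof -
    have "0 \<le> (b - a) \<bullet> c" using side[OF that] by simp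
    then show ?thesis by (simp add: inner_diff_left)
  qed
  have vol: "(\<Prod>c\<in>Basis. (b - a) \<bullet> c) = (2 powi k) ^ CARD('n)"
    using side by simp
  have "emeasure lborel (dcube k m) \<le> emeasure lborel (cbox a b)"
    by (intro emeasure_mono) (auto simp: dcube_def mem_box_cart a_def b_def less_imp_le)
  also have "\<dots> = ennreal ((2 powi k) ^ CARD('n))"
    using emeasure_lborel_cbox[of a b] le vol by simp
  finally show "emeasure lborel (dcube k m) \<le> ennreal ((2 powi k) ^ CARD('n))" .
  have "ennreal ((2 powi k) ^ CARD('n)) = emeasure lborel (box a b)"
    using emeasure_lborel_box[of a b] le vol by simp
  also have "\<dots> \<le> emeasure lborel (dcube k m)"
    by (intro emeasure_mono) (auto simp: dcube_def mem_box_cart a_def b_def less_imp_le)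
  finally show "ennreal ((2 powi k) ^ CARD('n)) \<le> emeasure lborel (dcube k m)" .
qed

lemma emeasure_rho_cube_times:
  fixes m :: "'n::finite \<Rightarrow> int"
  assumes [measurable]: "B \<in> sets borel" and B: "B \<subseteq> {0<..}"
  shows "emeasure rho (dcube k m \<times> B)
    = ennreal ((2 powi k) ^ CARD('n)) * (\<integral>\<^sup>+a. ennreal (1 / a) * indicator B a \<partial>lborel)"
proof -
  have [measurable]: "dcube k m \<times> B \<in> sets borel" by (intro borel_Times) simp_all
  then have "emeasure rho (dcube k m \<times> B) = (\<integral>\<^sup>+z. indicator (dcube k m \<times> B) z \<partial>rho)"
    using B by (subst nn_integral_indicator) (auto simp: sets_rho axb_set_def)
  also have "\<dots> = (\<integral>\<^sup>+a. (\<integral>\<^sup>+x. indicator (dcube k m \<times> B) (x, a) \<partial>lborel) * (ennreal (1 / a) * indicator {0<..} a) \<partial>lborel)"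
    by (rule nn_integral_rho) simp
  also have "\<dots> = (\<integral>\<^sup>+a. ennreal ((2 powi k) ^ CARD('n)) * (ennreal (1 / a) * indicator B a) \<partial>lborel)"
  proof (intro nn_integral_cong)
    fix a :: real
    have "(\<integral>\<^sup>+x. indicator (dcube k m \<times> B) (x, a) \<partial>lborel) = (\<integral>\<^sup>+x. indicator B a * indicator (dcube k m) x \<partial>lborel)"
      by (intro nn_integral_cong) (auto split: split_indicator)
    also have "\<dots> = indicator B a * ennreal ((2 powi k) ^ CARD('n))"
      by (simp add: nn_integral_cmult_indicator emeasure_dcube)
    finally show "(\<integral>\<^sup>+x. indicator (dcube k m \<times> B) (x, a) \<partial>lborel) * (ennreal (1 / a) * indicator {0<..} a)
        = ennreal ((2 powi k) ^ CARD('n)) * (ennreal (1 / a) * indicator B a)"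
      using B by (auto split: split_indicator simp: mult_ac)
  qed
  also have "\<dots> = ennreal ((2 powi k) ^ CARD('n)) * (\<integral>\<^sup>+a. ennreal (1 / a) * indicator B a \<partial>lborel)"
    by (intro nn_integral_cmult) measurable
  finally show ?thesis .
qed

lemma nn_integral_inverse_log_interval:
  assumes "0 < r"
  shows "(\<integral>\<^sup>+a. ennreal (1 / a) * indicator {exp (s - r)..exp (s + r)} a \<partial>lborel) = ennreal (2 * r)"
proof -
  have "(\<integral>\<^sup>+a. ennreal (1 / a) * indicator {exp (s - r)..exp (s + r)} a \<partial>lborel)
      = ennreal (ln (exp (s + r)) - ln (exp (s - r)))"
  proof (rule nn_integral_FTC_Icc)
    fix x assume "x \<in> {exp (s - r)..exp (s + r)}"
    then have "exp (s - r) \<le> x" by simp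
    then have "0 < x" using exp_gt_zero[of "s - r"] by linarith
    then show "(ln has_real_derivative 1 / x) (at x)"
      by (auto intro!: derivative_eq_intros)
    show "0 \<le> 1 / x" using \<open>0 < x\<close> by simp
  qed (use assms in auto)
  then show ?thesis by simp
qed

text \<open>
  Calderon--Zygmund sets with the interval in logarithmic coordinates \<open>s = ln a\<close>. The interval is half-open,
  so that the sets can form honest partitions; its closure has the same measure.
\<close>

definition cz_box :: "int \<Rightarrow> ('n \<Rightarrow> int) \<Rightarrow> real \<Rightarrow> real \<Rightarrow> ((real^'n) \<times> real) set" where
  "cz_box k m s r = dcube k m \<times> {exp (s - r)..<exp (s + r)}"

text \<open>
  The relation between the side \<open>2 powi k\<close> of the cube and the interval in the definition of
  Calderon--Zygmund sets.
\<close>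

definition admissible :: "int \<Rightarrow> real \<Rightarrow> real \<Rightarrow> bool" where
  "admissible k s r \<longleftrightarrow> 0 < r \<and>
    (r < 1 \<longrightarrow> exp 2 * exp s * r \<le> 2 powi k \<and> 2 powi k < exp 8 * exp s * r) \<and>
    (1 \<le> r \<longrightarrow> exp s * exp (2 * r) \<le> 2 powi k \<and> 2 powi k < exp s * exp (8 * r))"

lemma cz_box_axb: "cz_box k m s r \<subseteq> axb_set"
proof
  fix z assume "z \<in> cz_box k m s r"
  then have "exp (s - r) \<le> snd z" by (auto simp: cz_box_def)
  then have "0 < snd z" using exp_gt_zero[of "s - r"] by linarith
  then show "z \<in> axb_set" by (cases z) (simp add: axb_set_def)
qed

lemma cz_box_sets [measurable]: "cz_box k m s r \<in> sets rho"
proof -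
  have "cz_box k m s r \<in> sets borel" unfolding cz_box_def by (intro borel_Times) simp_all
  then show ?thesis using cz_box_axb[of k m s r] by (simp add: sets_rho)
qed

lemma emeasure_cz_box:
  fixes m :: "'n::finite \<Rightarrow> int"
  assumes r: "0 < r"
  shows "emeasure rho (cz_box k m s r) = ennreal (2 * r * (2 powi k) ^ CARD('n))"
    and "emeasure rho (dcube k m \<times> {exp (s - r)..exp (s + r)}) = ennreal (2 * r * (2 powi k) ^ CARD('n))"
proof -
  have sub: "{exp (s - r)..exp (s + r)} \<subseteq> {0<..}"
  proof
    fix x assume "x \<in> {exp (s - r)..exp (s + r)}"
    then have "exp (s - r) \<le> x" by simp
    then have "0 < x" using exp_gt_zero[of "s - r"] by linarith
    then show "x \<in> {0<..}" by simp
  qed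
  moreover have "{exp (s - r)..<exp (s + r)} \<subseteq> {exp (s - r)..exp (s + r)}"
    by (rule atLeastLessThan_subseteq_atLeastAtMost_iff[THEN iffD2]) simp
  ultimately have sub': "{exp (s - r)..<exp (s + r)} \<subseteq> {0<..}" by (rule subset_trans[rotated])
  have vol: "ennreal ((2 powi k) ^ CARD('n)) * ennreal (2 * r) = ennreal (2 * r * (2 powi k) ^ CARD('n))"
    using r by (subst ennreal_mult[symmetric]) (auto simp: mult.commute)
  have "(\<integral>\<^sup>+a. ennreal (1 / a) * indicator {exp (s - r)..<exp (s + r)} a \<partial>lborel)
      = (\<integral>\<^sup>+a. ennreal (1 / a) * indicator {exp (s - r)..exp (s + r)} a \<partial>lborel)"
    using AE_lborel_singleton[of "exp (s + r)"]
    by (intro nn_integral_cong_AE) (auto split: split_indicator elim!: eventually_mono)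
  then show "emeasure rho (cz_box k m s r) = ennreal (2 * r * (2 powi k) ^ CARD('n))"
    unfolding cz_box_def using r sub' vol
    by (simp add: emeasure_rho_cube_times nn_integral_inverse_log_interval)
  show "emeasure rho (dcube k m \<times> {exp (s - r)..exp (s + r)}) = ennreal (2 * r * (2 powi k) ^ CARD('n))"
    using r sub vol
    by (simp add: emeasure_rho_cube_times nn_integral_inverse_log_interval)
qed

lemma measure_cz_box:
  fixes m :: "'n::finite \<Rightarrow> int"
  assumes "0 < r"
  shows "measure rho (cz_box k m s r) = 2 * r * (2 powi k) ^ CARD('n)"
  using assms by (simp add: measure_def emeasure_cz_box)

lemma CZ_set_cz_box:
  fixes m :: "'n::finite \<Rightarrow> int"
  assumes "admissible k s r"
  shows "\<exists>R. CZ_set R \<and> cz_box k m s r \<subseteq> R \<and> measure rho R = measure rho (cz_box k m s r)"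
proof (intro exI conjI)
  let ?R = "dcube k m \<times> {exp (s - r)..exp (s + r)}"
  show "CZ_set ?R"
    unfolding CZ_set_def
  proof (intro exI conjI)
    show "dyadic_cube (dcube k m) (2 powi k)"
      unfolding dyadic_cube_def dcube_def by blast
    show "?R = dcube k m \<times> {exp s * exp (- r)..exp s * exp r}"
      by (simp add: exp_diff exp_minus exp_add divide_inverse)
  qed (use assms in \<open>auto simp: admissible_def\<close>)
  show "cz_box k m s r \<subseteq> ?R" unfolding cz_box_def by auto
  have "0 < r" using assms by (simp add: admissible_def)
  then show "measure rho ?R = measure rho (cz_box k m s r)"
    by (simp add: measure_def emeasure_cz_box)
qed

definition cz_boxes :: "((real^'n) \<times> real) set set" where
  "cz_boxes = {cz_box k m s r |k m s r. admissible k s r}"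

lemma cz_boxes_pos: "R \<in> cz_boxes \<Longrightarrow> 0 < measure rho R"
  by (auto simp: cz_boxes_def admissible_def measure_cz_box)

lemma cz_boxes_sets: "R \<in> cz_boxes \<Longrightarrow> R \<in> sets rho"
  by (auto simp: cz_boxes_def)

text \<open>
  If \<open>z = (x, b)\<close> lies in the set, the side \<open>L\<close> is at least \<open>b\<close> when \<open>r \<ge> 1\<close> and at least \<open>b r\<close> when
  \<open>r < 1\<close>. So a small measure \<open>2 r L\<^sup>d\<close> makes \<open>r\<close> small, and then \<open>L < e\<^sup>8 a r\<close> makes the cube small as well.
\<close>

lemma cz_box_small_near_point:
  fixes z :: "(real^'n) \<times> real"
  assumes z: "z \<in> axb_set" and \<eta>: "0 < \<eta>"
  obtains \<delta> where "0 < \<delta>"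
    "\<forall>R\<in>cz_boxes. z \<in> R \<and> measure rho R < \<delta> \<longrightarrow> R \<subseteq> ball z \<eta>"
proof -
  obtain x b where zb: "z = (x, b)" and b: "0 < b"
    using z by (cases z) (auto simp: axb_set_def)
  define d where "d = CARD('n)"
  define C where "C = real d * (exp 9 * b) + 4 * b + 1"
  have C: "1 \<le> C" using b by (simp add: C_def)
  \<comment> \<open>points of a set with \<open>r < t\<close> are at distance at most \<open>C t\<close> from \<open>z\<close>: the first summand
     of \<open>C\<close> comes from the cube and the second from the interval\<close>
  define t where "t = min (1 / 2) (\<eta> / (2 * C))"
  have t: "0 < t" "t \<le> 1 / 2" "C * t < \<eta>"
  proof -
    have "C * t \<le> C * (\<eta> / (2 * C))"
      using C by (intro mult_left_mono) (auto simp: t_def)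
    also have "\<dots> < \<eta>" using C \<eta> by simp
    finally show "C * t < \<eta>" .
  qed (use C \<eta> in \<open>auto simp: t_def\<close>)
  show thesis
  proof (rule that[of "min (2 * b ^ d) (2 * t * (b * t) ^ d)"], goal_cases)
    case 1
    show ?case using b t by simp
  next
    case 2
    show ?case
    proof (intro ballI impI subsetI)
      fix R w
      assume "R \<in> cz_boxes" and "z \<in> R \<and> measure rho R < min (2 * b ^ d) (2 * t * (b * t) ^ d)" and w: "w \<in> R"
      then have zR: "z \<in> R" and small: "measure rho R < min (2 * b ^ d) (2 * t * (b * t) ^ d)" by auto
      obtain k m s r where R: "R = cz_box k m s r" and adm: "admissible k s r"
        using \<open>R \<in> cz_boxes\<close> by (auto simp: cz_boxes_def)
      define L :: real where "L = 2 powi k"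
      have L: "0 < L" by (simp add: L_def)
      have r: "0 < r" using adm by (simp add: admissible_def)
      have meas: "measure rho R = 2 * r * L ^ d"
        using r by (simp add: R measure_cz_box L_def d_def)
      have b_low: "exp (s - r) \<le> b" and b_up: "b < exp (s + r)"
        using zR by (auto simp: R zb cz_box_def)
      have r1: "r < 1"
      proof (rule ccontr)
        assume "\<not> r < 1"
        then have r1: "1 \<le> r" by simp
        then have "exp s * exp (2 * r) \<le> L" using adm by (simp add: admissible_def L_def)
        moreover have "exp (s + r) \<le> exp s * exp (2 * r)" using r1 by (simp flip: exp_add)
        ultimately have "b \<le> L" using b_up by linarith
        then have "b ^ d \<le> L ^ d" using b by (intro power_mono) auto
        then have "1 * b ^ d \<le> r * L ^ d" using r1 b by (intro mult_mono) auto
        then show False using small meas by simp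
      qed
      have lowL: "exp 2 * exp s * r \<le> L" and upL: "L < exp 8 * exp s * r"
        using adm r1 by (auto simp: admissible_def L_def)
      have rt: "r < t"
      proof (rule ccontr)
        assume "\<not> r < t"
        then have rt: "t \<le> r" by simp
        have "b \<le> exp (s + r)" using b_up by simp
        also have "\<dots> \<le> exp (2 + s)" using r1 by simp
        finally have "b \<le> exp 2 * exp s" by (simp add: exp_add)
        then have "b * t \<le> exp 2 * exp s * r"
          using rt b t by (intro mult_mono) auto
        then have "b * t \<le> L" using lowL by simp
        then have "(b * t) ^ d \<le> L ^ d" using b t by (intro power_mono) auto
        then have "2 * t * (b * t) ^ d \<le> 2 * r * L ^ d"
          using rt b t by (intro mult_mono) auto
        then show False using small meas by simp
      qed
      have Lsmall: "L < exp 9 * b * t"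
      proof -
        have "exp s = exp r * exp (s - r)" by (simp flip: exp_add)
        also have "\<dots> \<le> exp 1 * b" using r1 b_low by (intro mult_mono) auto
        finally have "exp 8 * exp s * r \<le> exp 8 * (exp 1 * b) * t"
          using rt r b by (intro mult_mono) auto
        also have "\<dots> = exp 9 * b * t" by (simp flip: exp_add mult.assoc)
        finally show ?thesis using upL by simp
      qed
      obtain y c where wc: "w = (y, c)" by (cases w)
      have comp: "\<bar>(y - x) $ i\<bar> \<le> L" for i
      proof -
        have "of_int (m i) * L \<le> y $ i" "y $ i < (of_int (m i) + 1) * L"
          "of_int (m i) * L \<le> x $ i" "x $ i < (of_int (m i) + 1) * L"
          using w zR by (auto simp: R wc zb cz_box_def dcube_def L_def)
        then show ?thesis by (simp add: algebra_simps abs_le_iff)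
      qed
      have "norm (y - x) \<le> (\<Sum>i\<in>UNIV. \<bar>(y - x) $ i\<bar>)" by (rule norm_le_l1_cart)
      also have "\<dots> \<le> (\<Sum>i\<in>(UNIV::'n set). L)" by (intro sum_mono comp)
      also have "\<dots> = real d * L" by (simp add: d_def)
      also have "\<dots> \<le> real d * (exp 9 * b * t)" using Lsmall by (intro mult_left_mono) auto
      finally have 1: "norm (y - x) \<le> real d * (exp 9 * b) * t" by (simp add: mult_ac)
      have "exp (s - r) \<le> c" "c < exp (s + r)" using w by (auto simp: R wc cz_box_def)
      then have "\<bar>c - b\<bar> \<le> exp (s + r) - exp (s - r)" using b_low b_up by linarith
      also have "\<dots> = exp (s - r) * (exp (2 * r) - 1)" by (simp add: right_diff_distrib flip: exp_add)
      also have "\<dots> \<le> b * (4 * r)"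
      proof (intro mult_mono b_low)
        have "exp (2 * r) \<le> 1 + 2 * r + (2 * r)\<^sup>2" using r rt t by (intro exp_bound) auto
        moreover have "(2 * r)\<^sup>2 \<le> 2 * r" using r rt t by (simp add: power2_eq_square mult_left_le)
        ultimately show "exp (2 * r) - 1 \<le> 4 * r" by simp
      qed (use r b in auto)
      also have "\<dots> \<le> 4 * b * t" using rt b by simp
      finally have 2: "\<bar>c - b\<bar> \<le> 4 * b * t" .
      have "dist w z \<le> norm (y - x) + \<bar>c - b\<bar>"
        unfolding wc zb dist_prod_def by (simp add: dist_norm sqrt_sum_squares_le_sum_abs order_trans[OF sqrt_sum_squares_le_sum_abs])
      also have "\<dots> \<le> C * t" using 1 2 t(1) by (simp add: C_def algebra_simps)
      also have "\<dots> < \<eta>" by (rule t(3))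
      finally show "w \<in> ball z \<eta>" by (simp add: dist_commute)
    qed
  qed
qed

lemma dcube_split:
  "dcube k m = \<Union>{dcube (k - 1) m' |m'. \<forall>i. m' i div 2 = m i}"
proof -
  have eq: "dcube (k - 1) m' \<subseteq> dcube k (\<lambda>i. m' i div 2)" for m' :: "'a \<Rightarrow> int"
  proof
    fix x assume "x \<in> dcube (k - 1) m'"
    then have m': "m' i = \<lfloor>x $ i / 2 powi (k - 1)\<rfloor>" for i by (simp add: dcube_index)
    have "x $ i / 2 powi k = x $ i / 2 powi (k - 1) / real_of_int 2" for i
      by (simp add: power_int_diff)
    then have "m' i div 2 = \<lfloor>x $ i / 2 powi k\<rfloor>" for i
      by (simp only: floor_divide_real_eq_div[symmetric] m' )
    then show "x \<in> dcube k (\<lambda>i. m' i div 2)" by (simp add: dcube_index)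
  qed
  show ?thesis
  proof (intro equalityI subsetI)
    fix x assume x: "x \<in> dcube k m"
    define m' where "m' = (\<lambda>i. \<lfloor>x $ i / 2 powi (k - 1)\<rfloor>)"
    have x': "x \<in> dcube (k - 1) m'" by (simp add: dcube_index m'_def)
    then have "x \<in> dcube k (\<lambda>i. m' i div 2)" using eq by blast
    then have "m = (\<lambda>i. m' i div 2)" using x by (simp add: dcube_index)
    then show "x \<in> \<Union>{dcube (k - 1) m' |m'. \<forall>i. m' i div 2 = m i}" using x' by auto
  next
    fix x assume "x \<in> \<Union>{dcube (k - 1) m' |m'. \<forall>i. m' i div 2 = m i}"
    then obtain m' where "x \<in> dcube (k - 1) m'" "m = (\<lambda>i. m' i div 2)" by auto
    then show "x \<in> dcube k m" using eq by blast
  qed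
qed

lemma dcube_unique: "x \<in> dcube k m \<Longrightarrow> x \<in> dcube k m' \<Longrightarrow> m = m'"
  by (simp add: dcube_index)

text \<open>
  If the cube cannot be halved, its side \<open>L\<close> is within a factor 2 of its lower bound. This leaves enough room
  in the two-sided condition for halving the interval. The case \<open>1 \<le> r < 2\<close> passes from the condition for
  large \<open>r\<close> to the one for small \<open>r\<close>.
\<close>

lemma admissible_halve:
  assumes adm: "admissible k s r" and no: "\<not> admissible (k - 1) s r" and s': "\<bar>s' - s\<bar> \<le> r / 2"
  shows "admissible k s' (r / 2)"
proof -
  define L :: real where "L = 2 powi k"
  have half: "2 powi (k - 1) = L / 2" by (simp add: L_def power_int_diff)
  have L: "0 < L" by (simp add: L_def)
  have r: "0 < r" using adm by (simp add: admissible_def)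
  have s_up: "exp s' \<le> exp s * exp (r / 2)" and s_low: "exp s * exp (- (r / 2)) \<le> exp s'"
    using s' unfolding abs_le_iff by (auto simp flip: exp_add)
  consider (1) "r < 1" | (2) "1 \<le> r" "r < 2" | (3) "2 \<le> r" by linarith
  then show ?thesis
  proof cases
    case 1
    then have low: "exp 2 * exp s * r \<le> L" and up: "L < exp 8 * exp s * r"
      using adm by (auto simp: admissible_def L_def)
    have up': "L < 2 * (exp 2 * exp s * r)"
    proof (rule ccontr)
      assume *: "\<not> ?thesis"
      then have "admissible (k - 1) s r"
        using 1 r up L by (simp add: admissible_def half)
      then show False using no by simp
    qed
    have e2: "exp (r / 2) \<le> 2"
    proof -
      have "exp (r / 2) \<le> 1 + r / 2 + (r / 2)\<^sup>2" using r 1 by (intro exp_bound) auto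
      also have "1 + r / 2 + (r / 2)\<^sup>2 \<le> 1 + r / 2 + (1 / 2)\<^sup>2" using r 1 by (intro add_left_mono power_mono) auto
      also have "\<dots> \<le> 2" using 1 by (simp add: power2_eq_square)
      finally show ?thesis .
    qed
    have "exp 2 * exp s' * (r / 2) \<le> exp 2 * (exp s * 2) * (r / 2)"
      using e2 r by (intro mult_right_mono mult_left_mono order_trans[OF s_up]) auto
    also have "\<dots> = exp 2 * exp s * r" by simp
    finally have A: "exp 2 * exp s' * (r / 2) \<le> L" using low by linarith
    have e6: "4 \<le> exp (6 - r / 2)" using exp_ge_add_one_self[of "6 - r / 2"] 1 by linarith
    have "2 * (exp 2 * exp s * r) = exp 2 * (4 * exp s) * (r / 2)" by simp
    also have "\<dots> \<le> exp 2 * (exp (6 - r / 2) * exp s) * (r / 2)"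
      using e6 r by (intro mult_right_mono mult_left_mono) auto
    also have "\<dots> = exp 8 * (exp s * exp (- (r / 2))) * (r / 2)"
      by (simp add: mult_exp_exp)
    also have "\<dots> \<le> exp 8 * exp s' * (r / 2)"
      using s_low r by (intro mult_right_mono mult_left_mono) auto
    finally have B: "L < exp 8 * exp s' * (r / 2)" using up' by linarith
    show ?thesis using A B r 1 by (simp add: admissible_def L_def)
  next
    case 2
    then have low: "exp s * exp (2 * r) \<le> L" and up: "L < exp s * exp (8 * r)"
      using adm by (auto simp: admissible_def L_def)
    have up': "L < 2 * (exp s * exp (2 * r))"
    proof (rule ccontr)
      assume *: "\<not> ?thesis"
      then have "admissible (k - 1) s r"
        using 2 r up L by (simp add: admissible_def half)
      then show False using no by simp
    qed
    have "r / 2 \<le> exp (3 / 2 * r - 2)"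
      using exp_ge_add_one_self[of "3 / 2 * r - 2"] 2 by linarith
    then have "exp 2 * exp s' * (r / 2) \<le> exp 2 * (exp s * exp (r / 2)) * exp (3 / 2 * r - 2)"
      using s_up r by (intro mult_mono) auto
    also have "\<dots> = exp s * exp (2 * r)" by (simp add: mult_exp_exp)
    finally have A: "exp 2 * exp s' * (r / 2) \<le> L" using low by linarith
    have e4: "4 \<le> exp (8 - 5 / 2 * r)"
      using exp_ge_add_one_self[of "8 - 5 / 2 * r"] 2 by linarith
    have "2 * (exp s * exp (2 * r)) = (exp s * exp (2 * r)) * 4 * (1 / 2)" by simp
    also have "\<dots> \<le> (exp s * exp (2 * r)) * exp (8 - 5 / 2 * r) * (r / 2)"
      using e4 2 by (intro mult_mono) auto
    also have "\<dots> = exp 8 * (exp s * exp (- (r / 2))) * (r / 2)" by (simp add: mult_exp_exp)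
    also have "\<dots> \<le> exp 8 * exp s' * (r / 2)"
      using s_low r by (intro mult_right_mono mult_left_mono) auto
    finally have B: "L < exp 8 * exp s' * (r / 2)" using up' by linarith
    show ?thesis using A B r 2 by (simp add: admissible_def L_def)
  next
    case 3
    then have low: "exp s * exp (2 * r) \<le> L" and up: "L < exp s * exp (8 * r)"
      using adm by (auto simp: admissible_def L_def)
    have up': "L < 2 * (exp s * exp (2 * r))"
    proof (rule ccontr)
      assume *: "\<not> ?thesis"
      then have "admissible (k - 1) s r"
        using 3 r up L by (simp add: admissible_def half)
      then show False using no by simp
    qed
    have "exp s' * exp r \<le> exp s * exp (r / 2) * exp r"
      using s_up by (intro mult_right_mono) auto
    also have "\<dots> \<le> exp s * exp (2 * r)" using r by (simp add: mult_exp_exp)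
    finally have A: "exp s' * exp r \<le> L" using low by linarith
    have "2 \<le> exp (3 / 2 * r)" using exp_ge_add_one_self[of "3 / 2 * r"] 3 by linarith
    then have "2 * (exp s * exp (2 * r)) \<le> exp (3 / 2 * r) * (exp s * exp (2 * r))"
      by (intro mult_right_mono) auto
    also have "\<dots> = exp s * exp (- (r / 2)) * exp (4 * r)" by (simp add: mult_exp_exp)
    also have "\<dots> \<le> exp s' * exp (4 * r)" using s_low by (intro mult_right_mono) auto
    finally have B: "L < exp s' * exp (4 * r)" using up' by linarith
    show ?thesis using A B r 3 by (simp add: admissible_def L_def)
  qed
qed

text \<open>
  Halving the cube gives \<open>2\<^sup>d\<close> pieces, halving the interval gives two.
\<close>

lemma cz_boxes_split:
  assumes "R \<in> (cz_boxes :: ((real^'n) \<times> real) set set)"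
  shows "\<exists>S \<subseteq> cz_boxes. countable S \<and> disjoint S \<and> \<Union>S = R \<and>
    (\<forall>R'\<in>S. measure rho R \<le> 2 ^ CARD('n) * measure rho R' \<and> 2 * measure rho R' \<le> measure rho R)"
proof -
  obtain k s r and m :: "'n \<Rightarrow> int" where R: "R = cz_box k m s r" and adm: "admissible k s r"
    using assms by (auto simp: cz_boxes_def)
  have r: "0 < r" using adm by (simp add: admissible_def)
  define d where "d = CARD('n)"
  have two: "(2::real) \<le> 2 ^ d"
    using power_increasing[of 1 d "2::real"] by (simp add: d_def Suc_le_eq)
  show ?thesis
  proof (cases "admissible (k - 1) s r")
    case True
    define S where "S = (\<lambda>m'. cz_box (k - 1) m' s r) ` {m'. \<forall>i. m' i div 2 = m i}"
    have half: "(2::real) powi (k - 1) = 2 powi k / 2" by (simp add: power_int_diff)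
    show ?thesis
    proof (intro exI[of _ S] conjI ballI)
      show "S \<subseteq> cz_boxes" unfolding S_def cz_boxes_def using True by blast
      show "countable S" unfolding S_def by (intro countable_image) simp
      show "disjoint S"
      proof (rule disjointI)
        fix A B assume "A \<in> S" "B \<in> S" "A \<noteq> B"
        then obtain m1 m2 where AB: "A = cz_box (k - 1) m1 s r" "B = cz_box (k - 1) m2 s r" "m1 \<noteq> m2"
          unfolding S_def by blast
        show "A \<inter> B = {}"
        proof (rule ccontr)
          assume "A \<inter> B \<noteq> {}"
          then obtain x where "x \<in> dcube (k - 1) m1" "x \<in> dcube (k - 1) m2"
            unfolding AB cz_box_def by blast
          then show False using dcube_unique AB(3) by metis
        qed
      qed
      show "\<Union>S = R"
        unfolding S_def R cz_box_def dcube_split[of k m] by auto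
      fix R' assume "R' \<in> S"
      then obtain m' where "R' = cz_box (k - 1) m' s r" unfolding S_def by blast
      then have eq: "measure rho R = 2 ^ d * measure rho R'"
        using r by (simp add: R measure_cz_box half power_divide d_def)
      then show "measure rho R \<le> 2 ^ CARD('n) * measure rho R'" by (simp add: d_def)
      show "2 * measure rho R' \<le> measure rho R"
        unfolding eq using two by (intro mult_right_mono) auto
    qed
  next
    case False
    define S where "S = {cz_box k m (s - r / 2) (r / 2), cz_box k m (s + r / 2) (r / 2)}"
    show ?thesis
    proof (intro exI[of _ S] conjI ballI)
      have "admissible k (s - r / 2) (r / 2)" "admissible k (s + r / 2) (r / 2)"
        using r by (auto intro!: admissible_halve[OF adm False])
      then show "S \<subseteq> cz_boxes" unfolding S_def cz_boxes_def by blast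
      show "countable S" by (simp add: S_def)
      show "disjoint S"
        unfolding S_def disjoint_def cz_box_def by auto
      show "\<Union>S = R"
      proof -
        have "{exp (s - r)..<exp s} \<union> {exp s..<exp (s + r)} = {exp (s - r)..<exp (s + r)}"
          using r by (intro ivl_disj_un_two(3)) auto
        moreover have "s - r / 2 - r / 2 = s - r" "s - r / 2 + r / 2 = s" "s + r / 2 - r / 2 = s"
          "s + r / 2 + r / 2 = s + r" by simp_all
        ultimately show ?thesis
          unfolding S_def R cz_box_def by (simp only: Union_insert Union_empty Un_empty_right Sigma_Un_distrib2[symmetric])
      qed
      fix R' assume "R' \<in> S"
      then have eq: "measure rho R = 2 * measure rho R'"
        using r by (auto simp: S_def R measure_cz_box)
      then show "2 * measure rho R' \<le> measure rho R" by simp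
      show "measure rho R \<le> 2 ^ CARD('n) * measure rho R'"
        unfolding eq using two by (intro mult_right_mono) (auto simp: d_def)
    qed
  qed
qed

lemma ex_power_int_between:
  fixes b y :: real
  assumes b: "1 < b" and y: "0 < y"
  shows "\<exists>j::int. b powi j \<le> y \<and> y < b powi (j + 1)"
proof (intro exI conjI)
  let ?j = "\<lfloor>log b y\<rfloor>"
  have powr: "b powi j = b powr real_of_int j" for j
    using b by (simp add: powr_real_of_int')
  have "b powr real_of_int ?j \<le> b powr log b y"
    using b by (intro powr_mono) auto
  then show "b powi ?j \<le> y" using b y by (simp add: powr)
  have "b powr log b y < b powr real_of_int (?j + 1)"
    using b by (intro powr_less_mono) linarith+
  then show "y < b powi (?j + 1)" using b y by (simp only: powr) simp
qed

text \<open>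
  Cut the line of all \<open>s = ln a\<close> at the points \<open>v(4\<^sup>j)\<close>, with \<open>j\<close> an integer and
  \<open>v(x) = l (x - 1/x)\<close>. An interval with midpoint \<open>s\<close> and half-length \<open>r \<ge> 1\<close> admits the cubes with
  \<open>e\<^sup>s\<^sup>+\<^sup>2\<^sup>r \<le> L < e\<^sup>s\<^sup>+\<^sup>8\<^sup>r\<close>. Towards \<open>-\<infinity>\<close> the lengths grow geometrically, fast enough that \<open>s + 2 r\<close>
  stays above \<open>l\<close>, so all cubes have side at least \<open>e\<^sup>l\<close> although \<open>a\<close> tends to zero.
\<close>

lemma ex_cz_box_partition:
  "\<exists>P \<subseteq> (cz_boxes :: ((real^'n) \<times> real) set set). countable P \<and> disjoint P \<and> \<Union>P = axb_set \<and>
    (\<forall>R\<in>P. \<sigma> \<le> measure rho R)"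
proof -
  define l where "l = max 1 (ln (max 1 \<sigma>))"
  have l: "1 \<le> l" by (simp add: l_def)
  have "max 1 \<sigma> = exp (ln (max 1 \<sigma>))" by simp
  also have "\<dots> \<le> exp l" unfolding l_def exp_le_cancel_iff by (rule max.cobounded2)
  finally have l\<sigma>: "\<sigma> \<le> exp l" by simp
  define v where "v x = l * (x - 1 / x)" for x :: real
  have v_mono: "v x \<le> v y" if "0 < x" "x \<le> y" for x y
    unfolding v_def using that l by (intro mult_left_mono diff_mono frac_le) auto
  have v_strict: "v x < v y" if "0 < x" "x < y" for x y
    unfolding v_def using that l by (intro mult_strict_left_mono diff_strict_mono frac_less2) auto
  define X where "X j = (4::real) powi j" for j :: int
  have X: "0 < X j" for j by (simp add: X_def)
  have X_Suc: "X (j + 1) = 4 * X j" for j by (simp add: X_def power_int_add)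
  have X_mono: "X i \<le> X j" if "i \<le> j" for i j
    unfolding X_def using that by (intro power_int_increasing) auto
  define s where "s j = (v (X (j + 1)) + v (X j)) / 2" for j
  define r where "r j = (v (X (j + 1)) - v (X j)) / 2" for j
  have ends: "s j - r j = v (X j)" "s j + r j = v (X (j + 1))" for j
    by (simp_all add: s_def r_def field_simps)
  have r_ge: "1 \<le> r j" for j
  proof -
    have "0 \<le> (X j - 1 / 3)\<^sup>2" by simp
    then have "X j \<le> 3 / 2 * (X j * X j) + 3 / 8" by (simp add: power2_eq_square algebra_simps)
    then have "1 \<le> 3 / 2 * X j + 3 / (8 * X j)" using X[of j] by (simp add: field_simps)
    then have "1 * 1 \<le> l * (3 / 2 * X j + 3 / (8 * X j))" using l by (intro mult_mono) auto
    also have "\<dots> = r j" using X[of j] unfolding r_def v_def X_Suc by (simp add: field_simps)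
    finally show ?thesis by simp
  qed
  have top_ge: "l \<le> s j + 2 * r j" for j
  proof -
    have "0 \<le> (X j - 1 / 11)\<^sup>2" by simp
    then have "X j \<le> 11 / 2 * (X j * X j) + 1 / 8" by (simp add: power2_eq_square algebra_simps)
    then have "1 \<le> 11 / 2 * X j + 1 / (8 * X j)" using X[of j] by (simp add: field_simps)
    then have "l * 1 \<le> l * (11 / 2 * X j + 1 / (8 * X j))" using l by (intro mult_left_mono) auto
    also have "\<dots> = s j + 2 * r j" using X[of j] unfolding s_def r_def v_def X_Suc by (simp add: field_simps)
    finally show ?thesis by simp
  qed
  have "\<exists>k::int. exp (s j + 2 * r j) \<le> 2 powi k \<and> 2 powi k \<le> 2 * exp (s j + 2 * r j)" for j
  proof -
    obtain k :: int where k: "2 powi k \<le> exp (s j + 2 * r j)" "exp (s j + 2 * r j) < 2 powi (k + 1)"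
      using ex_power_int_between[of 2 "exp (s j + 2 * r j)"] by auto
    have "(2::real) powi (k + 1) = 2 * 2 powi k" by (simp add: power_int_add)
    then show ?thesis using k by (intro exI[of _ "k + 1"]) auto
  qed
  then obtain k :: "int \<Rightarrow> int" where k: "\<And>j. exp (s j + 2 * r j) \<le> 2 powi k j"
      "\<And>j. 2 powi k j \<le> 2 * exp (s j + 2 * r j)"
    by metis
  have adm: "admissible (k j) (s j) (r j)" for j
  proof -
    have "2 < exp (6 * r j)" using exp_ge_add_one_self[of "6 * r j"] r_ge[of j] by linarith
    then have "2 * exp (s j + 2 * r j) < exp (6 * r j) * exp (s j + 2 * r j)" by simp
    also have "\<dots> = exp (s j) * exp (8 * r j)" by (simp add: mult_exp_exp)
    finally have "2 powi k j < exp (s j) * exp (8 * r j)" using k(2)[of j] by linarith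
    then show ?thesis
      using k(1)[of j] r_ge[of j] by (simp add: admissible_def exp_add)
  qed
  define P where "P = (\<lambda>(j, m). cz_box (k j) m (s j) (r j) :: ((real^'n) \<times> real) set) ` UNIV"
  have box: "(x, a) \<in> cz_box (k j) m (s j) (r j) \<longleftrightarrow> x \<in> dcube (k j) m \<and> exp (v (X j)) \<le> a \<and> a < exp (v (X (j + 1)))"
    for x :: "real^'n" and a j m
    by (simp add: cz_box_def ends)
  show ?thesis
  proof (intro exI[of _ P] conjI ballI)
    show "P \<subseteq> cz_boxes" unfolding P_def cz_boxes_def using adm by fast
    show "countable P" unfolding P_def by (intro countable_image) simp
    show "disjoint P"
    proof (rule disjointI)
      fix R R' assume RR': "R \<in> P" "R' \<in> P" "R \<noteq> R'"
      show "R \<inter> R' = {}"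
      proof (rule ccontr)
        assume "R \<inter> R' \<noteq> {}"
        then obtain x a where xa: "(x, a) \<in> R" "(x, a) \<in> R'" by auto
        obtain j m j' m' where R: "R = cz_box (k j) m (s j) (r j)" "R' = cz_box (k j') m' (s j') (r j')"
          using RR' unfolding P_def by auto
        have no: "\<not> i < i'" if "exp (v (X i')) \<le> a" "a < exp (v (X (i + 1)))" for i i'
        proof
          assume "i < i'"
          then have "v (X (i + 1)) \<le> v (X i')" using X X_mono[of "i + 1" i'] by (intro v_mono) auto
          then have "exp (v (X (i + 1))) \<le> exp (v (X i'))" by simp
          then show False using that by linarith
        qed
        have "j = j'" using xa no[of j' j] no[of j j'] unfolding R box by linarith
        moreover have "m = m'" using xa \<open>j = j'\<close> dcube_unique unfolding R box by metis
        ultimately show False using R RR'(3) by simp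
      qed
    qed
    show "\<Union>P = axb_set"
    proof (intro equalityI subsetI)
      fix z assume "z \<in> \<Union>P"
      then show "z \<in> axb_set" unfolding P_def using cz_box_axb by fastforce
    next
      fix z :: "(real^'n) \<times> real" assume "z \<in> axb_set"
      then obtain x a where z: "z = (x, a)" and a: "0 < a" by (cases z) (auto simp: axb_set_def)
      \<comment> \<open>solve \<open>y - 1/y = w\<close> for positive \<open>y\<close>\<close>
      define w where "w = ln a / l"
      define y where "y = (w + sqrt (w\<^sup>2 + 4)) / 2"
      have "\<bar>w\<bar> < sqrt (w\<^sup>2 + 4)" by (rule real_less_rsqrt) simp
      then have y: "0 < y" by (simp add: y_def)
      have "y * y = w * y + 1"
        by (simp add: y_def field_simps power2_eq_square)
      then have "y - 1 / y = w" using y by (simp add: field_simps)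
      then have vy: "v y = ln a" using l by (simp add: v_def w_def)
      obtain j :: int where j: "X j \<le> y" "y < X (j + 1)"
        using ex_power_int_between[of 4 y] y by (auto simp: X_def)
      have "v (X j) \<le> ln a" using v_mono[OF X j(1)] vy by simp
      then have "exp (v (X j)) \<le> a" using a by (metis exp_ln exp_le_cancel_iff)
      moreover have "ln a < v (X (j + 1))" using v_strict[OF y j(2)] vy by simp
      then have "a < exp (v (X (j + 1)))" using a by (metis exp_ln exp_less_cancel_iff)
      moreover have "x \<in> dcube (k j) (\<lambda>i. \<lfloor>x $ i / 2 powi k j\<rfloor>)" by (simp add: dcube_index)
      ultimately have "z \<in> cz_box (k j) (\<lambda>i. \<lfloor>x $ i / 2 powi k j\<rfloor>) (s j) (r j)" by (simp add: z box)
      then show "z \<in> \<Union>P" unfolding P_def by force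
    qed
    fix R assume "R \<in> P"
    then obtain j m where R: "R = cz_box (k j) m (s j) (r j)" unfolding P_def by auto
    define L :: real where "L = 2 powi k j"
    have "exp l \<le> L"
      using k(1)[of j] top_ge[of j] unfolding L_def by (meson exp_le_cancel_iff order_trans)
    moreover have "1 \<le> exp l" using l by simp
    ultimately have L: "1 \<le> L" "\<sigma> \<le> L" using l\<sigma> by linarith+
    have "L ^ 1 \<le> L ^ CARD('n)" using L by (intro power_increasing) (auto simp: Suc_le_eq)
    then have "1 * L \<le> (2 * r j) * L ^ CARD('n)" using r_ge[of j] L by (intro mult_mono) auto
    then show "\<sigma> \<le> measure rho R"
      using r_ge[of j] L by (simp add: R measure_cz_box flip: L_def)
  qed
qed

section \<open>The tree of Calderon--Zygmund sets\<close>

definition cz_children :: "((real^'n) \<times> real) set \<Rightarrow> ((real^'n) \<times> real) set set" where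
  "cz_children R = (SOME S. S \<subseteq> cz_boxes \<and> countable S \<and> disjoint S \<and> \<Union>S = R \<and>
    (\<forall>R'\<in>S. measure rho R \<le> 2 ^ CARD('n) * measure rho R' \<and> 2 * measure rho R' \<le> measure rho R))"

lemma cz_children:
  assumes "R \<in> (cz_boxes :: ((real^'n) \<times> real) set set)"
  shows "cz_children R \<subseteq> cz_boxes" "countable (cz_children R)" "disjoint (cz_children R)" "\<Union>(cz_children R) = R"
    "\<And>R'. R' \<in> cz_children R \<Longrightarrow> measure rho R \<le> 2 ^ CARD('n) * measure rho R'"
    "\<And>R'. R' \<in> cz_children R \<Longrightarrow> 2 * measure rho R' \<le> measure rho R"
  using someI_ex[OF cz_boxes_split[OF assms], folded cz_children_def] by blast+

primrec cz_tree :: "((real^'n) \<times> real) set set \<Rightarrow> nat \<Rightarrow> ((real^'n) \<times> real) set set" where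
  "cz_tree P 0 = P"
| "cz_tree P (Suc n) = \<Union>(cz_children ` cz_tree P n)"

lemma cz_tree_subset: "P \<subseteq> cz_boxes \<Longrightarrow> cz_tree P n \<subseteq> cz_boxes"
proof (induction n)
  case (Suc n)
  show ?case
  proof
    fix R assume "R \<in> cz_tree P (Suc n)"
    then obtain R' where "R' \<in> cz_tree P n" "R \<in> cz_children R'" by auto
    then show "R \<in> cz_boxes" using cz_children(1)[of R'] Suc by blast
  qed
qed simp

text \<open>
  Along a branch the measure is at least halved in every generation, so the sets of the tree around a point
  shrink to it by \<open>cz_box_small_near_point\<close>; this gives the approximation by sets of the tree.
\<close>

lemma partition_tree_cz_tree:
  fixes P :: "((real^'n) \<times> real) set set"
  assumes P: "P \<subseteq> cz_boxes" "countable P" "disjoint P" "\<Union>P = axb_set"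
  shows "partition_tree rho (cz_tree P) (2 ^ CARD('n))"
proof -
  note sub = cz_tree_subset[OF P(1)]
  have cover: "\<Union>(cz_tree P n) = axb_set" for n
  proof (induction n)
    case (Suc n)
    have "\<Union>(cz_tree P (Suc n)) = (\<Union>R\<in>cz_tree P n. \<Union>(cz_children R))" by auto
    also have "\<dots> = (\<Union>R\<in>cz_tree P n. R)"
    proof (intro SUP_cong refl)
      fix R assume "R \<in> cz_tree P n"
      then have "R \<in> cz_boxes" using sub by blast
      then show "\<Union>(cz_children R) = R" by (rule cz_children(4))
    qed
    also have "\<dots> = \<Union>(cz_tree P n)" by simp
    finally show ?case using Suc by simp
  qed (use P in simp)
  have cnt: "countable (cz_tree P n)" for n
  proof (induction n)
    case (Suc n)
    have "countable (cz_children R)" if "R \<in> cz_tree P n" for R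
      using that sub cz_children(2) by blast
    then show ?case using Suc by (simp add: countable_UN)
  qed (use P in simp)
  have disj: "disjoint (cz_tree P n)" for n
  proof (induction n)
    case (Suc n)
    show ?case
    proof (rule disjointI)
      fix A B assume AB: "A \<in> cz_tree P (Suc n)" "B \<in> cz_tree P (Suc n)" "A \<noteq> B"
      then obtain A' B' where A': "A' \<in> cz_tree P n" "A \<in> cz_children A'"
        and B': "B' \<in> cz_tree P n" "B \<in> cz_children B'" by auto
      have box: "A' \<in> cz_boxes" "B' \<in> cz_boxes" using A' B' sub by auto
      show "A \<inter> B = {}"
      proof (cases "A' = B'")
        case True
        then show ?thesis using disjointD[OF cz_children(3)[OF box(1)] A'(2) _ AB(3)] B'(2) by simp
      next
        case False
        then have "A' \<inter> B' = {}" using disjointD[OF Suc A'(1) B'(1)] by simp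
        then show ?thesis using cz_children(4)[OF box(1)] cz_children(4)[OF box(2)] A'(2) B'(2) by blast
      qed
    qed
  qed (use P in simp)
  have small: "\<exists>R\<in>cz_tree P n. z \<in> R \<and> 2 ^ n * measure rho R \<le> measure rho R0"
    if "R0 \<in> P" "z \<in> R0" for z R0 n
  proof (induction n)
    case (Suc n)
    then obtain R where R: "R \<in> cz_tree P n" "z \<in> R" "2 ^ n * measure rho R \<le> measure rho R0" by blast
    then have box: "R \<in> cz_boxes" using sub by blast
    then obtain R' where R': "R' \<in> cz_children R" "z \<in> R'" using cz_children(4) R(2) by blast
    have "2 ^ Suc n * measure rho R' = 2 ^ n * (2 * measure rho R')" by simp
    also have "\<dots> \<le> 2 ^ n * measure rho R"
      using cz_children(6)[OF box R'(1)] by (intro mult_left_mono) auto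
    also note R(3)
    finally show ?case using R(1) R' by (intro bexI[of _ R'] conjI) auto
  qed (use that in auto)
  show ?thesis
  proof
    fix n show "countable (cz_tree P n)" by (rule cnt)
    show "disjoint (cz_tree P n)" by (rule disj)
    show "\<Union>(cz_tree P n) = space rho" by (simp add: cover)
    fix R show "R \<in> cz_tree P n \<Longrightarrow> R \<in> sets rho" using sub cz_boxes_sets by blast
    show "R \<in> cz_tree P n \<Longrightarrow> 0 < measure rho R" using sub cz_boxes_pos by blast
    assume "R \<in> cz_tree P (Suc n)"
    then obtain R' where R': "R' \<in> cz_tree P n" "R \<in> cz_children R'" by auto
    then have box: "R' \<in> cz_boxes" using sub by blast
    have "R \<subseteq> R'" using cz_children(4)[OF box] R'(2) by blast
    then show "\<exists>R'\<in>cz_tree P n. R \<subseteq> R' \<and> measure rho R' \<le> 2 ^ CARD('n) * measure rho R"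
      using R' cz_children(5)[OF box R'(2)] by blast
  next
    show "(1::real) \<le> 2 ^ CARD('n)" by simp
  next
    fix A :: "((real^'n) \<times> real) set" and e :: real
    assume "A \<in> sets rho" "0 < e"
    then obtain U where U: "open U" "U \<subseteq> axb_set" "A \<subseteq> U" "emeasure rho U \<le> emeasure rho A + ennreal e"
      using rho_outer_regular by metis
    have "\<exists>n. \<exists>R\<in>cz_tree P n. z \<in> R \<and> R \<subseteq> U" if z: "z \<in> U" for z
    proof -
      obtain \<eta> where \<eta>: "0 < \<eta>" "\<And>w. dist w z < \<eta> \<Longrightarrow> w \<in> U"
        using U(1) z by (metis open_dist)
      have zS: "z \<in> axb_set" using z U(2) by blast
      obtain \<delta> where \<delta>: "0 < \<delta>"
        "\<forall>R\<in>cz_boxes. z \<in> R \<and> measure rho R < \<delta> \<longrightarrow> R \<subseteq> ball z \<eta>"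
        by (rule cz_box_small_near_point[OF zS \<eta>(1)])
      obtain R0 where R0: "R0 \<in> P" "z \<in> R0" using zS P(4) by blast
      obtain n where n: "measure rho R0 / \<delta> < 2 ^ n" using real_arch_pow[of 2] by fastforce
      obtain R where R: "R \<in> cz_tree P n" "z \<in> R" "2 ^ n * measure rho R \<le> measure rho R0"
        using small[OF R0, of n] by blast
      have "measure rho R0 < 2 ^ n * \<delta>" using n \<delta>(1) by (simp add: divide_less_eq)
      then have "2 ^ n * measure rho R < 2 ^ n * \<delta>" using R(3) by linarith
      then have "measure rho R < \<delta>" by simp
      then have "R \<subseteq> ball z \<eta>" using \<delta>(2) R(1,2) sub by blast
      then have "R \<subseteq> U" using \<eta>(2) by (auto simp: dist_commute)
      then show ?thesis using R by blast
    qed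
    moreover have "U \<in> sets rho" using U(1,2) by (simp add: sets_rho)
    ultimately show "\<exists>U\<in>sets rho. A \<subseteq> U \<and> emeasure rho U \<le> emeasure rho A + ennreal e \<and>
        (\<forall>z\<in>U. \<exists>n. \<exists>R\<in>cz_tree P n. z \<in> R \<and> R \<subseteq> U)"
      using U(3,4) by blast
  qed
qed

section \<open>Atoms and the Hardy space\<close>

lemma Lp_enorm_1: "Lp_enorm M 1 f = (\<integral>\<^sup>+z. ennreal (cmod (f z)) \<partial>M)"
  by (auto simp: Lp_enorm_def ennreal_powr_def less_top)

lemma carr_Lp_1: "f \<in> carr (Lp M 1) \<longleftrightarrow> f \<in> borel_measurable M \<and> (\<integral>\<^sup>+z. ennreal (cmod (f z)) \<partial>M) < \<infinity>"
  by (simp add: Lp_def Lp_enorm_1)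

lemma nrm_Lp_1: "nrm (Lp M 1) f = enn2real (\<integral>\<^sup>+z. ennreal (cmod (f z)) \<partial>M)"
  by (simp add: Lp_def Lp_enorm_1)

lemma AE_le_nrm_Lp_inf:
  assumes "f \<in> carr (Lp M \<infinity>)"
  shows "AE z in M. cmod (f z) \<le> nrm (Lp M \<infinity>) f"
  using esssup_AE[of "\<lambda>z. ennreal (cmod (f z))" M]
proof eventually_elim
  case (elim z)
  have "esssup M (\<lambda>z. ennreal (cmod (f z))) = ennreal (nrm (Lp M \<infinity>) f)"
    using assms by (simp add: Lp_def Lp_enorm_def)
  then show ?case using elim by (simp add: Lp_def)
qed

lemma Lp_inf_bounded:
  assumes "f \<in> borel_measurable M" "AE z in M. cmod (f z) \<le> c" "0 \<le> c"
  shows "f \<in> carr (Lp M \<infinity>)" "nrm (Lp M \<infinity>) f \<le> c"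
proof -
  have "esssup M (\<lambda>z. ennreal (cmod (f z))) \<le> ennreal c"
    using assms by (intro esssup_I) (auto intro: ennreal_leI)
  moreover from this have "esssup M (\<lambda>z. ennreal (cmod (f z))) < \<infinity>"
    by (rule le_less_trans) simp
  ultimately show "f \<in> carr (Lp M \<infinity>)" "nrm (Lp M \<infinity>) f \<le> c"
    using assms(1,3) by (auto simp: Lp_def Lp_enorm_def enn2real_leI)
qed

lemma emeasure_CZ_set:
  assumes "CZ_set (R :: ((real^'n) \<times> real) set)"
  shows "R \<in> sets rho" "emeasure rho R = ennreal (measure rho R)" "0 < measure rho R"
proof -
  obtain Q L a r where R: "dyadic_cube Q L" "0 < a" "0 < r" "R = Q \<times> {a * exp (- r)..a * exp r}"
    using assms unfolding CZ_set_def by blast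
  obtain k m where Q: "Q = dcube k m"
    using R(1) unfolding dyadic_cube_def dcube_def by auto
  have R': "R = dcube k m \<times> {exp (ln a - r)..exp (ln a + r)}"
    using R(2) by (simp add: R(4) Q exp_diff exp_add exp_minus divide_inverse)
  have e: "emeasure rho R = ennreal (2 * r * (2 powi k) ^ CARD('n))"
    unfolding R' by (rule emeasure_cz_box(2)[OF R(3)])
  then show "emeasure rho R = ennreal (measure rho R)" "0 < measure rho R"
    using R(3) by (auto simp: measure_def)
  then have "emeasure rho R \<noteq> 0" by simp
  then show "R \<in> sets rho" using emeasure_notin_sets by blast
qed

lemma H1_atom_L1:
  assumes "H1_atom A"
  shows "A \<in> borel_measurable rho" "(\<integral>\<^sup>+z. ennreal (cmod (A z)) \<partial>rho) \<le> 1"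
proof -
  obtain R where R: "CZ_set R" "A \<in> carr (Lp rho \<infinity>)" "AE z in rho. z \<notin> R \<longrightarrow> A z = 0"
      "nrm (Lp rho \<infinity>) A \<le> 1 / measure rho R"
    using assms unfolding H1_atom_def by blast
  show "A \<in> borel_measurable rho" using R(2) by (simp add: Lp_def)
  have [measurable]: "R \<in> sets rho" by (rule emeasure_CZ_set[OF R(1)])
  have "(\<integral>\<^sup>+z. ennreal (cmod (A z)) \<partial>rho) \<le> (\<integral>\<^sup>+z. ennreal (1 / measure rho R) * indicator R z \<partial>rho)"
  proof (rule nn_integral_mono_AE)
    show "AE z in rho. ennreal (cmod (A z)) \<le> ennreal (1 / measure rho R) * indicator R z"
      using R(3) AE_le_nrm_Lp_inf[OF R(2)]
    proof eventually_elim
      case (elim z)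
      then show ?case using R(4) by (auto intro!: ennreal_leI split: split_indicator)
    qed
  qed
  also have "\<dots> = ennreal (1 / measure rho R) * ennreal (measure rho R)"
    using emeasure_CZ_set(2)[OF R(1)] by (simp add: nn_integral_cmult_indicator)
  also have "\<dots> = 1"
    using emeasure_CZ_set(3)[OF R(1)] by (simp flip: ennreal_mult)
  finally show "(\<integral>\<^sup>+z. ennreal (cmod (A z)) \<partial>rho) \<le> 1" .
qed

lemma H1_atom_zero: "H1_atom (\<lambda>_ :: (real^'n) \<times> real. 0)"
proof -
  obtain P :: "((real^'n) \<times> real) set set" where P: "P \<subseteq> cz_boxes" "\<Union>P = axb_set"
    using ex_cz_box_partition by metis
  have "(0, 1) \<in> (axb_set :: ((real^'n) \<times> real) set)" by (simp add: axb_set_def)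
  then obtain R0 where "R0 \<in> (cz_boxes :: ((real^'n) \<times> real) set set)" using P by blast
  then obtain R :: "((real^'n) \<times> real) set" where R: "CZ_set R"
    unfolding cz_boxes_def using CZ_set_cz_box by blast
  then show ?thesis
    unfolding H1_atom_def using Lp_inf_bounded[of "\<lambda>_. 0" rho 0]
    by (intro exI[of _ R]) (auto intro: order_trans[of _ 0])
qed

lemma H1_atom_normalize:
  assumes T: "T \<in> (cz_boxes :: ((real^'n) \<times> real) set set)" and h: "0 < h"
    and [measurable]: "a \<in> borel_measurable rho" and le: "AE z in rho. cmod (a z) \<le> h"
    and supp: "\<And>z. z \<notin> T \<Longrightarrow> a z = 0" and mean: "(\<integral>z. a z \<partial>rho) = 0"
  shows "H1_atom (\<lambda>z. a z / of_real (h * measure rho T))"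
proof -
  obtain R where R: "CZ_set R" "T \<subseteq> R" "measure rho R = measure rho T"
    using T CZ_set_cz_box unfolding cz_boxes_def by blast
  have pos: "0 < measure rho T" using T by (rule cz_boxes_pos)
  have bd: "AE z in rho. cmod (a z / of_real (h * measure rho T)) \<le> 1 / measure rho R"
    using le
  proof eventually_elim
    case (elim z)
    have "cmod (of_real (h * measure rho T)) = h * measure rho T"
      using h pos by (simp only: norm_of_real) simp
    then show ?case
      using elim h pos R(3) by (simp only: norm_divide) (simp add: field_simps)
  qed
  show ?thesis
    unfolding H1_atom_def
  proof (intro exI[of _ R] conjI)
    show "AE z in rho. z \<notin> R \<longrightarrow> a z / of_real (h * measure rho T) = 0"
      using supp R(2) by (intro AE_I2) auto
    show "(\<integral>z. a z / of_real (h * measure rho T) \<partial>rho) = 0"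
      using mean by simp
  qed (use R(1) Lp_inf_bounded[OF _ bd] in auto)
qed

lemma norm_sums_le_suminf:
  fixes f :: "nat \<Rightarrow> 'b::banach"
  assumes "f sums s"
  shows "ennreal (norm s) \<le> (\<Sum>j. ennreal (norm (f j)))"
proof (cases "(\<Sum>j. ennreal (norm (f j))) = \<infinity>")
  case False
  then have sm: "summable (\<lambda>j. norm (f j))"
    by (intro summable_suminf_not_top) auto
  then have "norm s \<le> (\<Sum>j. norm (f j))"
    using summable_norm[OF sm] assms by (simp add: sums_iff)
  then show ?thesis
    using sm by (simp add: suminf_ennreal2 ennreal_leI)
qed simp

text \<open>
  Atoms have \<open>L\<^sup>1\<close>-norm at most 1, so the tail of the series is bounded in \<open>L\<^sup>1\<close> by the tail of the
  coefficients: pointwise convergence almost everywhere is enough.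
\<close>

lemma atomic_decompI:
  assumes A: "\<And>j. H1_atom (A j)" and c: "summable (\<lambda>j. cmod (c j))"
    and [measurable]: "h \<in> borel_measurable rho"
    and sums: "AE z in rho. (\<lambda>j. c j * A j z) sums h z"
  shows "atomic_decomp h c A" "(\<integral>\<^sup>+z. ennreal (cmod (h z)) \<partial>rho) \<le> ennreal (\<Sum>j. cmod (c j))"
proof -
  have [measurable]: "A j \<in> borel_measurable rho" for j using A by (rule H1_atom_L1)
  have tail: "(\<integral>\<^sup>+z. ennreal (cmod (h z - (\<Sum>j<N. c j * A j z))) \<partial>rho) \<le> ennreal (\<Sum>j. cmod (c (j + N)))" for N
  proof -
    have "(\<integral>\<^sup>+z. ennreal (cmod (h z - (\<Sum>j<N. c j * A j z))) \<partial>rho)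
        \<le> (\<integral>\<^sup>+z. (\<Sum>j. ennreal (cmod (c (j + N) * A (j + N) z))) \<partial>rho)"
    proof (rule nn_integral_mono_AE)
      show "AE z in rho. ennreal (cmod (h z - (\<Sum>j<N. c j * A j z))) \<le> (\<Sum>j. ennreal (cmod (c (j + N) * A (j + N) z)))"
        using sums
      proof eventually_elim
        case (elim z)
        show ?case by (rule norm_sums_le_suminf[OF sums_split_initial_segment[OF elim]])
      qed
    qed
    also have "\<dots> = (\<Sum>j. \<integral>\<^sup>+z. ennreal (cmod (c (j + N) * A (j + N) z)) \<partial>rho)"
      by (rule nn_integral_suminf) measurable
    also have "\<dots> \<le> (\<Sum>j. ennreal (cmod (c (j + N))))"
    proof (intro suminf_le)
      fix j
      have "(\<integral>\<^sup>+z. ennreal (cmod (c (j + N) * A (j + N) z)) \<partial>rho)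
          = ennreal (cmod (c (j + N))) * (\<integral>\<^sup>+z. ennreal (cmod (A (j + N) z)) \<partial>rho)"
        by (simp add: norm_mult ennreal_mult nn_integral_cmult)
      also have "\<dots> \<le> ennreal (cmod (c (j + N))) * 1"
        by (intro mult_left_mono H1_atom_L1 A) simp
      finally show "(\<integral>\<^sup>+z. ennreal (cmod (c (j + N) * A (j + N) z)) \<partial>rho) \<le> ennreal (cmod (c (j + N)))" by simp
    qed auto
    also have "\<dots> = ennreal (\<Sum>j. cmod (c (j + N)))"
      using summable_ignore_initial_segment[OF c, of N] by (intro suminf_ennreal2) auto
    finally show ?thesis .
  qed
  show "(\<integral>\<^sup>+z. ennreal (cmod (h z)) \<partial>rho) \<le> ennreal (\<Sum>j. cmod (c j))"
    using tail[of 0] by simp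
  have "(\<lambda>N. nrm (Lp rho 1) (\<lambda>z. h z - (\<Sum>j<N. c j * A j z))) \<longlonglongrightarrow> 0"
  proof (rule tendsto_sandwich)
    show "\<forall>\<^sub>F N in sequentially. 0 \<le> nrm (Lp rho 1) (\<lambda>z. h z - (\<Sum>j<N. c j * A j z))"
      by (simp add: nrm_Lp_1)
    show "\<forall>\<^sub>F N in sequentially. nrm (Lp rho 1) (\<lambda>z. h z - (\<Sum>j<N. c j * A j z))
        \<le> (\<Sum>j. cmod (c j)) - (\<Sum>j<N. cmod (c j))"
    proof (intro always_eventually allI)
      fix N
      have "nrm (Lp rho 1) (\<lambda>z. h z - (\<Sum>j<N. c j * A j z)) \<le> (\<Sum>j. cmod (c (j + N)))"
        unfolding nrm_Lp_1 using summable_ignore_initial_segment[OF c, of N]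
        by (intro enn2real_leI tail suminf_nonneg) auto
      then show "nrm (Lp rho 1) (\<lambda>z. h z - (\<Sum>j<N. c j * A j z)) \<le> (\<Sum>j. cmod (c j)) - (\<Sum>j<N. cmod (c j))"
        using suminf_minus_initial_segment[OF c, of N] by simp
    qed
    have "(\<lambda>N. (\<Sum>j. cmod (c j)) - (\<Sum>j<N. cmod (c j))) \<longlonglongrightarrow> (\<Sum>j. cmod (c j)) - (\<Sum>j. cmod (c j))"
      by (intro tendsto_diff tendsto_const summable_LIMSEQ c)
    then show "(\<lambda>N. (\<Sum>j. cmod (c j)) - (\<Sum>j<N. cmod (c j))) \<longlonglongrightarrow> 0" by simp
  qed simp
  then show "atomic_decomp h c A"
    using A c by (simp add: atomic_decomp_def)
qed

lemma atomic_decomp_L1_le: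
  assumes dec: "atomic_decomp h c A" and h: "h \<in> carr (Lp rho 1)"
  shows "(\<integral>\<^sup>+z. ennreal (cmod (h z)) \<partial>rho) \<le> ennreal (\<Sum>j. cmod (c j))"
proof -
  have A: "\<And>j. H1_atom (A j)" and c: "summable (\<lambda>j. cmod (c j))"
    and lim: "(\<lambda>N. nrm (Lp rho 1) (\<lambda>z. h z - (\<Sum>j<N. c j * A j z))) \<longlonglongrightarrow> 0"
    using dec by (auto simp: atomic_decomp_def)
  have [measurable]: "A j \<in> borel_measurable rho" for j using A by (rule H1_atom_L1)
  have [measurable]: "h \<in> borel_measurable rho" and fin: "(\<integral>\<^sup>+z. ennreal (cmod (h z)) \<partial>rho) < \<infinity>"
    using h by (auto simp: carr_Lp_1)
  have S: "(\<integral>\<^sup>+z. ennreal (cmod (\<Sum>j<N. c j * A j z)) \<partial>rho) \<le> ennreal (\<Sum>j<N. cmod (c j))" for N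
  proof -
    have "(\<integral>\<^sup>+z. ennreal (cmod (\<Sum>j<N. c j * A j z)) \<partial>rho)
        \<le> (\<integral>\<^sup>+z. (\<Sum>j<N. ennreal (cmod (c j)) * ennreal (cmod (A j z))) \<partial>rho)"
    proof (intro nn_integral_mono)
      fix z
      have "cmod (\<Sum>j<N. c j * A j z) \<le> (\<Sum>j<N. cmod (c j) * cmod (A j z))"
        using norm_sum[of "\<lambda>j. c j * A j z" "{..<N}"] by (simp add: norm_mult)
      then have "ennreal (cmod (\<Sum>j<N. c j * A j z)) \<le> ennreal (\<Sum>j<N. cmod (c j) * cmod (A j z))"
        by (rule ennreal_leI)
      then show "ennreal (cmod (\<Sum>j<N. c j * A j z)) \<le> (\<Sum>j<N. ennreal (cmod (c j)) * ennreal (cmod (A j z)))"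
        by (simp add: ennreal_mult flip: sum_ennreal)
    qed
    also have "\<dots> = (\<Sum>j<N. ennreal (cmod (c j)) * (\<integral>\<^sup>+z. ennreal (cmod (A j z)) \<partial>rho))"
      by (subst nn_integral_sum) (auto simp: nn_integral_cmult)
    also have "\<dots> \<le> (\<Sum>j<N. ennreal (cmod (c j)) * 1)"
      by (intro sum_mono mult_left_mono H1_atom_L1 A) simp
    finally show ?thesis by simp
  qed
  have bound: "enn2real (\<integral>\<^sup>+z. ennreal (cmod (h z)) \<partial>rho)
      \<le> nrm (Lp rho 1) (\<lambda>z. h z - (\<Sum>j<N. c j * A j z)) + (\<Sum>j. cmod (c j))" for N
  proof -
    let ?S = "\<lambda>z. \<Sum>j<N. c j * A j z"
    have fin_diff: "(\<integral>\<^sup>+z. ennreal (cmod (h z - ?S z)) \<partial>rho) < \<infinity>"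
    proof -
      have "(\<integral>\<^sup>+z. ennreal (cmod (h z - ?S z)) \<partial>rho) \<le> (\<integral>\<^sup>+z. ennreal (cmod (h z)) + ennreal (cmod (?S z)) \<partial>rho)"
        by (intro nn_integral_mono) (auto intro: norm_triangle_ineq4 ennreal_leI simp flip: ennreal_plus)
      also have "\<dots> = (\<integral>\<^sup>+z. ennreal (cmod (h z)) \<partial>rho) + (\<integral>\<^sup>+z. ennreal (cmod (?S z)) \<partial>rho)"
        by (intro nn_integral_add) auto
      also have "\<dots> < \<infinity>"
        using fin le_less_trans[OF S[of N]] by simp
      finally show ?thesis .
    qed
    have "(\<integral>\<^sup>+z. ennreal (cmod (h z)) \<partial>rho)
        \<le> (\<integral>\<^sup>+z. ennreal (cmod (h z - ?S z)) + ennreal (cmod (?S z)) \<partial>rho)"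
    proof (intro nn_integral_mono)
      fix z
      have "cmod (h z) \<le> cmod (h z - ?S z) + cmod (?S z)"
        using norm_triangle_ineq[of "h z - ?S z" "?S z"] by simp
      then show "ennreal (cmod (h z)) \<le> ennreal (cmod (h z - ?S z)) + ennreal (cmod (?S z))"
        by (simp add: ennreal_leI flip: ennreal_plus)
    qed
    also have "\<dots> = (\<integral>\<^sup>+z. ennreal (cmod (h z - ?S z)) \<partial>rho) + (\<integral>\<^sup>+z. ennreal (cmod (?S z)) \<partial>rho)"
      by (intro nn_integral_add) auto
    also have "\<dots> \<le> ennreal (nrm (Lp rho 1) (\<lambda>z. h z - ?S z)) + ennreal (\<Sum>j<N. cmod (c j))"
      using fin_diff S[of N] by (intro add_mono) (auto simp: nrm_Lp_1)
    also have "\<dots> = ennreal (nrm (Lp rho 1) (\<lambda>z. h z - ?S z) + (\<Sum>j<N. cmod (c j)))"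
      by (simp add: nrm_Lp_1 sum_nonneg)
    finally have "enn2real (\<integral>\<^sup>+z. ennreal (cmod (h z)) \<partial>rho)
        \<le> nrm (Lp rho 1) (\<lambda>z. h z - ?S z) + (\<Sum>j<N. cmod (c j))"
      by (intro enn2real_leI add_nonneg_nonneg sum_nonneg) (auto simp: nrm_Lp_1)
    also have "(\<Sum>j<N. cmod (c j)) \<le> (\<Sum>j. cmod (c j))"
      using c by (intro sum_le_suminf) auto
    finally show ?thesis by simp
  qed
  have "enn2real (\<integral>\<^sup>+z. ennreal (cmod (h z)) \<partial>rho) \<le> 0 + (\<Sum>j. cmod (c j))"
    by (rule LIMSEQ_le_const[OF tendsto_add[OF lim tendsto_const]]) (use bound in blast)
  then have "ennreal (enn2real (\<integral>\<^sup>+z. ennreal (cmod (h z)) \<partial>rho)) \<le> ennreal (\<Sum>j. cmod (c j))"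
    by (intro ennreal_leI) simp
  then show ?thesis using fin by simp
qed

lemma H1_nrm_nonneg:
  assumes "h \<in> carr H1"
  shows "0 \<le> nrm H1 h"
proof -
  have ne: "{\<Sum>j. cmod (c j) |c. \<exists>A. atomic_decomp h c A} \<noteq> {}"
    using assms by (auto simp: H1_def)
  show ?thesis
    unfolding H1_def nspace.simps
    by (rule cInf_greatest[OF ne]) (auto simp: atomic_decomp_def suminf_nonneg)
qed

lemma H1_nrm_le:
  assumes "atomic_decomp h c A"
  shows "nrm H1 h \<le> (\<Sum>j. cmod (c j))"
  unfolding H1_def nspace.simps
proof (rule cInf_lower)
  show "bdd_below {\<Sum>j. cmod (c j) |c. \<exists>A. atomic_decomp h c A}"
    by (rule bdd_belowI[of _ 0]) (auto simp: atomic_decomp_def suminf_nonneg)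
qed (use assms in blast)

lemma L1_le_H1:
  assumes h: "h \<in> carr H1"
  shows "(\<integral>\<^sup>+z. ennreal (cmod (h z)) \<partial>rho) \<le> ennreal (nrm H1 h)"
proof -
  have ne: "{\<Sum>j. cmod (c j) |c. \<exists>A. atomic_decomp h c A} \<noteq> {}" and L1: "h \<in> carr (Lp rho 1)"
    using h by (auto simp: H1_def)
  have "enn2real (\<integral>\<^sup>+z. ennreal (cmod (h z)) \<partial>rho) \<le> nrm H1 h"
    unfolding H1_def nspace.simps
  proof (rule cInf_greatest[OF ne])
    fix x assume "x \<in> {\<Sum>j. cmod (c j) |c. \<exists>A. atomic_decomp h c A}"
    then obtain c A where "x = (\<Sum>j. cmod (c j))" "atomic_decomp h c A" by blast
    then show "enn2real (\<integral>\<^sup>+z. ennreal (cmod (h z)) \<partial>rho) \<le> x"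
      using atomic_decomp_L1_le[OF _ L1] by (auto intro!: enn2real_leI suminf_nonneg simp: atomic_decomp_def)
  qed
  then have "ennreal (enn2real (\<integral>\<^sup>+z. ennreal (cmod (h z)) \<partial>rho)) \<le> ennreal (nrm H1 h)"
    by (rule ennreal_leI)
  then show ?thesis using L1 by (simp add: carr_Lp_1)
qed

text \<open>
  The roots are chosen so large that the part of \<open>\<bar>f\<bar>\<close> above \<open>l / 2\<close> contributes at most \<open>l / 2\<close> to every
  average over a root; the part below contributes at most \<open>l / 2\<close> anyway. The tree therefore depends on \<open>f\<close> and
  \<open>l\<close>, but the bounds do not.
\<close>

proposition H1_decomposition:
  fixes f :: "(real^'n) \<times> real \<Rightarrow> complex"
  assumes f [measurable]: "f \<in> borel_measurable rho" and l: "0 < l" and Phi: "log_tail_mass rho f l < \<infinity>"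
  obtains g \<Omega> where "g \<in> borel_measurable rho" "AE z in rho. cmod (g z) \<le> 2 ^ CARD('n) * l"
    "\<Omega> \<in> sets rho" "ennreal l * emeasure rho \<Omega> \<le> 2 * log_tail_mass rho f l"
    "\<forall>z. z \<notin> \<Omega> \<longrightarrow> g z = f z"
    "(\<lambda>z. f z - g z) \<in> carr H1"
    "ennreal (nrm H1 (\<lambda>z. f z - g z)) \<le> ennreal (6 * 2 ^ CARD('n)) * log_tail_mass rho f l"
proof -
  have tail: "tail_mass rho f (l / 2) < \<infinity>"
    using tail_mass_le_log[of rho f l] Phi by (rule le_less_trans)
  then obtain \<tau> where \<tau>: "tail_mass rho f (l / 2) = ennreal \<tau>" "0 \<le> \<tau>"
    by (cases "tail_mass rho f (l / 2)") auto
  obtain P :: "((real^'n) \<times> real) set set" where P: "P \<subseteq> cz_boxes" "countable P" "disjoint P" "\<Union>P = axb_set"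
      "\<And>R. R \<in> P \<Longrightarrow> 2 * \<tau> / l \<le> measure rho R"
    using ex_cz_box_partition[of "2 * \<tau> / l"] by metis
  interpret partition_tree rho "cz_tree P" "2 ^ CARD('n)"
    by (rule partition_tree_cz_tree[OF P(1-4)])
  interpret calderon_zygmund rho "cz_tree P" "2 ^ CARD('n)" f l
  proof
    fix R assume "R \<in> cz_tree P 0"
    then have R: "R \<in> P" by simp
    then have [measurable]: "R \<in> sets rho" using P(1) cz_boxes_sets by blast
    have pos: "0 < measure rho R" using R P(1) cz_boxes_pos by blast
    have fin: "emeasure rho R = ennreal (measure rho R)"
      using gen_finite[of R 0] R by simp
    have "mass_on rho f R
        \<le> ennreal (l / 2) * emeasure rho R
          + (\<integral>\<^sup>+z. ennreal (cmod (f z)) * indicator {z. l / 2 < cmod (f z)} z * indicator R z \<partial>rho)"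
      using l by (intro mass_le_tail_mass) auto
    also have "\<dots> \<le> ennreal (l / 2) * emeasure rho R + tail_mass rho f (l / 2)"
      unfolding tail_mass_def
      by (intro add_left_mono nn_integral_mono) (auto split: split_indicator)
    also have "\<dots> = ennreal (l / 2 * measure rho R + \<tau>)"
      unfolding fin \<tau>(1) using l \<tau>(2) by (subst ennreal_mult[symmetric]) (auto simp: ennreal_plus)
    also have "\<dots> \<le> ennreal (l * measure rho R)"
      using P(5)[OF R] l by (intro ennreal_leI) (simp add: field_simps)
    finally show "mass_on rho f R \<le> ennreal (l * measure rho R)" .
  qed (use l tail in simp_all)
  obtain T :: "nat \<Rightarrow> ((real^'n) \<times> real) set" and a :: "nat \<Rightarrow> (real^'n) \<times> real \<Rightarrow> complex" and h :: "nat \<Rightarrow> real"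
    where "\<forall>j. T j \<in> insert {} (\<Union>n. cz_tree P n)" "\<forall>j. 0 < h j"
      "\<forall>j. a j \<in> borel_measurable rho" "\<forall>j. AE z in rho. cmod (a j z) \<le> h j"
      "\<forall>j z. z \<notin> T j \<longrightarrow> a j z = 0" "\<forall>j. (\<integral>z. a j z \<partial>rho) = 0"
      and total: "(\<Sum>j. ennreal (h j) * emeasure rho (T j)) \<le> ennreal (6 * 2 ^ CARD('n)) * log_tail_mass rho f l"
      and sums: "AE z in rho. (\<lambda>j. a j z) sums (f z - good l z)"
    by (rule atomic_pieces[OF Phi])
  then have T: "T j \<in> insert {} (\<Union>n. cz_tree P n)" and h: "0 < h j" and a: "a j \<in> borel_measurable rho"
      "AE z in rho. cmod (a j z) \<le> h j" "z \<notin> T j \<Longrightarrow> a j z = 0" "(\<integral>z. a j z \<partial>rho) = 0" for j z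
    by blast+
  define c where "c j = (of_real (h j * measure rho (T j)) :: complex)" for j
  define A where "A j = (if T j = {} then (\<lambda>_. 0) else (\<lambda>z. a j z / c j))" for j
  have T_box: "T j \<in> cz_boxes" if ne: "T j \<noteq> {}" for j
  proof -
    obtain n where "T j \<in> cz_tree P n" using T[of j] ne by blast
    then show ?thesis using cz_tree_subset[OF P(1)] by blast
  qed
  have T_fin: "emeasure rho (T j) = ennreal (measure rho (T j))" for j
    using gen_finite T[of j] by auto
  have atoms: "H1_atom (A j)" for j
  proof (cases "T j = {}")
    case True
    then show ?thesis by (simp add: A_def H1_atom_zero)
  next
    case False
    then show ?thesis
      using H1_atom_normalize[OF T_box[OF False] h a(1) a(2) a(3) a(4)] by (simp add: A_def c_def)
  qed
  have cA: "c j * A j z = a j z" for j z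
  proof (cases "T j = {}")
    case True
    then show ?thesis using a(3) by (simp add: A_def)
  next
    case False
    then have "c j \<noteq> 0" using cz_boxes_pos[OF T_box[OF False]] h[of j] by (simp add: c_def)
    then show ?thesis using False by (simp add: A_def)
  qed
  have norm_c: "ennreal (cmod (c j)) = ennreal (h j) * emeasure rho (T j)" for j
    using h[of j] by (simp add: c_def T_fin norm_mult abs_mult ennreal_mult less_imp_le)
  have total': "(\<Sum>j. ennreal (cmod (c j))) \<le> ennreal (6 * 2 ^ CARD('n)) * log_tail_mass rho f l"
    using total by (simp add: norm_c)
  also have "\<dots> < \<infinity>" using Phi by (simp add: ennreal_mult_less_top)
  finally have c_sum: "summable (\<lambda>j. cmod (c j))"
    by (intro summable_suminf_not_top) auto
  have meas: "(\<lambda>z. f z - good l z) \<in> borel_measurable rho" by measurable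
  have sums': "AE z in rho. (\<lambda>j. c j * A j z) sums (f z - good l z)"
    using sums by (simp add: cA)
  note dec = atomic_decompI[of A c "\<lambda>z. f z - good l z", OF atoms c_sum meas sums']
  have "ennreal (nrm H1 (\<lambda>z. f z - good l z)) \<le> ennreal (\<Sum>j. cmod (c j))"
    by (rule ennreal_leI[OF H1_nrm_le[OF dec(1)]])
  also have "\<dots> = (\<Sum>j. ennreal (cmod (c j)))"
    using c_sum by (subst suminf_ennreal2) auto
  finally have nrm_le: "ennreal (nrm H1 (\<lambda>z. f z - good l z)) \<le> ennreal (6 * 2 ^ CARD('n)) * log_tail_mass rho f l"
    using total' by (rule order_trans)
  have carr: "(\<lambda>z. f z - good l z) \<in> carr H1"
  proof -
    have "(\<integral>\<^sup>+z. ennreal (cmod (f z - good l z)) \<partial>rho) < \<infinity>"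
      by (rule le_less_trans[OF dec(2)]) simp
    then have "(\<lambda>z. f z - good l z) \<in> carr (Lp rho 1)" using meas by (simp add: carr_Lp_1)
    then show ?thesis using dec(1) unfolding H1_def nspace.simps by blast
  qed
  have bad_set: "ennreal l * emeasure rho (bad_set l) \<le> 2 * log_tail_mass rho f l"
    using emeasure_bad_set_le[OF l] tail_mass_le_log[of rho f l] by (meson mult_left_mono order_trans zero_le)
  have off: "\<forall>z. z \<notin> bad_set l \<longrightarrow> good l z = f z" using good_off by blast
  show thesis
    by (rule that[OF good_meas AE_good_le[OF order_refl] Union_stopped_sets bad_set off carr nrm_le])
qed

section \<open>Layer cake formulas\<close>

lemma sigma_finite_rho: "sigma_finite_measure (rho :: ((real^'n) \<times> real) measure)"
proof
  obtain P :: "((real^'n) \<times> real) set set" where P: "P \<subseteq> cz_boxes" "countable P" "\<Union>P = axb_set"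
    using ex_cz_box_partition by metis
  show "\<exists>A. countable A \<and> A \<subseteq> sets rho \<and> \<Union>A = space (rho :: ((real^'n) \<times> real) measure) \<and>
      (\<forall>a\<in>A. emeasure rho a \<noteq> \<infinity>)"
  proof (intro exI[of _ P] conjI ballI)
    show "P \<subseteq> sets rho" using P(1) cz_boxes_sets by blast
    fix R assume "R \<in> P"
    then have "0 < measure rho R" using P(1) cz_boxes_pos by blast
    then show "emeasure rho R \<noteq> \<infinity>" by (auto simp: measure_def)
  qed (use P in auto)
qed

lemma nn_integral_powr:
  assumes "-1 < a" "0 \<le> c"
  shows "(\<integral>\<^sup>+v. ennreal (v powr a) * indicator {0<..<c} v \<partial>lborel) = ennreal (c powr (a + 1) / (a + 1))"
proof -
  have "(\<integral>\<^sup>+v. ennreal (v powr a) * indicator {0<..<c} v \<partial>lborel) = (\<integral>\<^sup>+v. ennreal (v powr a) * indicator {0..c} v \<partial>lborel)"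
    using AE_lborel_singleton[of 0] AE_lborel_singleton[of c]
    by (intro nn_integral_cong_AE, eventually_elim) (auto split: split_indicator)
  also have "\<dots> = ennreal (c powr (a + 1) / (a + 1))"
    by (intro nn_integral_has_integral_lebesgue' has_integral_powr_from_0 assms) auto
  finally show ?thesis .
qed

lemma nn_integral_powr_cmult:
  assumes "0 < a" "0 \<le> c"
  shows "(\<integral>\<^sup>+v. ennreal (a * v powr (a - 1)) * indicator {0<..<c} v \<partial>lborel) = ennreal (c powr a)"
proof -
  have "(\<integral>\<^sup>+v. ennreal (a * v powr (a - 1)) * indicator {0<..<c} v \<partial>lborel)
      = (\<integral>\<^sup>+v. ennreal a * (ennreal (v powr (a - 1)) * indicator {0<..<c} v) \<partial>lborel)"
    using assms by (intro nn_integral_cong) (simp add: ennreal_mult mult.assoc)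
  also have "\<dots> = ennreal a * ennreal (c powr a / a)"
    using nn_integral_powr[of "a - 1" c] assms by (subst nn_integral_cmult) auto
  also have "\<dots> = ennreal (c powr a)"
    using assms by (simp flip: ennreal_mult)
  finally show ?thesis .
qed

lemma powr_less_iff:
  fixes x y a :: real
  assumes "0 < a" "0 \<le> x" "0 \<le> y"
  shows "x powr a < y powr a \<longleftrightarrow> x < y"
  using assms by (meson less_imp_le linorder_not_less powr_less_mono2 powr_mono2)

definition sublevel :: "real \<Rightarrow> ennreal \<Rightarrow> real set" where
  "sublevel q m = {t. 0 < t \<and> ennreal (t powr q) < m}"

lemma nn_integral_sublevel:
  assumes q: "0 < q"
  shows "(\<integral>\<^sup>+t. ennreal (q * t powr (q - 1)) * indicator (sublevel q m) t \<partial>lborel) = m"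
proof -
  have real_case: "(\<integral>\<^sup>+t. ennreal (q * t powr (q - 1)) * indicator (sublevel q (ennreal y)) t \<partial>lborel) = ennreal y"
    if y: "0 \<le> y" for y
  proof -
    have "t powr q < y \<longleftrightarrow> t < y powr (1 / q)" if t: "0 < t" for t
    proof -
      have "t = (t powr q) powr (1 / q)" using q t by (simp add: powr_powr)
      moreover have "(t powr q) powr (1 / q) < y powr (1 / q) \<longleftrightarrow> t powr q < y"
        using q y by (intro powr_less_iff) auto
      ultimately show ?thesis by simp
    qed
    then have "sublevel q (ennreal y) = {0<..<y powr (1 / q)}"
      using y by (auto simp: sublevel_def ennreal_less_iff)
    then show ?thesis
      using nn_integral_powr_cmult[OF q, of "y powr (1 / q)"] q y by (simp add: powr_powr)
  qed
  have mono: "(\<integral>\<^sup>+t. ennreal (q * t powr (q - 1)) * indicator (sublevel q m1) t \<partial>lborel)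
      \<le> (\<integral>\<^sup>+t. ennreal (q * t powr (q - 1)) * indicator (sublevel q m2) t \<partial>lborel)" if "m1 \<le> m2" for m1 m2
    using that by (intro nn_integral_mono mult_left_mono) (auto simp: sublevel_def split: split_indicator)
  show ?thesis
  proof (cases m)
    case (real y)
    then show ?thesis using real_case by simp
  next
    case top
    have "m \<le> (\<integral>\<^sup>+t. ennreal (q * t powr (q - 1)) * indicator (sublevel q m) t \<partial>lborel)"
    proof (rule dense_le)
      fix y assume y: "y < m"
      then obtain y' where "y = ennreal y'" "0 \<le> y'" by (cases y) auto
      then show "y \<le> (\<integral>\<^sup>+t. ennreal (q * t powr (q - 1)) * indicator (sublevel q m) t \<partial>lborel)"
        using real_case[of y'] mono[of y m] y by simp
    qed
    then show ?thesis using top by (simp add: top_unique)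
  qed
qed

lemma sublevel_measurable:
  assumes [measurable]: "D \<in> borel_measurable borel"
  shows "Measurable.pred (borel \<Otimes>\<^sub>M borel) (\<lambda>(v, t). t \<in> sublevel q (D v))"
  unfolding sublevel_def by measurable

text \<open>
  A weighted integral of \<open>D\<close> over the height \<open>v\<close> becomes an integral over \<open>t\<close>. It is applied to the
  distribution function of \<open>f\<close> and to its counterpart \<open>excess\<close>.
\<close>

lemma nn_integral_swap_levels:
  fixes D :: "real \<Rightarrow> ennreal"
  assumes q: "0 < q" and [measurable]: "D \<in> borel_measurable borel" "w \<in> borel_measurable borel"
  shows "(\<integral>\<^sup>+v. w v * D v \<partial>lborel)
    = (\<integral>\<^sup>+t. (\<integral>\<^sup>+v. w v * (ennreal (q * t powr (q - 1)) * indicator (sublevel q (D v)) t) \<partial>lborel) \<partial>lborel)"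
proof -
  have [measurable]: "Measurable.pred (borel \<Otimes>\<^sub>M borel) (\<lambda>(v, t). t \<in> sublevel q (D v))"
    by (rule sublevel_measurable) simp
  have ind: "(\<lambda>(v, t). indicator (sublevel q (D v)) t :: ennreal) \<in> borel_measurable (borel \<Otimes>\<^sub>M borel)"
  proof -
    have "(\<lambda>x. indicator {x. case x of (v, t) \<Rightarrow> t \<in> sublevel q (D v)} x :: ennreal) \<in> borel_measurable (borel \<Otimes>\<^sub>M borel)"
      by measurable
    then show ?thesis by (simp add: indicator_def case_prod_beta)
  qed
  have meas: "(\<lambda>(v, t). w v * (ennreal (q * t powr (q - 1)) * indicator (sublevel q (D v)) t))
      \<in> borel_measurable (borel \<Otimes>\<^sub>M borel)"
    using ind by (simp add: case_prod_beta)
  have sec: "(\<lambda>t. ennreal (q * t powr (q - 1)) * indicator (sublevel q (D v)) t) \<in> borel_measurable borel" for v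
    unfolding sublevel_def by measurable
  have "(\<integral>\<^sup>+v. w v * D v \<partial>lborel)
      = (\<integral>\<^sup>+v. (\<integral>\<^sup>+t. w v * (ennreal (q * t powr (q - 1)) * indicator (sublevel q (D v)) t) \<partial>lborel) \<partial>lborel)"
    using sec by (simp add: nn_integral_cmult nn_integral_sublevel[OF q])
  also have "\<dots> = (\<integral>\<^sup>+t. (\<integral>\<^sup>+v. w v * (ennreal (q * t powr (q - 1)) * indicator (sublevel q (D v)) t) \<partial>lborel) \<partial>lborel)"
    using meas by (intro lborel_pair.Fubini'[symmetric]) simp
  finally show ?thesis .
qed

lemma (in sigma_finite_measure) nn_integral_layer_cake:
  assumes [measurable]: "f \<in> borel_measurable M" and p: "0 < p"
  shows "power_mass M p f
    = (\<integral>\<^sup>+v. height_weight p v * emeasure M {z \<in> space M. v < cmod (f z)} \<partial>lborel)"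
proof -
  interpret pair_sigma_finite M lborel ..
  have "power_mass M p f
      = (\<integral>\<^sup>+z. (\<integral>\<^sup>+v. height_weight p v * indicator {z. v < cmod (f z)} z \<partial>lborel) \<partial>M)"
  proof (intro nn_integral_cong)
    fix z
    have "ennreal (cmod (f z) powr p) = (\<integral>\<^sup>+v. ennreal (p * v powr (p - 1)) * indicator {0<..<cmod (f z)} v \<partial>lborel)"
      using nn_integral_powr_cmult[OF p, of "cmod (f z)"] by simp
    also have "\<dots> = (\<integral>\<^sup>+v. height_weight p v * indicator {z. v < cmod (f z)} z \<partial>lborel)"
      by (intro nn_integral_cong) (auto split: split_indicator)
    finally show "ennreal (cmod (f z) powr p) = (\<integral>\<^sup>+v. height_weight p v * indicator {z. v < cmod (f z)} z \<partial>lborel)" .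
  qed
  also have "\<dots> = (\<integral>\<^sup>+v. (\<integral>\<^sup>+z. height_weight p v * indicator {z. v < cmod (f z)} z \<partial>M) \<partial>lborel)"
    by (intro Fubini'[symmetric]) (simp add: indicator_def case_prod_beta)
  also have "\<dots> = (\<integral>\<^sup>+v. height_weight p v * emeasure M {z \<in> space M. v < cmod (f z)} \<partial>lborel)"
  proof (intro nn_integral_cong)
    fix v :: real
    have "(\<integral>\<^sup>+z. height_weight p v * indicator {z. v < cmod (f z)} z \<partial>M)
        = (\<integral>\<^sup>+z. height_weight p v * indicator {z \<in> space M. v < cmod (f z)} z \<partial>M)"
      by (intro nn_integral_cong) (auto split: split_indicator)
    also have "\<dots> = height_weight p v * emeasure M {z \<in> space M. v < cmod (f z)}"
      by (intro nn_integral_cmult_indicator) measurable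
    finally show "(\<integral>\<^sup>+z. height_weight p v * indicator {z. v < cmod (f z)} z \<partial>M)
        = height_weight p v * emeasure M {z \<in> space M. v < cmod (f z)}" .
  qed
  finally show ?thesis .
qed

section \<open>Lebesgue norms and level sets\<close>

lemma carr_Lp_real:
  assumes "0 < p"
  shows "f \<in> carr (Lp M (ereal p)) \<longleftrightarrow> f \<in> borel_measurable M \<and> power_mass M p f < \<infinity>"
  by (auto simp: Lp_def Lp_enorm_def ennreal_powr_def less_top)

lemma nrm_Lp_real:
  assumes "f \<in> carr (Lp M (ereal p))" "0 < p"
  shows "nrm (Lp M (ereal p)) f = enn2real (power_mass M p f) powr (1 / p)"
  using assms by (auto simp: carr_Lp_real) (auto simp: Lp_def Lp_enorm_def ennreal_powr_def)

lemma Lp_real_integral: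
  assumes "f \<in> carr (Lp M (ereal p))" "0 < p"
  shows "power_mass M p f = ennreal (nrm (Lp M (ereal p)) f powr p)"
  using assms by (simp add: nrm_Lp_real powr_powr carr_Lp_real)

lemma nrm_Lp_nonneg: "0 \<le> nrm (Lp M p) f"
  by (simp add: Lp_def)

lemma emeasure_above_le_L1:
  assumes [measurable]: "f \<in> borel_measurable M" and w: "0 < w" and u: "ennreal u < emeasure M {z \<in> space M. w < cmod (f z)}"
    and I: "(\<integral>\<^sup>+z. ennreal (cmod (f z)) \<partial>M) \<le> ennreal n" and n: "0 \<le> n" and u0: "0 \<le> u"
  shows "w * u \<le> n"
proof -
  have "ennreal (w * u) = ennreal w * ennreal u" using w u0 by (simp add: ennreal_mult)
  also have "\<dots> \<le> ennreal w * emeasure M {z \<in> space M. w < cmod (f z)}"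
    using u by (intro mult_left_mono) auto
  also have "\<dots> = (\<integral>\<^sup>+z. ennreal w * indicator {z \<in> space M. w < cmod (f z)} z \<partial>M)"
    by (intro nn_integral_cmult_indicator[symmetric]) measurable
  also have "\<dots> \<le> (\<integral>\<^sup>+z. ennreal (cmod (f z)) \<partial>M)"
    by (intro nn_integral_mono) (auto intro!: ennreal_leI split: split_indicator)
  also note I
  finally show ?thesis using n by simp
qed

text \<open>
  The reciprocal exponent, with \<open>1 / \<infinity> = 0\<close>; the conjugate exponent is \<open>1 / (1 - recip p)\<close>.
\<close>

definition recip :: "ereal \<Rightarrow> real" where
  "recip p = (if p = \<infinity> then 0 else 1 / real_of_ereal p)"

lemma emeasure_above_le_Lp:
  assumes f: "f \<in> carr (Lp M p)" and p: "0 < p" and w: "0 < w" and u: "0 < u"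
    and above: "ennreal u < emeasure M {z \<in> space M. w < cmod (f z)}"
  shows "w * u powr recip p \<le> nrm (Lp M p) f"
proof (cases "p = \<infinity>")
  case True
  have "w \<le> nrm (Lp M p) f"
  proof (rule ccontr)
    assume less: "\<not> w \<le> nrm (Lp M p) f"
    have "AE z in M. \<not> w < cmod (f z)"
      using AE_le_nrm_Lp_inf[of f M] f True less by (auto elim!: eventually_mono)
    then have "emeasure M {z \<in> space M. w < cmod (f z)} = 0"
      using f True by (subst emeasure_eq_0_AE) auto
    then show False using above by simp
  qed
  then show ?thesis using True u by (simp add: recip_def)
next
  case False
  then obtain P where P: "p = ereal P" "0 < P" using p by (cases p) auto
  have f': "f \<in> carr (Lp M (ereal P))" using f P by simp
  then have [measurable]: "f \<in> borel_measurable M" using P by (simp add: carr_Lp_real)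
  have "w powr P * u \<le> nrm (Lp M (ereal P)) f powr P"
  proof (rule emeasure_above_le_L1[where f = "\<lambda>z. complex_of_real (cmod (f z) powr P)" and M = M])
    show "(\<integral>\<^sup>+z. ennreal (cmod (complex_of_real (cmod (f z) powr P))) \<partial>M) \<le> ennreal (nrm (Lp M (ereal P)) f powr P)"
      using Lp_real_integral[OF f' P(2)] by simp
    have "{z \<in> space M. w < cmod (f z)} = {z \<in> space M. w powr P < cmod (complex_of_real (cmod (f z) powr P))}"
      using w P(2) by (auto simp: powr_less_iff less_imp_le)
    then show "ennreal u < emeasure M {z \<in> space M. w powr P < cmod (complex_of_real (cmod (f z) powr P))}"
      using above by simp
  qed (use w u in auto)
  then have "(w powr P * u) powr (1 / P) \<le> (nrm (Lp M (ereal P)) f powr P) powr (1 / P)"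
    using P w u by (intro powr_mono2) auto
  then show ?thesis
    using P w u nrm_Lp_nonneg[of M "ereal P" f] by (simp add: recip_def powr_mult powr_powr)
qed

section \<open>Integrals over all heights\<close>

context sigma_finite_measure
begin

lemma tail_mass_measurable [measurable]:
  assumes [measurable]: "f \<in> borel_measurable M"
  shows "(\<lambda>v. tail_mass M f (c * v)) \<in> borel_measurable borel"
proof -
  have "(\<lambda>(v, z). ennreal (cmod (f z)) * indicator {z. c * v < cmod (f z)} z) \<in> borel_measurable (borel \<Otimes>\<^sub>M M)"
    by (simp add: indicator_def case_prod_beta)
  then show ?thesis
    unfolding tail_mass_def by (rule borel_measurable_nn_integral)
qed

lemma nn_integral_tail_mass:
  assumes [measurable]: "f \<in> borel_measurable M" and p: "1 < p" and c: "0 < c"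
  shows "(\<integral>\<^sup>+v. ennreal (p * v powr (p - 2)) * indicator {0<..} v * tail_mass M f (c * v) \<partial>lborel)
    = ennreal (p / (p - 1) * (1 / c) powr (p - 1)) * power_mass M p f"
proof -
  interpret pair_sigma_finite M lborel ..
  have "(\<integral>\<^sup>+v. ennreal (p * v powr (p - 2)) * indicator {0<..} v * tail_mass M f (c * v) \<partial>lborel)
      = (\<integral>\<^sup>+v. (\<integral>\<^sup>+z. ennreal (p * v powr (p - 2)) * indicator {0<..} v * (ennreal (cmod (f z)) * indicator {z. c * v < cmod (f z)} z) \<partial>M) \<partial>lborel)"
    unfolding tail_mass_def by (intro nn_integral_cong nn_integral_cmult[symmetric]) measurable
  also have "\<dots> = (\<integral>\<^sup>+z. (\<integral>\<^sup>+v. ennreal (p * v powr (p - 2)) * indicator {0<..} v * (ennreal (cmod (f z)) * indicator {z. c * v < cmod (f z)} z) \<partial>lborel) \<partial>M)"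
    by (intro Fubini') (simp add: indicator_def case_prod_beta)
  also have "\<dots> = (\<integral>\<^sup>+z. ennreal (p / (p - 1) * (1 / c) powr (p - 1)) * ennreal (cmod (f z) powr p) \<partial>M)"
  proof (intro nn_integral_cong)
    fix z
    define x where "x = cmod (f z)"
    have x: "0 \<le> x" by (simp add: x_def)
    have "(\<integral>\<^sup>+v. ennreal (p * v powr (p - 2)) * indicator {0<..} v * (ennreal x * indicator {z. c * v < cmod (f z)} z) \<partial>lborel)
        = (\<integral>\<^sup>+v. ennreal (p * x) * (ennreal (v powr (p - 2)) * indicator {0<..<x / c} v) \<partial>lborel)"
    proof (intro nn_integral_cong)
      fix v :: real
      have "c * v < x \<longleftrightarrow> v < x / c" using c by (simp add: less_divide_eq mult.commute)
      then show "ennreal (p * v powr (p - 2)) * indicator {0<..} v * (ennreal x * indicator {z. c * v < cmod (f z)} z)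
          = ennreal (p * x) * (ennreal (v powr (p - 2)) * indicator {0<..<x / c} v)"
        using p x by (auto simp: x_def[symmetric] ennreal_mult mult_ac split: split_indicator)
    qed
    also have "\<dots> = ennreal (p * x) * ennreal ((x / c) powr (p - 2 + 1) / (p - 2 + 1))"
      using p x c by (subst nn_integral_cmult) (auto simp: nn_integral_powr)
    also have "\<dots> = ennreal (p * x * ((x / c) powr (p - 1) / (p - 1)))"
      using p x by (subst ennreal_mult[symmetric]) auto
    also have "p * x * ((x / c) powr (p - 1) / (p - 1)) = p / (p - 1) * (1 / c) powr (p - 1) * x powr p"
    proof -
      have "x * x powr (p - 1) = x powr p"
        using x p by (cases "x = 0") (auto simp: powr_mult_base)
      then show ?thesis using x c by (simp add: powr_divide mult_ac)
    qed
    also have "ennreal \<dots> = ennreal (p / (p - 1) * (1 / c) powr (p - 1)) * ennreal (x powr p)"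
      using p by (intro ennreal_mult) auto
    finally show "(\<integral>\<^sup>+v. ennreal (p * v powr (p - 2)) * indicator {0<..} v * (ennreal (cmod (f z)) * indicator {z. c * v < cmod (f z)} z) \<partial>lborel)
        = ennreal (p / (p - 1) * (1 / c) powr (p - 1)) * ennreal (cmod (f z) powr p)"
      by (simp add: x_def)
  qed
  also have "\<dots> = ennreal (p / (p - 1) * (1 / c) powr (p - 1)) * power_mass M p f"
    by (intro nn_integral_cmult) measurable
  finally show ?thesis .
qed

lemma log_tail_mass_measurable [measurable]:
  assumes [measurable]: "f \<in> borel_measurable M"
  shows "log_tail_mass M f \<in> borel_measurable borel"
proof -
  have "(\<lambda>v. tail_mass M f (2 ^ n * v / 2)) \<in> borel_measurable borel" for n
    using tail_mass_measurable[OF assms, of "2 ^ n / 2"] by simp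
  then show ?thesis unfolding log_tail_mass_def[abs_def] by measurable
qed

text \<open>
  The term for \<open>n\<close> contributes \<open>2\<^sup>-\<^sup>n\<^sup>(\<^sup>p\<^sup>-\<^sup>1\<^sup>)\<close> times a constant, so the sum is a geometric series, convergent as
  \<open>p > 1\<close>.
\<close>

lemma nn_integral_log_tail_mass:
  assumes f [measurable]: "f \<in> borel_measurable M" and p: "1 < p"
  shows "(\<integral>\<^sup>+v. ennreal (p * v powr (p - 2)) * indicator {0<..} v * log_tail_mass M f v \<partial>lborel)
    = ennreal (p / (p - 1) * 2 powr (p - 1) * (1 / (1 - (1 / 2) powr (p - 1))))
      * power_mass M p f"
proof -
  define J where "J = power_mass M p f"
  define A where "A = p / (p - 1) * 2 powr (p - 1)"
  define x where "x = (1 / 2) powr (p - 1)"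
  have A: "0 < A" using p by (simp add: A_def)
  have x: "0 < x" "x < 1"
    using p powr_less_mono2[of "p - 1" "1 / 2" 1] by (auto simp: x_def)
  have tm [measurable]: "(\<lambda>v. tail_mass M f (2 ^ n / 2 * v)) \<in> borel_measurable borel" for n
    by (rule tail_mass_measurable[OF f])
  have "(\<integral>\<^sup>+v. ennreal (p * v powr (p - 2)) * indicator {0<..} v * log_tail_mass M f v \<partial>lborel)
      = (\<integral>\<^sup>+v. (\<Sum>n. ennreal (p * v powr (p - 2)) * indicator {0<..} v * tail_mass M f (2 ^ n / 2 * v)) \<partial>lborel)"
    unfolding log_tail_mass_def by simp
  also have "\<dots> = (\<Sum>n. \<integral>\<^sup>+v. ennreal (p * v powr (p - 2)) * indicator {0<..} v * tail_mass M f (2 ^ n / 2 * v) \<partial>lborel)"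
    by (rule nn_integral_suminf) measurable
  also have "\<dots> = (\<Sum>n. ennreal (A * x ^ n) * J)"
  proof (intro suminf_cong)
    fix n
    have "(1 / (2 ^ n / 2)) powr (p - 1) = (2 * (1 / 2) ^ n) powr (p - 1)"
      by (simp add: power_divide)
    also have "\<dots> = 2 powr (p - 1) * x ^ n"
      by (simp add: powr_mult x_def powr_power mult.commute flip: powr_realpow) (simp add: powr_powr mult.commute)
    finally show "(\<integral>\<^sup>+v. ennreal (p * v powr (p - 2)) * indicator {0<..} v * tail_mass M f (2 ^ n / 2 * v) \<partial>lborel)
        = ennreal (A * x ^ n) * J"
      using nn_integral_tail_mass[OF f p, of "2 ^ n / 2"] by (simp add: A_def J_def mult.assoc)
  qed
  also have "\<dots> = (\<Sum>n. ennreal (A * x ^ n)) * J"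
    by (rule ennreal_suminf_multc)
  also have "(\<Sum>n. ennreal (A * x ^ n)) = ennreal (A * (1 / (1 - x)))"
    using x A by (intro suminf_ennreal_eq sums_mult geometric_sums) auto
  finally show ?thesis by (simp only: J_def A_def x_def)
qed

lemma nn_integral_truncated_power:
  assumes f [measurable]: "f \<in> borel_measurable M" and p: "1 < p" "p < P"
  shows "(\<lambda>v. \<integral>\<^sup>+z. ennreal (min (cmod (f z) / v) 1 powr P) \<partial>M) \<in> borel_measurable borel"
    and "(\<integral>\<^sup>+v. height_weight p v * (\<integral>\<^sup>+z. ennreal (min (cmod (f z) / v) 1 powr P) \<partial>M) \<partial>lborel)
      \<le> ennreal (1 + p / (P - p)) * power_mass M p f"
proof -
  have meas: "(\<lambda>(v, z). ennreal (min (cmod (f z) / v) 1 powr P)) \<in> borel_measurable (borel \<Otimes>\<^sub>M M)"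
    by measurable
  show "(\<lambda>v. \<integral>\<^sup>+z. ennreal (min (cmod (f z) / v) 1 powr P) \<partial>M) \<in> borel_measurable borel"
    using borel_measurable_nn_integral[of "\<lambda>v z. ennreal (min (cmod (f z) / v) 1 powr P)" borel, OF meas] .
  interpret pair_sigma_finite M lborel ..
  have "(\<integral>\<^sup>+v. height_weight p v * (\<integral>\<^sup>+z. ennreal (min (cmod (f z) / v) 1 powr P) \<partial>M) \<partial>lborel)
      = (\<integral>\<^sup>+v. (\<integral>\<^sup>+z. height_weight p v * ennreal (min (cmod (f z) / v) 1 powr P) \<partial>M) \<partial>lborel)"
    by (intro nn_integral_cong nn_integral_cmult[symmetric]) measurable
  also have "\<dots> = (\<integral>\<^sup>+z. (\<integral>\<^sup>+v. height_weight p v * ennreal (min (cmod (f z) / v) 1 powr P) \<partial>lborel) \<partial>M)"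
    by (intro Fubini') measurable
  also have "\<dots> \<le> (\<integral>\<^sup>+z. ennreal (1 + p / (P - p)) * ennreal (cmod (f z) powr p) \<partial>M)"
  proof (intro nn_integral_mono)
    fix z
    define x where "x = cmod (f z)"
    show "(\<integral>\<^sup>+v. height_weight p v * ennreal (min (cmod (f z) / v) 1 powr P) \<partial>lborel)
        \<le> ennreal (1 + p / (P - p)) * ennreal (cmod (f z) powr p)"
    proof (cases "x = 0")
      case True
      then show ?thesis using p by (simp add: x_def[symmetric] min_def)
    next
      case False
      then have x: "0 < x" by (simp add: x_def)
      have "(\<integral>\<^sup>+v. height_weight p v * ennreal (min (x / v) 1 powr P) \<partial>lborel)
          \<le> (\<integral>\<^sup>+v. ennreal (p * v powr (p - 1)) * indicator {0<..<x} v
              + ennreal (p * x powr P) * (ennreal (v powr (p - 1 - P)) * indicator {x..} v) \<partial>lborel)"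
      proof (intro nn_integral_mono)
        fix v :: real
        show "height_weight p v * ennreal (min (x / v) 1 powr P)
          \<le> ennreal (p * v powr (p - 1)) * indicator {0<..<x} v
              + ennreal (p * x powr P) * (ennreal (v powr (p - 1 - P)) * indicator {x..} v)"
        proof (cases "0 < v")
          case v: True
          show ?thesis
          proof (cases "v < x")
            case True
            then have "min (x / v) 1 = 1" using v by (simp add: min_def)
            then show ?thesis using True v by simp
          next
            case False
            then have "min (x / v) 1 = x / v" using v by (simp add: min_def)
            then have "p * v powr (p - 1) * min (x / v) 1 powr P = p * x powr P * v powr (p - 1 - P)"
              using x v by (simp add: powr_divide powr_diff)
            then show ?thesis using False v x p by (simp flip: ennreal_mult)
          qed
        qed simp
      qed
      also have "\<dots> = ennreal (x powr p) + ennreal (p * x powr P) * (\<integral>\<^sup>+v. ennreal (v powr (p - 1 - P)) * indicator {x..} v \<partial>lborel)"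
        using p x by (subst nn_integral_add) (auto simp: nn_integral_cmult nn_integral_powr_cmult)
      also have "(\<integral>\<^sup>+v. ennreal (v powr (p - 1 - P)) * indicator {x..} v \<partial>lborel) = ennreal (- (x powr (p - 1 - P + 1)) / (p - 1 - P + 1))"
        using p x by (intro nn_integral_has_integral_lebesgue' has_integral_powr_to_inf) auto
      also have "- (x powr (p - 1 - P + 1)) / (p - 1 - P + 1) = x powr (p - P) / (P - p)"
        using p by (simp add: field_simps)
      also have "ennreal (x powr p) + ennreal (p * x powr P) * ennreal (x powr (p - P) / (P - p))
          = ennreal (x powr p + p * x powr P * (x powr (p - P) / (P - p)))"
        using p by (simp add: ennreal_mult[symmetric] ennreal_plus[symmetric] del: ennreal_plus)
      also have "x powr p + p * x powr P * (x powr (p - P) / (P - p)) = (1 + p / (P - p)) * x powr p"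
      proof -
        have "x powr P * x powr (p - P) = x powr p" using x by (simp flip: powr_add)
        then have "p * x powr P * (x powr (p - P) / (P - p)) = p / (P - p) * x powr p" by simp
        then show ?thesis by (simp add: algebra_simps)
      qed
      also have "ennreal \<dots> = ennreal (1 + p / (P - p)) * ennreal (x powr p)"
        using p by (intro ennreal_mult) auto
      finally show ?thesis by (simp add: x_def)
    qed
  qed
  also have "\<dots> = ennreal (1 + p / (P - p)) * power_mass M p f"
    by (intro nn_integral_cmult) measurable
  finally show "(\<integral>\<^sup>+v. height_weight p v * (\<integral>\<^sup>+z. ennreal (min (cmod (f z) / v) 1 powr P) \<partial>M) \<partial>lborel)
      \<le> ennreal (1 + p / (P - p)) * power_mass M p f" .
qed

text \<open>
  A majorant of the measure of the set where \<open>\<bar>f\<bar>\<close> exceeds \<open>v\<close>. The first summand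
  measures the bad part of \<open>f\<close> at height \<open>v\<close>; the second one controls the \<open>L\<^sup>p\<^sup>1\<close>-norm of \<open>f\<close> where
  \<open>\<bar>f\<bar> \<le> v\<close>, so that a single inequality bounds both parts of the decomposition.
\<close>

definition excess :: "ereal \<Rightarrow> ('a \<Rightarrow> complex) \<Rightarrow> real \<Rightarrow> ennreal" where
  "excess p\<^sub>1 f v = ennreal (1 / v) * log_tail_mass M f v
    + (if p\<^sub>1 = \<infinity> then 0 else \<integral>\<^sup>+z. ennreal (min (cmod (f z) / v) 1 powr real_of_ereal p\<^sub>1) \<partial>M)"

lemma excess_measurable:
  assumes f [measurable]: "f \<in> borel_measurable M" and p: "1 < p" "ereal p < p\<^sub>1"
  shows "excess p\<^sub>1 f \<in> borel_measurable borel"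
proof (cases p\<^sub>1)
  case (real P)
  then have [measurable]: "(\<lambda>v. \<integral>\<^sup>+z. ennreal (min (cmod (f z) / v) 1 powr P) \<partial>M) \<in> borel_measurable borel"
    using p by (intro nn_integral_truncated_power(1)[of f p]) auto
  show ?thesis unfolding excess_def[abs_def] real by simp
qed (use p in \<open>auto simp: excess_def[abs_def]\<close>)

lemma nn_integral_excess:
  assumes p: "1 < p" "ereal p < p\<^sub>1"
  shows "\<exists>C>0. \<forall>f\<in>borel_measurable M.
    (\<integral>\<^sup>+v. height_weight p v * excess p\<^sub>1 f v \<partial>lborel)
      \<le> ennreal C * power_mass M p f"
proof -
  define A where "A = p / (p - 1) * 2 powr (p - 1) * (1 / (1 - (1 / 2) powr (p - 1)))"
  define B where "B = (if p\<^sub>1 = \<infinity> then 0 else 1 + p / (real_of_ereal p\<^sub>1 - p))"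
  have A: "0 < A"
    using p powr_less_mono2[of "p - 1" "1 / 2" 1] by (simp add: A_def)
  have B: "0 \<le> B"
    using p by (cases p\<^sub>1) (auto simp: B_def)
  have "(\<integral>\<^sup>+v. height_weight p v * excess p\<^sub>1 f v \<partial>lborel)
      \<le> ennreal (A + B) * power_mass M p f"
    if f [measurable]: "f \<in> borel_measurable M" for f
  proof -
    define J where "J = power_mass M p f"
    define E where "E v = (if p\<^sub>1 = \<infinity> then 0 else \<integral>\<^sup>+z. ennreal (min (cmod (f z) / v) 1 powr real_of_ereal p\<^sub>1) \<partial>M)" for v
    have C: "(\<integral>\<^sup>+v. ennreal (p * v powr (p - 2)) * indicator {0<..} v * log_tail_mass M f v \<partial>lborel) = ennreal A * J"
      using nn_integral_log_tail_mass[OF f p(1)] by (simp only: J_def A_def)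
    have "E \<in> borel_measurable borel \<and> (\<integral>\<^sup>+v. height_weight p v * E v \<partial>lborel) \<le> ennreal B * J"
    proof (cases p\<^sub>1)
      case (real P)
      then show ?thesis
        using nn_integral_truncated_power[OF f p(1), of P] p
        by (simp add: J_def E_def[abs_def] B_def)
    qed (use p in \<open>auto simp: E_def[abs_def]\<close>)
    then have [measurable]: "E \<in> borel_measurable borel"
      and B_le: "(\<integral>\<^sup>+v. height_weight p v * E v \<partial>lborel) \<le> ennreal B * J"
      by auto
    have "(\<integral>\<^sup>+v. height_weight p v * excess p\<^sub>1 f v \<partial>lborel)
        = (\<integral>\<^sup>+v. ennreal (p * v powr (p - 2)) * indicator {0<..} v * log_tail_mass M f v
              + height_weight p v * E v \<partial>lborel)"
    proof (intro nn_integral_cong)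
      fix v :: real
      have "ennreal (p * v powr (p - 1)) * ennreal (1 / v) = ennreal (p * v powr (p - 2))" if "0 < v"
      proof -
        have "v powr (p - 2) = v powr (p - 1) / v" using that powr_diff[of v "p - 1" 1] by simp
        then show ?thesis using that p by (simp flip: ennreal_mult)
      qed
      then show "height_weight p v * excess p\<^sub>1 f v
          = ennreal (p * v powr (p - 2)) * indicator {0<..} v * log_tail_mass M f v
              + height_weight p v * E v"
        by (auto simp: excess_def E_def distrib_left mult.assoc[symmetric] split: split_indicator)
    qed
    also have "\<dots> \<le> ennreal A * J + ennreal B * J"
      using C B_le by (subst nn_integral_add) (auto intro: add_left_mono)
    also have "\<dots> = ennreal (A + B) * J"
      using A B by (simp add: distrib_right)
    finally show ?thesis by (simp add: J_def)
  qed
  then show ?thesis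
    using A B by (intro exI[of _ "A + B"]) auto
qed

end

section \<open>Bounds for the K-functional\<close>

lemma carr_Lp_measurable: "f \<in> carr (Lp M p) \<Longrightarrow> f \<in> borel_measurable M"
  by (simp add: Lp_def)

lemma carr_H1_measurable: "f \<in> carr H1 \<Longrightarrow> f \<in> borel_measurable rho"
  by (simp add: H1_def carr_Lp_1)

lemma sum_carr_measurable:
  assumes "f \<in> sum_carr H1 (Lp rho p\<^sub>1)"
  shows "f \<in> borel_measurable rho"
proof -
  obtain x0 x1 where "x0 \<in> carr H1" "x1 \<in> carr (Lp rho p\<^sub>1)" and f: "f = x0 + x1"
    using assms by (auto simp: sum_carr_def)
  then have [measurable]: "x0 \<in> borel_measurable rho" "x1 \<in> borel_measurable rho"
    using carr_H1_measurable carr_Lp_measurable by auto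
  have "(\<lambda>z. x0 z + x1 z) \<in> borel_measurable rho" by measurable
  then show ?thesis by (simp add: f plus_fun_def)
qed

lemma K_functional_le:
  assumes "x\<^sub>0 \<in> carr H1" "x\<^sub>1 \<in> carr (Lp rho p\<^sub>1)" "f = x\<^sub>0 + x\<^sub>1" "0 < t"
  shows "K_functional t f H1 (Lp rho p\<^sub>1) \<le> nrm H1 x\<^sub>0 + t * nrm (Lp rho p\<^sub>1) x\<^sub>1"
  unfolding K_functional_def
proof (rule cInf_lower)
  show "bdd_below {nrm H1 x0 + t * nrm (Lp rho p\<^sub>1) x1 |x0 x1. x0 \<in> carr H1 \<and> x1 \<in> carr (Lp rho p\<^sub>1) \<and> f = x0 + x1}"
    using assms(4) by (intro bdd_belowI[of _ 0]) (auto intro!: add_nonneg_nonneg mult_nonneg_nonneg H1_nrm_nonneg nrm_Lp_nonneg)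
qed (use assms in blast)

lemma K_functional_ge:
  assumes f: "f \<in> sum_carr H1 (Lp rho p\<^sub>1)"
    and le: "\<And>x\<^sub>0 x\<^sub>1. x\<^sub>0 \<in> carr H1 \<Longrightarrow> x\<^sub>1 \<in> carr (Lp rho p\<^sub>1) \<Longrightarrow> f = x\<^sub>0 + x\<^sub>1 \<Longrightarrow>
      c \<le> nrm H1 x\<^sub>0 + t * nrm (Lp rho p\<^sub>1) x\<^sub>1"
  shows "c \<le> K_functional t f H1 (Lp rho p\<^sub>1)"
  unfolding K_functional_def
proof (rule cInf_greatest)
  show "{nrm H1 x0 + t * nrm (Lp rho p\<^sub>1) x1 |x0 x1. x0 \<in> carr H1 \<and> x1 \<in> carr (Lp rho p\<^sub>1) \<and> f = x0 + x1} \<noteq> {}"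
    using f by (auto simp: sum_carr_def)
qed (use le in blast)

lemma K_functional_nonneg:
  assumes "f \<in> sum_carr H1 (Lp rho p\<^sub>1)" "0 < t"
  shows "0 \<le> K_functional t f H1 (Lp rho p\<^sub>1)"
  using assms(2) by (intro K_functional_ge[OF assms(1)] add_nonneg_nonneg mult_nonneg_nonneg H1_nrm_nonneg nrm_Lp_nonneg) auto

lemma recip_bounds:
  assumes "1 < p\<^sub>1"
  shows "0 \<le> recip p\<^sub>1" "recip p\<^sub>1 < 1"
  using assms by (cases p\<^sub>1; auto simp: recip_def)+

text \<open>
  On a set of measure larger than \<open>u = t\<^sup>q/2\<close> either \<open>\<bar>x\<^sub>0\<bar>\<close> or \<open>\<bar>x\<^sub>1\<bar>\<close> exceeds \<open>v/2\<close>. By Markov's inequality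
  the first case gives \<open>\<parallel>x\<^sub>0\<parallel> \<ge> v u / 2\<close>; the second gives \<open>\<parallel>x\<^sub>1\<parallel> \<ge> (v/2) u\<^sup>\<beta>\<close> with \<open>\<beta> = 1/p\<^sub>1\<close>, where
  \<open>t t\<^sup>q\<^sup>\<beta> = t\<^sup>q\<close> since \<open>1 + q \<beta> = q\<close>.
\<close>

lemma level_le_K_functional:
  fixes f :: "(real^'n) \<times> real \<Rightarrow> complex"
  assumes f: "f \<in> sum_carr H1 (Lp rho p\<^sub>1)" and p: "1 < p\<^sub>1" and q: "q = 1 / (1 - recip p\<^sub>1)"
    and v: "0 < v" and t: "0 < t"
    and above: "ennreal (t powr q) < emeasure rho {z \<in> space rho. v < cmod (f z)}"
  shows "v * t powr q \<le> 4 * K_functional t f H1 (Lp rho p\<^sub>1)"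
proof -
  define \<beta> where "\<beta> = recip p\<^sub>1"
  have \<beta>: "0 \<le> \<beta>" "\<beta> < 1" using recip_bounds[OF p] by (auto simp: \<beta>_def)
  have q\<beta>: "1 + q * \<beta> = q" using \<beta> unfolding q \<beta>_def[symmetric] by (simp add: field_simps)
  define u where "u = t powr q / 2"
  have u: "0 < u" using t by (simp add: u_def)
  have "v * t powr q / 4 \<le> K_functional t f H1 (Lp rho p\<^sub>1)"
  proof (rule K_functional_ge[OF f])
    fix x\<^sub>0 x\<^sub>1 :: "(real^'n) \<times> real \<Rightarrow> complex"
    assume x0: "x\<^sub>0 \<in> carr H1" and x1: "x\<^sub>1 \<in> carr (Lp rho p\<^sub>1)" and fx: "f = x\<^sub>0 + x\<^sub>1"
    have [measurable]: "x\<^sub>0 \<in> borel_measurable rho" "x\<^sub>1 \<in> borel_measurable rho"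
      using carr_H1_measurable[OF x0] carr_Lp_measurable[OF x1] by auto
    define E0 where "E0 = {z \<in> space rho. v / 2 < cmod (x\<^sub>0 z)}"
    define E1 where "E1 = {z \<in> space rho. v / 2 < cmod (x\<^sub>1 z)}"
    have [measurable]: "E0 \<in> sets rho" "E1 \<in> sets rho" unfolding E0_def E1_def by measurable
    have n0: "0 \<le> nrm H1 x\<^sub>0" and n1: "0 \<le> nrm (Lp rho p\<^sub>1) x\<^sub>1"
      using H1_nrm_nonneg[OF x0] nrm_Lp_nonneg by auto
    have sub: "{z \<in> space rho. v < cmod (f z)} \<subseteq> E0 \<union> E1"
    proof
      fix z assume z: "z \<in> {z \<in> space rho. v < cmod (f z)}"
      have "cmod (f z) \<le> cmod (x\<^sub>0 z) + cmod (x\<^sub>1 z)" by (simp add: fx norm_triangle_ineq)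
      then show "z \<in> E0 \<union> E1" using z by (auto simp: E0_def E1_def)
    qed
    have "ennreal (t powr q) < emeasure rho (E0 \<union> E1)"
      using above emeasure_mono[OF sub, of rho] by (simp add: less_le_trans)
    also have "\<dots> \<le> emeasure rho E0 + emeasure rho E1" by (intro emeasure_subadditive) auto
    finally have sum: "ennreal (t powr q) < emeasure rho E0 + emeasure rho E1" .
    have "ennreal u < emeasure rho E0 \<or> ennreal u < emeasure rho E1"
    proof (rule ccontr)
      assume "\<not> ?thesis"
      then have "emeasure rho E0 + emeasure rho E1 \<le> ennreal u + ennreal u"
        by (intro add_mono) (auto simp: not_less)
      also have "\<dots> = ennreal (t powr q)" using u by (simp add: u_def flip: ennreal_plus)
      finally show False using sum by simp
    qed
    then show "v * t powr q / 4 \<le> nrm H1 x\<^sub>0 + t * nrm (Lp rho p\<^sub>1) x\<^sub>1"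
    proof
      assume "ennreal u < emeasure rho E0"
      then have "v / 2 * u \<le> nrm H1 x\<^sub>0"
        using v u n0 L1_le_H1[OF x0] unfolding E0_def by (intro emeasure_above_le_L1[of x\<^sub>0 rho]) auto
      moreover have "0 \<le> t * nrm (Lp rho p\<^sub>1) x\<^sub>1" using t n1 by simp
      ultimately show ?thesis by (simp add: u_def)
    next
      assume "ennreal u < emeasure rho E1"
      moreover have "0 < p\<^sub>1" using p by (rule less_trans[rotated]) simp
      ultimately have *: "v / 2 * u powr \<beta> \<le> nrm (Lp rho p\<^sub>1) x\<^sub>1"
        using v u x1 unfolding E1_def \<beta>_def
        by (intro emeasure_above_le_Lp) auto
      have "1 / 2 \<le> (1 / 2 :: real) powr \<beta>"
        using powr_mono'[of \<beta> 1 "1 / 2 :: real"] \<beta> by simp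
      then have "v / 2 * (1 / 2 * t powr (q * \<beta>)) \<le> v / 2 * ((1 / 2) powr \<beta> * t powr (q * \<beta>))"
        using v by (intro mult_left_mono mult_right_mono) auto
      also have "(1 / 2) powr \<beta> * t powr (q * \<beta>) = u powr \<beta>"
        using t by (simp add: u_def powr_divide powr_powr)
      also note *
      finally have "t * (v / 2 * (1 / 2 * t powr (q * \<beta>))) \<le> t * nrm (Lp rho p\<^sub>1) x\<^sub>1"
        using t by (intro mult_left_mono) auto
      moreover have "t powr q = t * t powr (q * \<beta>)"
        using t powr_add[of t 1 "q * \<beta>"] by (simp add: q\<beta>)
      then have "v * t powr q / 4 = t * (v / 2 * (1 / 2 * t powr (q * \<beta>)))" by simp
      ultimately show ?thesis using n0 by linarith
    qed
  qed
  then show ?thesis by simp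
qed

text \<open>
  The decomposition at height \<open>v\<close> has \<open>\<parallel>b\<parallel> \<le> 6 \<kappa> v t\<^sup>q\<close> in \<open>H\<^sup>1\<close>. For finite \<open>p\<^sub>1\<close>, the bound
  \<open>\<bar>g\<bar> \<le> \<kappa> v\<close> on the exceptional set \<open>\<Omega>\<close>, of measure at most \<open>2 t\<^sup>q\<close>, and
  \<open>\<bar>g\<bar> \<le> \<kappa> v min (\<bar>f\<bar> / v) 1\<close> outside it give \<open>\<parallel>g\<parallel> \<le> \<kappa> v (3 t\<^sup>q)\<^sup>\<beta>\<close> in \<open>L\<^sup>p\<^sup>1\<close> with \<open>\<beta> = 1/p\<^sub>1\<close>; once more
  \<open>t t\<^sup>q\<^sup>\<beta> = t\<^sup>q\<close>.
\<close>

lemma K_functional_le_excess: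
  fixes f :: "(real^'n) \<times> real \<Rightarrow> complex"
  assumes f [measurable]: "f \<in> borel_measurable rho" and p: "1 < p\<^sub>1" and q: "q = 1 / (1 - recip p\<^sub>1)"
    and v: "0 < v" and t: "0 < t"
    and le: "sigma_finite_measure.excess rho p\<^sub>1 f v \<le> ennreal (t powr q)"
  shows "f \<in> sum_carr H1 (Lp rho p\<^sub>1)"
    "K_functional t f H1 (Lp rho p\<^sub>1) \<le> 9 * 2 ^ CARD('n) * v * t powr q"
proof -
  interpret sigma_finite_measure "rho :: ((real^'n) \<times> real) measure" by (rule sigma_finite_rho)
  define \<kappa> :: real where "\<kappa> = 2 ^ CARD('n)"
  have \<kappa>: "1 \<le> \<kappa>" by (simp add: \<kappa>_def)
  define \<beta> where "\<beta> = recip p\<^sub>1"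
  have \<beta>: "0 \<le> \<beta>" "\<beta> < 1" using recip_bounds[OF p] by (auto simp: \<beta>_def)
  have q\<beta>: "1 + q * \<beta> = q" using \<beta> unfolding q \<beta>_def[symmetric] by (simp add: field_simps)
  have "ennreal (1 / v) * log_tail_mass rho f v \<le> ennreal (t powr q)"
    using le unfolding excess_def by (meson add_increasing2 order_trans order_refl zero_le)
  then have "ennreal v * (ennreal (1 / v) * log_tail_mass rho f v) \<le> ennreal v * ennreal (t powr q)"
    by (intro mult_left_mono) auto
  then have log_le: "log_tail_mass rho f v \<le> ennreal (v * t powr q)"
    using v by (simp add: mult.assoc[symmetric] flip: ennreal_mult)
  then have fin: "log_tail_mass rho f v < \<infinity>" by (rule le_less_trans) simp
  obtain g \<Omega> where g [measurable]: "g \<in> borel_measurable rho" and g_le: "AE z in rho. cmod (g z) \<le> 2 ^ CARD('n) * v"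
    and \<Omega> [measurable]: "\<Omega> \<in> sets rho" and \<Omega>_le: "ennreal v * emeasure rho \<Omega> \<le> 2 * log_tail_mass rho f v"
    and g_off: "\<forall>z. z \<notin> \<Omega> \<longrightarrow> g z = f z"
    and b: "(\<lambda>z. f z - g z) \<in> carr H1"
    and b_le: "ennreal (nrm H1 (\<lambda>z. f z - g z)) \<le> ennreal (6 * 2 ^ CARD('n)) * log_tail_mass rho f v"
    by (rule H1_decomposition[OF f v fin])
  have "ennreal (nrm H1 (\<lambda>z. f z - g z)) \<le> ennreal (6 * \<kappa>) * ennreal (v * t powr q)"
    using b_le log_le unfolding \<kappa>_def by (meson mult_left_mono order_trans zero_le)
  also have "\<dots> = ennreal (6 * \<kappa> * (v * t powr q))" using \<kappa> v by (intro ennreal_mult[symmetric]) auto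
  finally have b_nrm: "nrm H1 (\<lambda>z. f z - g z) \<le> 6 * \<kappa> * (v * t powr q)"
    using \<kappa> v by (subst (asm) ennreal_le_iff) auto
  have "g \<in> carr (Lp rho p\<^sub>1) \<and> nrm (Lp rho p\<^sub>1) g \<le> 3 * \<kappa> * v * t powr (q * \<beta>)"
  proof (cases "p\<^sub>1 = \<infinity>")
    case True
    then have "\<beta> = 0" by (simp add: \<beta>_def recip_def)
    moreover have "g \<in> carr (Lp rho \<infinity>)" "nrm (Lp rho \<infinity>) g \<le> \<kappa> * v"
      using Lp_inf_bounded[OF g g_le] v by (auto simp: \<kappa>_def)
    moreover have "\<kappa> * v \<le> 3 * \<kappa> * v" using \<kappa> v by simp
    ultimately show ?thesis using True t by simp
  next
    case False
    then obtain P where P: "p\<^sub>1 = ereal P" "1 < P" using p by (cases p\<^sub>1) auto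
    define E where "E = (\<integral>\<^sup>+z. ennreal (min (cmod (f z) / v) 1 powr P) \<partial>rho)"
    have "E \<le> ennreal (1 / v) * log_tail_mass rho f v + E" by (rule add_increasing) auto
    also have "\<dots> = excess p\<^sub>1 f v" by (simp add: excess_def E_def P(1))
    also note le
    finally have E_le: "E \<le> ennreal (t powr q)" .
    have "ennreal (1 / v) * (ennreal v * emeasure rho \<Omega>) \<le> ennreal (1 / v) * (2 * ennreal (v * t powr q))"
      using \<Omega>_le log_le by (intro mult_left_mono order_trans[OF \<Omega>_le]) auto
    moreover have "ennreal (1 / v) * ennreal v = 1" using v by (simp flip: ennreal_mult)
    moreover have "ennreal (1 / v) * (2 * ennreal (v * t powr q)) = ennreal (2 * t powr q)"
    proof -
      have "ennreal (1 / v) * (2 * ennreal (v * t powr q)) = ennreal (1 / v) * ennreal (2 * (v * t powr q))"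
        using v ennreal_mult[of 2 "v * t powr q"] by simp
      also have "\<dots> = ennreal (1 / v * (2 * (v * t powr q)))" using v by (intro ennreal_mult[symmetric]) auto
      finally show ?thesis using v by simp
    qed
    ultimately have \<Omega>_le': "emeasure rho \<Omega> \<le> ennreal (2 * t powr q)"
      by (simp add: mult.assoc[symmetric])
    have "power_mass rho P g
        \<le> (\<integral>\<^sup>+z. ennreal ((\<kappa> * v) powr P) * (indicator \<Omega> z + ennreal (min (cmod (f z) / v) 1 powr P)) \<partial>rho)"
    proof (rule nn_integral_mono_AE)
      show "AE z in rho. ennreal (cmod (g z) powr P) \<le> ennreal ((\<kappa> * v) powr P) * (indicator \<Omega> z + ennreal (min (cmod (f z) / v) 1 powr P))"
        using g_le
      proof eventually_elim
        case (elim z)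
        then have gz: "cmod (g z) \<le> \<kappa> * v" by (simp add: \<kappa>_def)
        show ?case
        proof (cases "z \<in> \<Omega>")
          case True
          have "ennreal (cmod (g z) powr P) \<le> ennreal ((\<kappa> * v) powr P) * 1"
            using gz P(2) by (auto intro!: ennreal_leI powr_mono2)
          also have "\<dots> \<le> ennreal ((\<kappa> * v) powr P) * (indicator \<Omega> z + ennreal (min (cmod (f z) / v) 1 powr P))"
            using True by (intro mult_left_mono) auto
          finally show ?thesis .
        next
          case False
          then have eq: "cmod (g z) = cmod (f z)" using g_off by metis
          have "cmod (f z) \<le> (\<kappa> * v) * min (cmod (f z) / v) 1"
          proof (cases "cmod (f z) \<le> v")
            case True
            then have "min (cmod (f z) / v) 1 = cmod (f z) / v" using v by (simp add: min_def)
            moreover have "1 * cmod (f z) \<le> \<kappa> * cmod (f z)" using \<kappa> by (intro mult_right_mono) auto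
            ultimately show ?thesis using v by simp
          next
            case False
            then have "min (cmod (f z) / v) 1 = 1" using v by (simp add: min_def)
            then show ?thesis using gz eq by simp
          qed
          then have "cmod (f z) powr P \<le> ((\<kappa> * v) * min (cmod (f z) / v) 1) powr P"
            using P(2) by (intro powr_mono2) auto
          also have "\<dots> = (\<kappa> * v) powr P * min (cmod (f z) / v) 1 powr P"
            by (rule powr_mult)
          finally have "ennreal (cmod (f z) powr P) \<le> ennreal ((\<kappa> * v) powr P) * ennreal (min (cmod (f z) / v) 1 powr P)"
            by (simp add: ennreal_leI flip: ennreal_mult)
          then show ?thesis using False eq by simp
        qed
      qed
    qed
    also have "\<dots> = ennreal ((\<kappa> * v) powr P) * (emeasure rho \<Omega> + E)"
      unfolding E_def by (simp add: nn_integral_cmult nn_integral_add)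
    also have "\<dots> \<le> ennreal ((\<kappa> * v) powr P) * (ennreal (2 * t powr q) + ennreal (t powr q))"
      by (intro mult_left_mono add_mono \<Omega>_le' E_le) simp
    also have "\<dots> = ennreal ((\<kappa> * v) powr P * (3 * t powr q))"
      by (simp flip: ennreal_plus ennreal_mult)
    finally have I: "power_mass rho P g \<le> ennreal ((\<kappa> * v) powr P * (3 * t powr q))" .
    then have "power_mass rho P g < \<infinity>" by (rule le_less_trans) simp
    then have carr: "g \<in> carr (Lp rho (ereal P))" using P(2) g by (simp add: carr_Lp_real)
    have "nrm (Lp rho (ereal P)) g = enn2real (power_mass rho P g) powr (1 / P)"
      using carr P(2) by (intro nrm_Lp_real) auto
    also have "\<dots> \<le> ((\<kappa> * v) powr P * (3 * t powr q)) powr (1 / P)"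
      using P(2) I by (intro powr_mono2 enn2real_leI) auto
    also have "\<dots> = \<kappa> * v * (3 powr (1 / P) * t powr (q * \<beta>))"
      using P \<kappa> v t by (simp add: powr_mult powr_powr \<beta>_def recip_def)
    also have "\<dots> \<le> \<kappa> * v * (3 * t powr (q * \<beta>))"
    proof -
      have "3 powr (1 / P) \<le> (3::real) powr 1" using P(2) by (intro powr_mono) auto
      then show ?thesis using \<kappa> v by (intro mult_left_mono mult_right_mono) auto
    qed
    finally show ?thesis using carr P(1) by (simp add: mult_ac)
  qed
  then have g_carr: "g \<in> carr (Lp rho p\<^sub>1)" and g_nrm: "nrm (Lp rho p\<^sub>1) g \<le> 3 * \<kappa> * v * t powr (q * \<beta>)" by auto
  have fbg: "f = (\<lambda>z. f z - g z) + g" by (simp add: fun_eq_iff)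
  then show "f \<in> sum_carr H1 (Lp rho p\<^sub>1)" unfolding sum_carr_def using b g_carr by blast
  have "K_functional t f H1 (Lp rho p\<^sub>1) \<le> nrm H1 (\<lambda>z. f z - g z) + t * nrm (Lp rho p\<^sub>1) g"
    by (rule K_functional_le[OF b g_carr fbg t])
  also have "\<dots> \<le> 6 * \<kappa> * (v * t powr q) + t * (3 * \<kappa> * v * t powr (q * \<beta>))"
    using b_nrm g_nrm t by (intro add_mono mult_left_mono) auto
  also have "t * (3 * \<kappa> * v * t powr (q * \<beta>)) = 3 * \<kappa> * v * t powr q"
    using t powr_add[of t 1 "q * \<beta>"] by (simp add: q\<beta>)
  finally show "K_functional t f H1 (Lp rho p\<^sub>1) \<le> 9 * 2 ^ CARD('n) * v * t powr q"
    by (simp add: \<kappa>_def mult_ac)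
qed

section \<open>The interpolation theorem\<close>

text \<open>
  By the layer cake formula and \<open>nn_integral_swap_levels\<close>, the left-hand side is the integral of
  \<open>q t\<^sup>q\<^sup>-\<^sup>1 p v\<^sup>p\<^sup>-\<^sup>1\<close> over the pairs with \<open>t\<^sup>q < m(v)\<close>, where \<open>m\<close> is the distribution function of \<open>f\<close>. These
  pairs satisfy \<open>v \<le> 4 K(t) / t\<^sup>q\<close>. The constant is moved to the left-hand side first, which avoids the question of
  the measurability of \<open>K\<close>.
\<close>

lemma Lp_power_le_interp_power:
  fixes f :: "(real^'n) \<times> real \<Rightarrow> complex"
  assumes f: "f \<in> sum_carr H1 (Lp rho p\<^sub>1)" and p: "1 < p" "1 < p\<^sub>1" and q: "q = 1 / (1 - recip p\<^sub>1)"
    and \<theta>: "\<theta> * p = q * (p - 1)"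
  shows "power_mass rho p f
    \<le> ennreal (q * 8 powr p) * (\<integral>\<^sup>+t\<in>{0<..}. ennreal ((t powr (- \<theta>) * K_functional t f H1 (Lp rho p\<^sub>1)) powr p / t) \<partial>lborel)"
    (is "?J \<le> _ * ?L")
proof -
  interpret sigma_finite_measure "rho :: ((real^'n) \<times> real) measure" by (rule sigma_finite_rho)
  note f_meas [measurable] = sum_carr_measurable[OF f]
  have q0: "0 < q" using recip_bounds[OF p(2)] by (simp add: q)
  define K where "K t = K_functional t f H1 (Lp rho p\<^sub>1)" for t
  define m where "m v = emeasure rho {z \<in> space rho. v < cmod (f z)}" for v
  have m_meas [measurable]: "m \<in> borel_measurable borel"
  proof -
    have eq: "m v = (\<integral>\<^sup>+z. indicator {z. v < cmod (f z)} z \<partial>rho)" for v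
    proof -
      have "m v = (\<integral>\<^sup>+z. indicator {z \<in> space rho. v < cmod (f z)} z \<partial>rho)"
        unfolding m_def by (intro nn_integral_indicator[symmetric]) measurable
      also have "\<dots> = (\<integral>\<^sup>+z. indicator {z. v < cmod (f z)} z \<partial>rho)"
        by (intro nn_integral_cong) (auto split: split_indicator)
      finally show ?thesis .
    qed
    have "(\<lambda>(v, z). indicator {z. v < cmod (f z)} z :: ennreal) \<in> borel_measurable (borel \<Otimes>\<^sub>M rho)"
      by (simp add: indicator_def case_prod_beta)
    then show ?thesis
      unfolding eq[abs_def] by (rule borel_measurable_nn_integral)
  qed
  define c where "c = 1 / (q * 8 powr p)"
  have c: "0 < c" using q0 by (simp add: c_def)
  define w where "w v = ennreal c * (height_weight p v)" for v :: real
  have [measurable]: "w \<in> borel_measurable borel" unfolding w_def[abs_def] by measurable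
  have "ennreal c * ?J = ennreal c * (\<integral>\<^sup>+v. height_weight p v * m v \<partial>lborel)"
    using nn_integral_layer_cake[OF f_meas, of p] p by (simp add: m_def)
  also have "\<dots> = (\<integral>\<^sup>+v. w v * m v \<partial>lborel)"
    by (subst nn_integral_cmult[symmetric]) (auto simp: w_def mult.assoc)
  also have "\<dots> = (\<integral>\<^sup>+t. (\<integral>\<^sup>+v. w v * (ennreal (q * t powr (q - 1)) * indicator (sublevel q (m v)) t) \<partial>lborel) \<partial>lborel)"
    by (rule nn_integral_swap_levels[OF q0]) auto
  also have "\<dots> \<le> (\<integral>\<^sup>+t\<in>{0<..}. ennreal ((t powr (- \<theta>) * K t) powr p / t) \<partial>lborel)"
  proof (intro nn_integral_mono)
    fix t :: real
    show "(\<integral>\<^sup>+v. w v * (ennreal (q * t powr (q - 1)) * indicator (sublevel q (m v)) t) \<partial>lborel)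
      \<le> ennreal ((t powr (- \<theta>) * K t) powr p / t) * indicator {0<..} t"
    proof (cases "0 < t")
      case t: True
      have K0: "0 \<le> K t" unfolding K_def by (rule K_functional_nonneg[OF f t])
      \<comment> \<open>the factor 8 instead of 4 turns \<open>v \<le> 4 K(t) / t\<^sup>q\<close> into a strict inequality\<close>
      define s where "s = 8 * K t / t powr q"
      have s: "0 \<le> s" using K0 t by (simp add: s_def)
      have "(\<integral>\<^sup>+v. w v * (ennreal (q * t powr (q - 1)) * indicator (sublevel q (m v)) t) \<partial>lborel)
          \<le> (\<integral>\<^sup>+v. ennreal (c * q * t powr (q - 1)) * (ennreal (p * v powr (p - 1)) * indicator {0<..<s} v) \<partial>lborel)"
      proof (intro nn_integral_mono)
        fix v :: real
        have "v \<in> {0<..<s}" if v: "0 < v" "t \<in> sublevel q (m v)"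
        proof -
          have "v * t powr q \<le> 4 * K t"
            using level_le_K_functional[OF f p(2) q v(1) t] v(2) by (simp add: sublevel_def m_def K_def)
          moreover have "0 < v * t powr q" using v t by simp
          ultimately have "v * t powr q < 8 * K t" by linarith
          then show ?thesis using v t by (simp add: s_def less_divide_eq)
        qed
        then show "w v * (ennreal (q * t powr (q - 1)) * indicator (sublevel q (m v)) t)
            \<le> ennreal (c * q * t powr (q - 1)) * (ennreal (p * v powr (p - 1)) * indicator {0<..<s} v)"
          using c q0 by (auto simp: w_def ennreal_mult mult_ac split: split_indicator)
      qed
      also have "\<dots> = ennreal (c * q * t powr (q - 1)) * ennreal (s powr p)"
        using p s by (subst nn_integral_cmult) (auto simp: nn_integral_powr_cmult)
      also have "\<dots> = ennreal (c * q * t powr (q - 1) * s powr p)"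
        using c q0 by (intro ennreal_mult[symmetric]) auto
      also have "c * q * t powr (q - 1) * s powr p = (t powr (- \<theta>) * K t) powr p / t"
      proof -
        have "s powr p = 8 powr p * K t powr p / (t powr q) powr p"
          using K0 t by (simp add: s_def powr_divide powr_mult)
        moreover have "c * q * 8 powr p = 1" using q0 by (simp add: c_def)
        ultimately have "c * q * t powr (q - 1) * s powr p = t powr (q - 1) * (K t powr p / (t powr q) powr p)"
          by (simp add: field_simps)
        also have "\<dots> = K t powr p * t powr (q - 1 - q * p)"
          using t by (simp add: powr_powr powr_diff)
        also have "q - 1 - q * p = - \<theta> * p - 1" using \<theta> by (simp add: algebra_simps)
        also have "K t powr p * t powr (- \<theta> * p - 1) = (t powr (- \<theta>) * K t) powr p / t"
          using t K0 powr_diff[of t "- \<theta> * p" 1] by (simp add: powr_mult powr_powr)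
        finally show ?thesis .
      qed
      finally show ?thesis using t by simp
    qed (simp add: sublevel_def)
  qed
  finally have "ennreal c * ?J \<le> ?L" by (simp add: K_def)
  then have "ennreal (q * 8 powr p) * (ennreal c * ?J) \<le> ennreal (q * 8 powr p) * ?L"
    by (intro mult_left_mono) auto
  moreover have "ennreal (q * 8 powr p) * ennreal c = 1"
    using q0 by (simp add: c_def flip: ennreal_mult)
  ultimately show ?thesis by (simp add: mult.assoc[symmetric])
qed

text \<open>
  Write \<open>(K(t) / (C t\<^sup>q))\<^sup>p\<close> as the integral of \<open>p v\<^sup>p\<^sup>-\<^sup>1\<close> over \<open>0 < v < K(t) / (C t\<^sup>q)\<close>. For these \<open>v\<close>,
  \<open>K_functional_le_excess\<close> forces \<open>t\<^sup>q < D(v)\<close>, and \<open>nn_integral_swap_levels\<close> leaves the integral of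
  \<open>p v\<^sup>p\<^sup>-\<^sup>1 D(v)\<close>. Its finiteness also provides a height \<open>v\<close> with \<open>D(v) < \<infinity>\<close>, and hence a decomposition of
  \<open>f\<close>.
\<close>

lemma interp_power_le_Lp_power:
  assumes p: "1 < p" "ereal p < p\<^sub>1" and q: "q = 1 / (1 - recip p\<^sub>1)"
    and \<theta>: "\<theta> * p = q * (p - 1)"
  shows "\<exists>C>0. \<forall>f :: (real^'n) \<times> real \<Rightarrow> complex. f \<in> carr (Lp rho (ereal p)) \<longrightarrow>
    f \<in> sum_carr H1 (Lp rho p\<^sub>1) \<and>
    (\<integral>\<^sup>+t\<in>{0<..}. ennreal ((t powr (- \<theta>) * K_functional t f H1 (Lp rho p\<^sub>1)) powr p / t) \<partial>lborel)
      \<le> ennreal C * power_mass rho p f"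
proof -
  interpret sigma_finite_measure "rho :: ((real^'n) \<times> real) measure" by (rule sigma_finite_rho)
  have p1: "1 < p\<^sub>1" using p by (cases p\<^sub>1) auto
  have q0: "0 < q" using recip_bounds[OF p1] by (simp add: q)
  obtain B where B0: "0 < B"
    and B1: "\<forall>f\<in>borel_measurable (rho :: ((real^'n) \<times> real) measure).
      (\<integral>\<^sup>+v. height_weight p v * excess p\<^sub>1 f v \<partial>lborel)
        \<le> ennreal B * power_mass rho p f"
    using nn_integral_excess[OF p] by (elim exE conjE)
  define C :: real where "C = 9 * 2 ^ CARD('n)"
  have C: "0 < C" by (simp add: C_def)
  have "f \<in> sum_carr H1 (Lp rho p\<^sub>1) \<and>
    (\<integral>\<^sup>+t\<in>{0<..}. ennreal ((t powr (- \<theta>) * K_functional t f H1 (Lp rho p\<^sub>1)) powr p / t) \<partial>lborel)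
      \<le> ennreal (C powr p / q * B) * power_mass rho p f"
    if fL: "f \<in> carr (Lp rho (ereal p))" for f :: "(real^'n) \<times> real \<Rightarrow> complex"
  proof
    have f [measurable]: "f \<in> borel_measurable rho" by (rule carr_Lp_measurable[OF fL])
    have Jfin: "power_mass rho p f < \<infinity>"
      using fL p by (simp add: carr_Lp_real)
    define D where "D = excess p\<^sub>1 f"
    have D_meas [measurable]: "D \<in> borel_measurable borel"
      unfolding D_def by (rule excess_measurable[OF f p])
    define w where "w v = height_weight p v" for v :: real
    have w_meas [measurable]: "w \<in> borel_measurable borel" unfolding w_def[abs_def] by measurable
    have wD: "(\<integral>\<^sup>+v. w v * D v \<partial>lborel) \<le> ennreal B * power_mass rho p f"
      unfolding w_def D_def using B1 f by (rule bspec)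
    also have "\<dots> < \<infinity>" using Jfin by (simp add: ennreal_mult_less_top)
    finally have "AE v in lborel. w v * D v \<noteq> \<infinity>"
      by (intro nn_integral_PInf_AE) auto
    moreover have "\<not> (AE v in lborel. v \<notin> {0<..<1::real})"
    proof
      assume "AE v in lborel. v \<notin> {0<..<1::real}"
      then have "emeasure lborel {0<..<1::real} = 0"
        by (subst (asm) AE_iff_measurable[of "{0<..<1}"]) auto
      then show False by simp
    qed
    ultimately obtain v where v: "0 < v" "w v * D v \<noteq> \<infinity>"
    proof -
      assume thesis: "\<And>v. 0 < v \<Longrightarrow> w v * D v \<noteq> \<infinity> \<Longrightarrow> thesis"
      assume fin: "AE v in lborel. w v * D v \<noteq> \<infinity>" and no: "\<not> (AE v in lborel. v \<notin> {0<..<1::real})"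
      have "\<exists>v>0. w v * D v \<noteq> \<infinity>"
      proof (rule ccontr)
        assume none: "\<not> (\<exists>v>0. w v * D v \<noteq> \<infinity>)"
        from fin have "AE v in lborel. v \<notin> {0<..<1::real}"
        proof eventually_elim
          case (elim v)
          then show ?case using none by auto
        qed
        then show False using no by blast
      qed
      then show thesis using thesis by blast
    qed
    then have "D v \<noteq> \<infinity>" using p by (auto simp: w_def ennreal_mult_eq_top_iff)
    then obtain y where y: "D v = ennreal y" "0 \<le> y" by (cases "D v") auto
    define t where "t = (y + 1) powr (1 / q)"
    have "D v \<le> ennreal (t powr q)"
      using y q0 by (simp add: t_def powr_powr ennreal_leI)
    moreover have "0 < t" using y by (simp add: t_def)
    ultimately show sum: "f \<in> sum_carr H1 (Lp rho p\<^sub>1)"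
      using K_functional_le_excess(1)[OF f p1 q v(1)] by (simp add: D_def)
    define K where "K t = K_functional t f H1 (Lp rho p\<^sub>1)" for t
    have "(\<integral>\<^sup>+t\<in>{0<..}. ennreal ((t powr (- \<theta>) * K t) powr p / t) \<partial>lborel)
        \<le> (\<integral>\<^sup>+t. (\<integral>\<^sup>+v. ennreal (C powr p / q) * w v * (ennreal (q * t powr (q - 1)) * indicator (sublevel q (D v)) t) \<partial>lborel) \<partial>lborel)"
    proof (intro nn_integral_mono)
      fix t :: real
      show "ennreal ((t powr (- \<theta>) * K t) powr p / t) * indicator {0<..} t
          \<le> (\<integral>\<^sup>+v. ennreal (C powr p / q) * w v * (ennreal (q * t powr (q - 1)) * indicator (sublevel q (D v)) t) \<partial>lborel)"
      proof (cases "0 < t")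
        case t: True
        have K0: "0 \<le> K t" unfolding K_def by (rule K_functional_nonneg[OF sum t])
        define s where "s = K t / (C * t powr q)"
        have s: "0 \<le> s" using K0 C t by (simp add: s_def)
        have "(t powr (- \<theta>) * K t) powr p / t = C powr p * t powr (q - 1) * s powr p"
        proof -
          have "s powr p = K t powr p / (C powr p * (t powr q) powr p)"
            using K0 C t by (simp add: s_def powr_divide powr_mult)
          then have "C powr p * t powr (q - 1) * s powr p = K t powr p * t powr (q - 1 - q * p)"
            using C t by (simp add: powr_powr powr_diff)
          also have "q - 1 - q * p = - \<theta> * p - 1" using \<theta> by (simp add: algebra_simps)
          also have "K t powr p * t powr (- \<theta> * p - 1) = (t powr (- \<theta>) * K t) powr p / t"
            using t K0 powr_diff[of t "- \<theta> * p" 1] by (simp add: powr_mult powr_powr)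
          finally show ?thesis by simp
        qed
        then have "ennreal ((t powr (- \<theta>) * K t) powr p / t) = ennreal (C powr p * t powr (q - 1)) * ennreal (s powr p)"
          by (simp add: ennreal_mult)
        also have "\<dots> = (\<integral>\<^sup>+v. ennreal (C powr p * t powr (q - 1)) * (ennreal (p * v powr (p - 1)) * indicator {0<..<s} v) \<partial>lborel)"
          using p s by (subst nn_integral_cmult) (auto simp: nn_integral_powr_cmult)
        also have "\<dots> \<le> (\<integral>\<^sup>+v. ennreal (C powr p / q) * w v * (ennreal (q * t powr (q - 1)) * indicator (sublevel q (D v)) t) \<partial>lborel)"
        proof (intro nn_integral_mono)
          fix v :: real
          have "t \<in> sublevel q (D v)" if v: "0 < v" "v < s"
          proof (rule ccontr)
            assume "t \<notin> sublevel q (D v)"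
            then have "D v \<le> ennreal (t powr q)" using t by (simp add: sublevel_def not_less)
            then have "K t \<le> C * v * t powr q"
              using K_functional_le_excess(2)[OF f p1 q v(1) t] by (simp add: D_def K_def C_def)
            then have "s \<le> v" using C t by (simp add: s_def divide_le_eq mult_ac)
            then show False using v by simp
          qed
          moreover have "ennreal (C powr p * t powr (q - 1)) = ennreal (C powr p / q) * ennreal (q * t powr (q - 1))"
            using q0 by (subst ennreal_mult[symmetric]) auto
          ultimately show "ennreal (C powr p * t powr (q - 1)) * (ennreal (p * v powr (p - 1)) * indicator {0<..<s} v)
              \<le> ennreal (C powr p / q) * w v * (ennreal (q * t powr (q - 1)) * indicator (sublevel q (D v)) t)"
            by (auto simp: w_def mult_ac split: split_indicator)
        qed
        finally show ?thesis using t by simp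
      qed simp
    qed
    also have "\<dots> = (\<integral>\<^sup>+v. ennreal (C powr p / q) * w v * D v \<partial>lborel)"
      by (rule nn_integral_swap_levels[OF q0, symmetric]) measurable
    also have "\<dots> = ennreal (C powr p / q) * (\<integral>\<^sup>+v. w v * D v \<partial>lborel)"
      by (subst nn_integral_cmult[symmetric]) (auto simp: mult.assoc)
    also have "\<dots> \<le> ennreal (C powr p / q) * (ennreal B * power_mass rho p f)"
      by (intro mult_left_mono wD) simp
    also have "\<dots> = ennreal (C powr p / q * B) * power_mass rho p f"
      unfolding mult.assoc[symmetric] using q0 B0 by (subst ennreal_mult) auto
    finally show "(\<integral>\<^sup>+t\<in>{0<..}. ennreal ((t powr (- \<theta>) * K_functional t f H1 (Lp rho p\<^sub>1)) powr p / t) \<partial>lborel)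
      \<le> ennreal (C powr p / q * B) * power_mass rho p f"
      by (simp add: K_def)
  qed
  then show ?thesis
    using C q0 B0 by (intro exI[of _ "C powr p / q * B"]) auto
qed

lemma conjugate_exponent_identity:
  assumes "1 < p" "ereal p < p\<^sub>1" "1 / ereal p = 1 - ereal \<theta> + ereal \<theta> / p\<^sub>1"
  shows "\<theta> * p = 1 / (1 - recip p\<^sub>1) * (p - 1)"
proof (cases p\<^sub>1)
  case (real P)
  then have P: "1 < P" using assms by simp
  have "1 / ereal p = ereal (1 / p)" "ereal \<theta> / ereal P = ereal (\<theta> / P)"
    using assms(1) P by (simp_all add: one_ereal_def)
  then have "1 / p = 1 - \<theta> + \<theta> / P" using assms(3) real by (simp add: one_ereal_def)
  then have "\<theta> * (1 - 1 / P) = 1 - 1 / p" by (simp add: algebra_simps)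
  then have "\<theta> * (1 - 1 / P) * p = p - 1" using assms(1) by (simp add: field_simps)
  moreover have "0 < 1 - 1 / P" using P by simp
  ultimately have "\<theta> * p = (p - 1) / (1 - 1 / P)"
    using P by (subst eq_divide_eq) (simp add: mult_ac)
  then show ?thesis using real by (simp add: recip_def)
next
  case PInf
  have "1 / ereal p = ereal (1 / p)" using assms(1) by (simp add: one_ereal_def)
  then have "1 / p = 1 - \<theta>" using assms(3) PInf by (simp add: one_ereal_def)
  then have "\<theta> * p = p - 1" using assms(1) by (simp add: field_simps)
  then show ?thesis using PInf by (simp add: recip_def)
qed (use assms in simp)

lemma enn2real_root_le:
  assumes "I \<le> ennreal C * J" "J < \<infinity>" "0 < C" "0 < p"
  shows "enn2real I powr (1 / p) \<le> C powr (1 / p) * enn2real J powr (1 / p)"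
proof -
  obtain j where j: "J = ennreal j" "0 \<le> j" using assms(2) by (cases J) auto
  then have "I \<le> ennreal (C * j)" using assms by (simp add: ennreal_mult)
  then have "enn2real I \<le> C * j" using assms j by (intro enn2real_leI) auto
  then have "enn2real I powr (1 / p) \<le> (C * j) powr (1 / p)"
    using assms by (intro powr_mono2) auto
  then show ?thesis using assms j by (simp add: powr_mult)
qed

theorem theorem5p2:
  fixes p \<theta> :: real and p\<^sub>1 :: ereal
  assumes "1 < p" and "ereal p < p\<^sub>1" and "p\<^sub>1 \<le> \<infinity>"
    and "0 < \<theta>" and "\<theta> < 1"
    and "1 / ereal p = 1 - ereal \<theta> + ereal \<theta> / p\<^sub>1"
  shows "nspace_equiv
    (real_interp (H1 :: ((real^'n) \<times> real \<Rightarrow> complex) nspace) (Lp rho p\<^sub>1) \<theta> (ereal p))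
    (Lp rho (ereal p))"
proof -
  let ?X = "real_interp (H1 :: ((real^'n) \<times> real \<Rightarrow> complex) nspace) (Lp rho p\<^sub>1) \<theta> (ereal p)"
  let ?Y = "Lp (rho :: ((real^'n) \<times> real) measure) (ereal p)"
  define q where "q = 1 / (1 - recip p\<^sub>1)"
  have p1: "1 < p\<^sub>1" using assms(1,2) by (cases p\<^sub>1) auto
  have q0: "0 < q" using recip_bounds[OF p1] by (simp add: q_def)
  have \<theta>: "\<theta> * p = q * (p - 1)"
    unfolding q_def by (rule conjugate_exponent_identity[OF assms(1,2,6)])
  define L where "L f = (\<integral>\<^sup>+t\<in>{0<..}. ennreal ((t powr (- \<theta>) * K_functional t f H1 (Lp rho p\<^sub>1)) powr p / t) \<partial>lborel)"
    for f :: "(real^'n) \<times> real \<Rightarrow> complex"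
  define J where "J f = power_mass rho p f" for f :: "(real^'n) \<times> real \<Rightarrow> complex"
  define A where "A = q * 8 powr p"
  have A: "0 < A" using q0 by (simp add: A_def)
  have J_le: "J f \<le> ennreal A * L f" if "f \<in> sum_carr H1 (Lp rho p\<^sub>1)" for f
    unfolding J_def L_def A_def by (rule Lp_power_le_interp_power[OF that assms(1) p1 q_def \<theta>])
  have "\<exists>C>0. \<forall>f. f \<in> carr ?Y \<longrightarrow> f \<in> sum_carr H1 (Lp rho p\<^sub>1) \<and> L f \<le> ennreal C * J f"
    unfolding L_def J_def by (rule interp_power_le_Lp_power[OF assms(1,2) q_def \<theta>])
  then obtain C where C0: "0 < C"
    and C1: "\<forall>f. f \<in> carr ?Y \<longrightarrow> f \<in> sum_carr H1 (Lp rho p\<^sub>1) \<and> L f \<le> ennreal C * J f"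
    by blast
  have C: "0 < C" "f \<in> carr ?Y \<Longrightarrow> f \<in> sum_carr H1 (Lp rho p\<^sub>1) \<and> L f \<le> ennreal C * J f" for f
    using C0 C1 by simp_all
  have X_carr: "f \<in> carr ?X \<longleftrightarrow> f \<in> sum_carr H1 (Lp rho p\<^sub>1) \<and> L f < \<infinity>" for f
    by (auto simp: real_interp_def interp_enorm_def ennreal_powr_def L_def less_top)
  have X_nrm: "nrm ?X f = enn2real (L f) powr (1 / p)" if "L f < \<infinity>" for f
    using that by (auto simp: real_interp_def interp_enorm_def ennreal_powr_def L_def)
  have Y_carr: "f \<in> carr ?Y \<longleftrightarrow> f \<in> borel_measurable rho \<and> J f < \<infinity>" for f
    using assms(1) unfolding J_def by (intro carr_Lp_real) simp
  have Y_nrm: "nrm ?Y f = enn2real (J f) powr (1 / p)" if "f \<in> carr ?Y" for f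
    using that assms(1) unfolding J_def by (intro nrm_Lp_real) auto
  have XY: "f \<in> carr ?Y" if f: "f \<in> carr ?X" for f
  proof -
    have "f \<in> borel_measurable rho" using f by (intro sum_carr_measurable[of f p\<^sub>1]) (simp add: X_carr)
    moreover have "J f < \<infinity>"
      using J_le[of f] f by (auto simp: X_carr ennreal_mult_less_top intro: le_less_trans)
    ultimately show ?thesis by (simp add: Y_carr)
  qed
  have YX: "f \<in> carr ?X" if f: "f \<in> carr ?Y" for f
    using C(2)[OF f] f by (auto simp: X_carr Y_carr ennreal_mult_less_top intro: le_less_trans)
  have up: "nrm ?Y f \<le> A powr (1 / p) * nrm ?X f" if f: "f \<in> carr ?X" for f
    using enn2real_root_le[OF J_le _ A, of f p] f XY[OF f] assms(1)
    by (simp add: X_carr X_nrm Y_nrm)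
  have low: "nrm ?X f \<le> C powr (1 / p) * nrm ?Y f" if f: "f \<in> carr ?X" for f
    using enn2real_root_le[of "L f" C "J f" p] C(1) C(2)[OF XY[OF f]] f XY[OF f] assms(1)
    by (simp add: X_carr X_nrm Y_nrm Y_carr)
  show ?thesis
    unfolding nspace_equiv_def
  proof (intro conjI)
    show "carr ?X = carr ?Y" using XY YX by blast
    show "\<exists>c>0. \<exists>C>0. \<forall>x\<in>carr ?X. c * nrm ?X x \<le> nrm ?Y x \<and> nrm ?Y x \<le> C * nrm ?X x"
    proof (intro exI conjI ballI)
      show "0 < 1 / C powr (1 / p)" "0 < A powr (1 / p)" using C(1) A by auto
      fix f assume f: "f \<in> carr ?X"
      show "1 / C powr (1 / p) * nrm ?X f \<le> nrm ?Y f"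
        using low[OF f] C(1) by (simp add: divide_le_eq mult.commute)
      show "nrm ?Y f \<le> A powr (1 / p) * nrm ?X f" by (rule up[OF f])
    qed
  qed
qed

end
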